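(* There exists $\beta_0<0$ such that the following holds. For $\beta\in\mathbb{R}$ let $s_\beta$ be the Ising model over the (planar) triangular lattice with inverse temperature $\beta$, and let $\beta_c>0$ be its critical parameter. Let $\sigma_\beta:\mathbb{R}^2\to\{0,1\}$ be the associated random planar colouring, in which each hexagon of the dual lattice is painted with the value of the spin at its center, and let $T_\beta(x,y)=\inf_\gamma\int_\gamma\sigma_\beta$, the infimum being over piecewise $C^1$ paths from $x$ to $y$ (arc length integral). If $\beta\in\,]\beta_0,\beta_c[$, then $\mu_\beta=0$, where $\mu_\beta(v)=\lim_{n\to\infty}\frac1nT_\beta(0,nv)$ (almost sure and $L^1$ limit), $v\in\mathbb{R}^2$, is the time constant associated with $\sigma_\beta$.
   Context: The Ising model at inverse temperature $\beta=1/\text{temperature}$ is the infinite-volume Gibbs measure on spin configurations $s\in\{-1,+1\}^{V}$, $V$ the vertices of the triangular lattice, with formal weight $\exp(\beta\sum_{x\sim y}s_xs_y)$; $\beta>0$ is the ferromagnetic case and $\beta<0$ the antiferromagnetic case. $\beta_c>0$ is the critical inverse temperature of the ferromagnetic model. The colour is $0$ on hexagons of spin $-1$ and $1$ on hexagons of spin $+1$; points lying on several hexagons get value $0$ if at least one of these hexagons has value $0$. *)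

theory Defs
  imports "HOL-Probability.Probability"
begin

text \<open>Vertices of the triangular lattice are indexed by integer coordinates in the basis
  $1, e^{i\pi/3}$; the mesh is 1.\<close>

type_synonym vertex = "int \<times> int"
type_synonym spins = "vertex \<Rightarrow> real"

definition site :: "vertex \<Rightarrow> real ^ 2" where
  "site x = vector [of_int (fst x) + of_int (snd x) / 2, of_int (snd x) * sqrt 3 / 2]"

definition edges :: "vertex set set" where
  "edges = {{x, y} | x y. dist (site x) (site y) = 1}"

text \<open>The closed hexagon of the dual lattice around a vertex, i.e. its Voronoi cell.\<close>

definition hexagon :: "vertex \<Rightarrow> (real ^ 2) set" where
  "hexagon x = {p. \<forall>y. dist p (site x) \<le> dist p (site y)}"


subsection \<open>The Ising model in infinite volume\<close>

definition spin_space :: "spins measure" where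
  "spin_space = (\<Pi>\<^sub>M x\<in>UNIV. count_space {-1, 1})"

text \<open>Each edge is counted once.  Edges disjoint from \<open>\<Lambda>\<close> contribute a factor that
  depends only on the boundary condition, and cancel in \<open>ising_kernel\<close>.\<close>

definition ising_weight :: "real \<Rightarrow> vertex set \<Rightarrow> spins \<Rightarrow> real" where
  "ising_weight \<beta> \<Lambda> s = exp (\<beta> * (\<Sum>e \<in> {e \<in> edges. e \<inter> \<Lambda> \<noteq> {}}. \<Prod>x\<in>e. s x))"

definition extensions :: "vertex set \<Rightarrow> spins \<Rightarrow> spins set" where
  "extensions \<Lambda> \<eta> = {s \<in> space spin_space. \<forall>x. x \<notin> \<Lambda> \<longrightarrow> s x = \<eta> x}"

text \<open>Finite-volume Gibbs probability of the event \<open>A\<close> in \<open>\<Lambda>\<close> with boundary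
  condition \<open>\<eta>\<close>.\<close>

definition ising_kernel :: "real \<Rightarrow> vertex set \<Rightarrow> spins \<Rightarrow> spins set \<Rightarrow> real" where
  "ising_kernel \<beta> \<Lambda> \<eta> A =
     (\<Sum>s \<in> extensions \<Lambda> \<eta> \<inter> A. ising_weight \<beta> \<Lambda> s) /
     (\<Sum>s \<in> extensions \<Lambda> \<eta>. ising_weight \<beta> \<Lambda> s)"

text \<open>Infinite-volume Gibbs measures, through the Dobrushin--Lanford--Ruelle equations.\<close>

definition ising_gibbs :: "real \<Rightarrow> spins measure \<Rightarrow> bool" where
  "ising_gibbs \<beta> M \<longleftrightarrow>
     prob_space M \<and> sets M = sets spin_space \<and>
     (\<forall>\<Lambda>. finite \<Lambda> \<longrightarrow>
        (\<forall>A \<in> sets M. measure M A = (\<integral>\<eta>. ising_kernel \<beta> \<Lambda> \<eta> A \<partial>M)))"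

text \<open>Critical inverse temperature: the threshold for phase coexistence in the ferromagnetic
  model.  The set is nonempty by Peierls' argument, so the infimum is a genuine one.\<close>

definition ising_beta_c :: real where
  "ising_beta_c = Inf {\<beta>. 0 \<le> \<beta> \<and> (\<exists>M N. ising_gibbs \<beta> M \<and> ising_gibbs \<beta> N \<and> M \<noteq> N)}"


subsection \<open>The planar colouring and its pseudometric\<close>

definition colouring :: "spins \<Rightarrow> real ^ 2 \<Rightarrow> real" where
  "colouring s p = (if \<exists>x. p \<in> hexagon x \<and> s x = -1 then 0 else 1)"

text \<open>Piecewise \<open>C\<^sup>1\<close> with one-sided derivatives at the break points.  The library notion
  \<^const>\<open>valid_path\<close> is too liberal here: it allows derivatives that are unbounded near a break
  point, so that the speed need not be integrable.\<close>

definition piecewise_C1_path :: "(real \<Rightarrow> real ^ 2) \<Rightarrow> bool" where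
  "piecewise_C1_path \<gamma> \<longleftrightarrow>
     (\<exists>(m::nat) p. p 0 = 0 \<and> p m = 1 \<and>
        (\<forall>i<m. p i < p (Suc i) \<and>
           (\<exists>D. continuous_on {p i..p (Suc i)} D \<and>
              (\<forall>t \<in> {p i..p (Suc i)}.
                 (\<gamma> has_vector_derivative D t) (at t within {p i..p (Suc i)})))))"

definition arc_length_integral :: "(real ^ 2 \<Rightarrow> real) \<Rightarrow> (real \<Rightarrow> real ^ 2) \<Rightarrow> real" where
  "arc_length_integral f \<gamma> = integral {0..1} (\<lambda>t. f (\<gamma> t) * norm (vector_derivative \<gamma> (at t)))"

definition pseudometric :: "(real ^ 2 \<Rightarrow> real) \<Rightarrow> real ^ 2 \<Rightarrow> real ^ 2 \<Rightarrow> real" where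
  "pseudometric \<sigma> x y =
     (INF \<gamma> \<in> {\<gamma>. piecewise_C1_path \<gamma> \<and> pathstart \<gamma> = x \<and> pathfinish \<gamma> = y}.
        arc_length_integral \<sigma> \<gamma>)"

text \<open>\<open>\<mu>\<close> is the time constant of the random colouring \<open>\<sigma>\<close>: the almost sure and
  \<open>L\<^sup>1\<close> limit of the rescaled pseudometric.\<close>

definition has_time_constant ::
  "'a measure \<Rightarrow> ('a \<Rightarrow> real ^ 2 \<Rightarrow> real) \<Rightarrow> (real ^ 2 \<Rightarrow> real) \<Rightarrow> bool" where
  "has_time_constant M \<sigma> \<mu> \<longleftrightarrow>
     (\<forall>v.
        (AE \<omega> in M. (\<lambda>n. pseudometric (\<sigma> \<omega>) 0 (real n *\<^sub>R v) / real n) \<longlonglongrightarrow> \<mu> v) \<and>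
        (\<forall>n. integrable M (\<lambda>\<omega>. pseudometric (\<sigma> \<omega>) 0 (real n *\<^sub>R v))) \<and>
        (\<lambda>n. \<integral>\<omega>. \<bar>pseudometric (\<sigma> \<omega>) 0 (real n *\<^sub>R v) / real n - \<mu> v\<bar> \<partial>M) \<longlonglongrightarrow> 0)"

end

theory Submission
  imports Defs
begin

text \<open>If the Gibbs measure is unique, it inherits the lattice symmetries and the spin flip, and the
  finite-volume kernels converge uniformly in the boundary condition (compactness).  Hence the spins
  far away have a uniformly small influence on a local function, and sums of translates of a local
  function obey an exponential Chernoff bound.  As the pseudometric \<open>T\<close> is an upper semicontinuous
  function of the spins, it is approximated from above by local functions; with subadditivity this
  gives \<open>T(0, nz) \<le> n (\<mu>(z) + \<epsilon>)\<close> up to an exponentially small probability, where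
  \<open>\<mu>(z) = inf E T(0, nz) / n\<close>, and then \<open>T(0, nz) \<ge> n \<mu>(z) / 2\<close> with probability close to 1.
  By the rotation symmetry \<open>\<mu>\<close> vanishes in all directions or in none.  In the second case, by a finite net
  argument, large rhombi are unlikely to be crossed at zero cost in either direction; but by the hex
  lemma and the flip symmetry, the two crossing probabilities add up to at least 1.  So \<open>\<mu> = 0\<close>, and
  Borel--Cantelli concludes.

  Gibbs measures exist for every \<open>\<beta>\<close>.  They are unique for \<open>0 \<le> \<beta> < \<beta>\<^sub>c\<close> by definition of \<open>\<beta>\<^sub>c\<close>,
  and for small negative \<open>\<beta>\<close> by Dobrushin's criterion.\<close>


text \<open>So all mixing is drawn from uniqueness alone: the exponential moment of a local
  function, conditioned on everything outside a fixed translated volume, is nearly its mean, and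
  conditioning successively gives the Chernoff bound. This bound controls upper deviations only, the
  side on which \<open>T\<close> can be replaced by a local function. Lower deviations come from the
  mean: a variable of mean at least \<mu> n that hardly ever exceeds (\<mu> + \<epsilon>) n cannot
  often be below \<mu> n / 2. As no rate results, a union bound may involve only a number of pairs
  of points that does not grow with the scale. Hence the sides of the rhombus are rounded to K + 1
  marks each, with K fixed first and so large that crossing costs more than rounding. The constant
  1/96 makes the influence of each of the 6 neighbours at most 1/12, hence the total influence at
  most 1/2.\<close>

section \<open>Geometry of the triangular lattice\<close>

text \<open>Otherwise the automation splits quantified vertices into their two coordinates.\<close>

declare split_paired_All [simp del] split_paired_Ex [simp del]

lemma site_nth [simp]:
  "site x $ 1 = of_int (fst x) + of_int (snd x) / 2" "site x $ 2 = of_int (snd x) * sqrt 3 / 2"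
  by (simp_all add: site_def)

lemma site_add: "site (x + y) = site x + site y"
  and site_diff: "site (x - y) = site x - site y"
  and site_0 [simp]: "site 0 = 0"
  by (simp_all add: vec_eq_iff forall_2 site_def field_simps)

lemma norm_vec2: "norm (v :: real ^ 2) = sqrt ((v $ 1)\<^sup>2 + (v $ 2)\<^sup>2)"
  by (simp add: norm_vec_def L2_set_def sum_2)

lemma norm_site_sq:
  "(norm (site (a, b)))\<^sup>2 = of_int (a * a + a * b + b * b)"
proof -
  have "(norm (site (a, b)))\<^sup>2 = (site (a, b) $ 1)\<^sup>2 + (site (a, b) $ 2)\<^sup>2"
    unfolding norm_vec2 by (rule real_sqrt_pow2) simp
  also have "\<dots> = of_int (a * a + a * b + b * b)"
    by (simp add: power2_eq_square field_simps)
  finally show ?thesis .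
qed

text \<open>The form is the norm of the Eisenstein integers, and its solutions are their six units.
  Completing the square in either variable bounds both by 1 in absolute value.\<close>

lemma eisenstein_norm_eq_1_iff:
  fixes a b :: int
  shows "a * a + a * b + b * b = 1 \<longleftrightarrow> (a, b) \<in> {(1,0),(-1,0),(0,1),(0,-1),(1,-1),(-1,1)}"
proof
  assume h: "a * a + a * b + b * b = 1"
  have "(2 * a + b)\<^sup>2 + 3 * b\<^sup>2 = 4" "(2 * b + a)\<^sup>2 + 3 * a\<^sup>2 = 4"
    using h by (simp_all add: power2_eq_square algebra_simps)
  then have "3 * b\<^sup>2 \<le> 4" "3 * a\<^sup>2 \<le> 4"
    by (metis le_add_same_cancel2 zero_le_power2)+
  then have "\<bar>b\<bar>\<^sup>2 < 2\<^sup>2" "\<bar>a\<bar>\<^sup>2 < 2\<^sup>2" by auto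
  then have "\<bar>b\<bar> < 2" "\<bar>a\<bar> < 2"
    by (meson power_less_imp_less_base zero_le_numeral)+
  then have "a \<in> {-1,0,1}" "b \<in> {-1,0,1}" by auto
  then show "(a, b) \<in> {(1,0),(-1,0),(0,1),(0,-1),(1,-1),(-1,1)}"
    using h by auto
qed auto

text \<open>Adjacency by the six Eisenstein units; \<open>dist_site_eq_1_iff\<close> identifies it
  with distance 1, after which spin arguments need no geometry.\<close>

definition adj :: "vertex \<Rightarrow> vertex \<Rightarrow> bool" where
  "adj x y \<longleftrightarrow> y - x \<in> {(1,0),(-1,0),(0,1),(0,-1),(1,-1),(-1,1)}"

lemma dist_site_eq_1_iff: "dist (site x) (site y) = 1 \<longleftrightarrow> adj x y"
proof -
  obtain a b where ab: "y - x = (a, b)" by fastforce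
  have "dist (site x) (site y) = norm (site (y - x))"
    by (simp add: site_diff dist_norm norm_minus_commute)
  then have "dist (site x) (site y) = 1 \<longleftrightarrow> (norm (site (a, b)))\<^sup>2 = 1"
    unfolding ab using norm_ge_zero[of "site (a, b)"] unfolding power2_eq_1_iff by linarith
  also have "\<dots> \<longleftrightarrow> a * a + a * b + b * b = 1"
    unfolding norm_site_sq by linarith
  finally show ?thesis
    unfolding adj_def ab eisenstein_norm_eq_1_iff by simp
qed

lemma edges_eq: "edges = {{x, y} | x y. adj x y}"
  unfolding edges_def dist_site_eq_1_iff ..

lemma adj_sym: "adj x y \<Longrightarrow> adj y x"
  by (metis dist_commute dist_site_eq_1_iff)

lemma adj_irrefl: "\<not> adj x x"
  by (simp add: adj_def zero_prod_def)

lemma adj_subset: "{y. adj x y} \<subseteq> (\<lambda>d. x + d) ` {(1,0),(-1,0),(0,1),(0,-1),(1,-1),(-1,1)}"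
proof
  fix y assume "y \<in> {y. adj x y}"
  then have "y - x \<in> {(1,0),(-1,0),(0,1),(0,-1),(1,-1),(-1,1)}"
    by (simp only: adj_def mem_Collect_eq)
  moreover have "y = x + (y - x)" by simp
  ultimately show "y \<in> (\<lambda>d. x + d) ` {(1,0),(-1,0),(0,1),(0,-1),(1,-1),(-1,1)}"
    by (rule rev_image_eqI)
qed

lemma finite_adj: "finite {y. adj x y}"
  by (rule finite_subset[OF adj_subset]) (intro finite_imageI finite.intros)

lemma card_adj: "card {y. adj x y} \<le> 6"
proof -
  have "card {y. adj x y} \<le> card ((\<lambda>d. x + d) ` {(1::int,0::int),(-1,0),(0,1),(0,-1),(1,-1),(-1,1)})"
    by (intro card_mono adj_subset finite_imageI finite.intros)
  also have "\<dots> \<le> card {(1::int,0::int),(-1,0),(0,1),(0,-1),(1,-1),(-1,1)}"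
    by (intro card_image_le finite.intros)
  finally show ?thesis by simp
qed

lemma edge_obtain:
  assumes "e \<in> edges" "x \<in> e"
  shows "\<exists>y. e = {x, y} \<and> adj x y \<and> x \<noteq> y"
proof -
  obtain a b where ab: "e = {a, b}" "adj a b"
    using assms(1) unfolding edges_eq by blast
  then have "adj b a" "a \<noteq> b" using adj_sym adj_irrefl by blast+
  with ab assms(2) show ?thesis by (metis insert_commute insertE singletonD)
qed

lemma finite_edges_touching:
  assumes "finite L"
  shows "finite {e \<in> edges. e \<inter> L \<noteq> {}}"
proof -
  have "{e \<in> edges. e \<inter> L \<noteq> {}} \<subseteq> (\<Union>x\<in>L. (\<lambda>y. {x, y}) ` {y. adj x y})"
  proof
    fix e assume "e \<in> {e \<in> edges. e \<inter> L \<noteq> {}}"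
    then obtain x where "e \<in> edges" "x \<in> e" "x \<in> L" by blast
    then show "e \<in> (\<Union>x\<in>L. (\<lambda>y. {x, y}) ` {y. adj x y})"
      using edge_obtain by fast
  qed
  then show ?thesis
    by (rule finite_subset) (auto simp: assms finite_adj)
qed


section \<open>Finite-volume Gibbs expectations\<close>

text \<open>Configurations are coded by their sets of plus spins, so that sums over the spins in L
  run over \<open>Pow L\<close> whatever the boundary condition.\<close>

definition conf :: "vertex set \<Rightarrow> spins" where
  "conf B x = (if x \<in> B then 1 else -1)"

abbreviation \<Omega> :: "spins set" where "\<Omega> \<equiv> space spin_space"

lemma space_spin: "\<Omega> = {s. \<forall>x. s x = 1 \<or> s x = -1}"
  unfolding spin_space_def space_PiM by (auto simp: PiE_def Pi_def)

lemma conf_in [simp]: "conf B \<in> \<Omega>"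
  by (auto simp: space_spin conf_def)

definition graft :: "vertex set \<Rightarrow> spins \<Rightarrow> spins \<Rightarrow> spins" where
  "graft L s t = (\<lambda>x. if x \<in> L then s x else t x)"

lemma graft_in: "s \<in> \<Omega> \<Longrightarrow> t \<in> \<Omega> \<Longrightarrow> graft L s t \<in> \<Omega>"
  by (auto simp: space_spin graft_def)

lemma ext_iff: "s \<in> extensions L \<eta> \<longleftrightarrow> s \<in> \<Omega> \<and> (\<forall>x. x \<notin> L \<longrightarrow> s x = \<eta> x)"
  by (simp add: extensions_def)

lemma ext_eq_image:
  assumes "\<eta> \<in> \<Omega>"
  shows "extensions L \<eta> = (\<lambda>B. graft L (conf B) \<eta>) ` Pow L"
proof safe
  fix s assume s: "s \<in> extensions L \<eta>"
  have "s = graft L (conf {x\<in>L. s x = 1}) \<eta>"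
    using s by (auto simp: ext_iff space_spin graft_def conf_def fun_eq_iff)
  then show "s \<in> (\<lambda>B. graft L (conf B) \<eta>) ` Pow L" by blast
next
  fix B assume "B \<subseteq> L"
  then show "graft L (conf B) \<eta> \<in> extensions L \<eta>"
    using assms by (auto simp: ext_iff graft_in) (auto simp: graft_def)
qed

lemma inj_on_graft_conf: "inj_on (\<lambda>B. graft L (conf B) \<eta>) (Pow L)"
proof (rule inj_onI)
  fix A B assume h: "A \<in> Pow L" "B \<in> Pow L" "graft L (conf A) \<eta> = graft L (conf B) \<eta>"
  have "x \<in> A \<longleftrightarrow> x \<in> B" for x
    using h(1,2) fun_cong[OF h(3), of x] by (cases "x \<in> L") (auto simp: graft_def conf_def split: if_splits)
  then show "A = B" by auto
qed

lemma finite_ext: "finite L \<Longrightarrow> \<eta> \<in> \<Omega> \<Longrightarrow> finite (extensions L \<eta>)"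
  by (simp add: ext_eq_image)

lemma ext_self: "\<eta> \<in> \<Omega> \<Longrightarrow> \<eta> \<in> extensions L \<eta>"
  by (simp add: ext_iff)

lemma ext_eq: "s \<in> extensions L \<eta> \<Longrightarrow> extensions L s = extensions L \<eta>"
  by (auto simp: ext_iff)

lemma ext_mono: "D \<subseteq> L \<Longrightarrow> s \<in> extensions L \<eta> \<Longrightarrow> extensions D s \<subseteq> extensions L \<eta>"
  by (auto simp: ext_iff subset_iff)

lemma ext_sym: "s \<in> \<Omega> \<Longrightarrow> t \<in> extensions D s \<Longrightarrow> s \<in> extensions D t"
  by (auto simp: ext_iff)

lemma weight_pos: "ising_weight \<beta> L s > 0"
  by (simp add: ising_weight_def)

lemma sum_weight_pos:
  "finite L \<Longrightarrow> \<eta> \<in> \<Omega> \<Longrightarrow> (\<Sum>s\<in>extensions L \<eta>. ising_weight \<beta> L s) > 0"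
  by (intro sum_pos finite_ext weight_pos) (use ext_self in auto)

text \<open>Edges that touch L but not D see only spins on which s and t agree, so they give both
  weights the same factor. The cross-multiplied form is the one that \<open>gexp_gexp\<close>
  consumes.\<close>

lemma weight_ratio:
  assumes "finite L" "D \<subseteq> L" "\<And>x. x \<notin> D \<Longrightarrow> s x = t x"
  shows "ising_weight \<beta> L s * ising_weight \<beta> D t = ising_weight \<beta> L t * ising_weight \<beta> D s"
proof -
  let ?E = "\<lambda>L. {e \<in> edges. e \<inter> L \<noteq> {}}"
  define r where "r s = (\<Sum>e\<in>?E L - ?E D. \<Prod>x\<in>e. s x)" for s :: spins
  have fin: "finite (?E L)" by (rule finite_edges_touching) fact
  have sub: "?E D \<subseteq> ?E L" using assms(2) by auto
  have split: "(\<Sum>e\<in>?E L. \<Prod>x\<in>e. s x) = r s + (\<Sum>e\<in>?E D. \<Prod>x\<in>e. s x)" for s :: spins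
    unfolding r_def using sum.subset_diff[OF sub fin] .
  have "r s = r t"
    unfolding r_def by (intro sum.cong refl prod.cong assms(3)) auto
  then show ?thesis
    unfolding ising_weight_def split by (simp add: exp_add[symmetric] algebra_simps)
qed

text \<open>Contains L itself besides its outer neighbours: these are all the spins that the weight
  in L can read.\<close>

definition bdry :: "vertex set \<Rightarrow> vertex set" where
  "bdry L = L \<union> (\<Union>x\<in>L. {y. adj x y})"

lemma finite_bdry: "finite L \<Longrightarrow> finite (bdry L)"
  unfolding bdry_def using finite_adj by auto

lemma edge_touching_subset_bdry: "e \<in> edges \<Longrightarrow> e \<inter> L \<noteq> {} \<Longrightarrow> e \<subseteq> bdry L"
proof -
  assume e: "e \<in> edges" "e \<inter> L \<noteq> {}"
  then obtain x where x: "x \<in> e" "x \<in> L" by blast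
  then obtain y where "e = {x, y}" "adj x y" using edge_obtain[OF e(1)] by blast
  then show "e \<subseteq> bdry L" using x unfolding bdry_def by auto
qed

lemma weight_cong:
  assumes "\<And>x. x \<in> bdry L \<Longrightarrow> s x = t x"
  shows "ising_weight \<beta> L s = ising_weight \<beta> L t"
proof -
  have "(\<Sum>e\<in>{e \<in> edges. e \<inter> L \<noteq> {}}. \<Prod>x\<in>e. s x) = (\<Sum>e\<in>{e \<in> edges. e \<inter> L \<noteq> {}}. \<Prod>x\<in>e. t x)"
    using edge_touching_subset_bdry by (intro sum.cong refl prod.cong assms) auto
  then show ?thesis by (simp add: ising_weight_def)
qed

text \<open>The finite-volume kernel integrated against a function; \<open>kernel_eq_gexp\<close>
  recovers the kernel from indicators.\<close>

definition gexp :: "real \<Rightarrow> vertex set \<Rightarrow> spins \<Rightarrow> (spins \<Rightarrow> real) \<Rightarrow> real" where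
  "gexp \<beta> L \<eta> F = (\<Sum>s\<in>extensions L \<eta>. F s * ising_weight \<beta> L s) /
     (\<Sum>s\<in>extensions L \<eta>. ising_weight \<beta> L s)"

lemma kernel_eq_gexp:
  assumes "finite L" "\<eta> \<in> \<Omega>"
  shows "ising_kernel \<beta> L \<eta> A = gexp \<beta> L \<eta> (indicator A)"
  unfolding ising_kernel_def gexp_def
  using finite_ext[OF assms] by (simp add: sum.inter_restrict indicator_def if_distrib cong: if_cong)

lemma gexp_cong:
  "(\<And>s. s \<in> extensions L \<eta> \<Longrightarrow> F s = G s) \<Longrightarrow> gexp \<beta> L \<eta> F = gexp \<beta> L \<eta> G"
  unfolding gexp_def by (simp cong: sum.cong)

lemma gexp_const:
  assumes "finite L" "\<eta> \<in> \<Omega>"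
  shows "gexp \<beta> L \<eta> (\<lambda>_. c) = c"
  unfolding gexp_def sum_distrib_left[symmetric] using sum_weight_pos[OF assms, of \<beta>] by simp

lemma gexp_mono:
  assumes "finite L" "\<eta> \<in> \<Omega>" "\<And>s. s \<in> extensions L \<eta> \<Longrightarrow> F s \<le> G s"
  shows "gexp \<beta> L \<eta> F \<le> gexp \<beta> L \<eta> G"
  unfolding gexp_def using sum_weight_pos[OF assms(1,2), of \<beta>] weight_pos
  by (intro divide_right_mono sum_mono mult_right_mono assms(3)) (auto intro: less_imp_le)

lemma gexp_sum:
  "gexp \<beta> L \<eta> (\<lambda>s. \<Sum>i\<in>I. c i * F i s) = (\<Sum>i\<in>I. c i * gexp \<beta> L \<eta> (F i))"
proof -
  have "(\<Sum>s\<in>extensions L \<eta>. (\<Sum>i\<in>I. c i * F i s) * ising_weight \<beta> L s)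
      = (\<Sum>i\<in>I. c i * (\<Sum>s\<in>extensions L \<eta>. F i s * ising_weight \<beta> L s))"
    unfolding sum_distrib_right sum_distrib_left by (subst sum.swap) (simp add: mult.assoc)
  then show ?thesis
    unfolding gexp_def times_divide_eq_right sum_divide_distrib[of _ I, symmetric] by simp
qed

lemma gexp_mult_const:
  assumes "\<And>s. s \<in> extensions L \<eta> \<Longrightarrow> G s = G \<eta>"
  shows "gexp \<beta> L \<eta> (\<lambda>s. G s * F s) = G \<eta> * gexp \<beta> L \<eta> F"
proof -
  have "gexp \<beta> L \<eta> (\<lambda>s. G s * F s) = gexp \<beta> L \<eta> (\<lambda>s. G \<eta> * F s)"
    by (rule gexp_cong) (simp add: assms)
  then show ?thesis
    unfolding gexp_def by (simp add: sum_distrib_left mult.assoc)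
qed

lemma gexp_bounds:
  assumes "finite L" "\<eta> \<in> \<Omega>" "\<And>s. s \<in> \<Omega> \<Longrightarrow> a \<le> F s" "\<And>s. s \<in> \<Omega> \<Longrightarrow> F s \<le> b"
  shows "a \<le> gexp \<beta> L \<eta> F" "gexp \<beta> L \<eta> F \<le> b"
proof -
  show "a \<le> gexp \<beta> L \<eta> F"
    using gexp_mono[OF assms(1,2), of "\<lambda>_. a" F \<beta>] assms by (auto simp: gexp_const ext_iff)
  show "gexp \<beta> L \<eta> F \<le> b"
    using gexp_mono[OF assms(1,2), of F "\<lambda>_. b" \<beta>] assms by (auto simp: gexp_const ext_iff)
qed

text \<open>Consistency of the specification. Agreement outside D is a symmetric relation on
  \<open>extensions L \<eta>\<close> along which the normalisation of the inner kernel is constant;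
  after exchanging the two sums, \<open>weight_ratio\<close> makes the inner sum equal to that
  normalisation.\<close>

lemma gexp_gexp:
  assumes "finite L" "D \<subseteq> L" "\<eta> \<in> \<Omega>"
  shows "gexp \<beta> L \<eta> (\<lambda>s. gexp \<beta> D s F) = gexp \<beta> L \<eta> F"
proof -
  let ?E = "extensions L \<eta>" and ?w = "ising_weight \<beta>"
  define Z where "Z s = (\<Sum>u\<in>extensions D s. ?w D u)" for s
  define R where "R s t \<longleftrightarrow> t \<in> extensions D s" for s t
  have finD: "finite D" using assms finite_subset by auto
  have finE: "finite ?E" using assms finite_ext by auto
  have E\<Omega>: "s \<in> \<Omega>" if "s \<in> ?E" for s using that by (simp add: ext_iff)
  have extD: "extensions D s = {t\<in>?E. R s t}" if "s \<in> ?E" for s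
    using ext_mono[OF assms(2) that] by (auto simp: R_def)
  have Rsym: "R s t \<longleftrightarrow> R t s" if "s \<in> ?E" "t \<in> ?E" for s t
    using ext_sym E\<Omega> that unfolding R_def by blast
  have Zeq: "Z s = Z t" if "R s t" for s t
    using ext_eq that by (auto simp: Z_def R_def)
  have Zpos: "Z s > 0" if "s \<in> ?E" for s
    unfolding Z_def using sum_weight_pos[OF finD] E\<Omega> that by blast
  have "(\<Sum>s\<in>?E. gexp \<beta> D s F * ?w L s) = (\<Sum>s\<in>?E. \<Sum>t\<in>{t\<in>?E. R s t}. F t * ?w D t * ?w L s / Z s)"
    by (intro sum.cong refl) (simp add: gexp_def extD Z_def sum_distrib_right sum_divide_distrib)
  also have "\<dots> = (\<Sum>t\<in>?E. \<Sum>s\<in>{s\<in>?E. R s t}. F t * ?w D t * ?w L s / Z s)"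
    by (rule sum.swap_restrict[OF finE finE])
  also have "\<dots> = (\<Sum>t\<in>?E. \<Sum>s\<in>extensions D t. F t * ?w L t * ?w D s / Z t)"
  proof (rule sum.cong[OF refl])
    fix t assume t: "t \<in> ?E"
    have "{s\<in>?E. R s t} = extensions D t"
      using extD[OF t] Rsym t by auto
    moreover have "F t * ?w D t * ?w L s / Z s = F t * ?w L t * ?w D s / Z t" if "s \<in> extensions D t" for s
    proof -
      have "?w L s * ?w D t = ?w L t * ?w D s"
        using that by (intro weight_ratio assms) (auto simp: ext_iff)
      moreover have "Z s = Z t" using Zeq that by (auto simp: R_def)
      ultimately show ?thesis by (simp add: mult.assoc mult.commute)
    qed
    ultimately show "(\<Sum>s\<in>{s\<in>?E. R s t}. F t * ?w D t * ?w L s / Z s)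
        = (\<Sum>s\<in>extensions D t. F t * ?w L t * ?w D s / Z t)"
      by (simp cong: sum.cong)
  qed
  also have "\<dots> = (\<Sum>t\<in>?E. F t * ?w L t)"
  proof (rule sum.cong[OF refl])
    fix t assume t: "t \<in> ?E"
    have "(\<Sum>s\<in>extensions D t. F t * ?w L t * ?w D s / Z t) = F t * ?w L t * Z t / Z t"
      by (simp add: Z_def sum_distrib_left sum_divide_distrib)
    then show "(\<Sum>s\<in>extensions D t. F t * ?w L t * ?w D s / Z t) = F t * ?w L t"
      using Zpos[OF t] by simp
  qed
  finally show ?thesis by (simp add: gexp_def)
qed

text \<open>Locality is required on \<Omega> only, because the type of spins also contains functions
  with values other than 1 and -1.\<close>

definition dep :: "vertex set \<Rightarrow> (spins \<Rightarrow> 'a) \<Rightarrow> bool" where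
  "dep J F \<longleftrightarrow> (\<forall>s\<in>\<Omega>. \<forall>t\<in>\<Omega>. (\<forall>x\<in>J. s x = t x) \<longrightarrow> F s = F t)"

lemma depD: "dep J F \<Longrightarrow> s \<in> \<Omega> \<Longrightarrow> t \<in> \<Omega> \<Longrightarrow> (\<And>x. x \<in> J \<Longrightarrow> s x = t x) \<Longrightarrow> F s = F t"
  unfolding dep_def by blast

lemma dep_mono: "dep J F \<Longrightarrow> J \<subseteq> J' \<Longrightarrow> dep J' F"
  unfolding dep_def by blast

lemma gexp_graft:
  assumes "\<eta> \<in> \<Omega>"
  shows "gexp \<beta> L \<eta> F = (\<Sum>B\<in>Pow L. F (graft L (conf B) \<eta>) * ising_weight \<beta> L (graft L (conf B) \<eta>)) /
     (\<Sum>B\<in>Pow L. ising_weight \<beta> L (graft L (conf B) \<eta>))"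
  unfolding gexp_def ext_eq_image[OF assms] by (simp add: sum.reindex[OF inj_on_graft_conf])

text \<open>The spins in L are summed out, and the weight reads the boundary condition only next to
  L. Thus kernels map local functions to local functions, which lets the DLR equations pass to
  limits.\<close>

lemma dep_gexp:
  assumes "dep J F"
  shows "dep (J - L \<union> (bdry L - L)) (\<lambda>\<eta>. gexp \<beta> L \<eta> F)"
  unfolding dep_def
proof (intro ballI impI)
  fix s t assume st: "s \<in> \<Omega>" "t \<in> \<Omega>" "\<forall>x\<in>J - L \<union> (bdry L - L). s x = t x"
  have "F (graft L (conf B) s) = F (graft L (conf B) t)" for B
    using st by (intro depD[OF assms] graft_in) (auto simp: graft_def)
  moreover have "ising_weight \<beta> L (graft L (conf B) s) = ising_weight \<beta> L (graft L (conf B) t)" for B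
    using st by (intro weight_cong) (auto simp: graft_def)
  ultimately show "gexp \<beta> L s F = gexp \<beta> L t F"
    using st by (simp add: gexp_graft)
qed

definition cyl :: "vertex set \<Rightarrow> vertex set \<Rightarrow> spins set" where
  "cyl J B = {s \<in> \<Omega>. \<forall>x\<in>J. s x = conf B x}"

text \<open>Exactly one pattern on J agrees with s. This reduces statements about local functions to
  finitely many cylinder events.\<close>

lemma dep_expand:
  fixes F :: "spins \<Rightarrow> real"
  assumes "dep J F" "finite J" "s \<in> \<Omega>"
  shows "F s = (\<Sum>B\<in>Pow J. F (conf B) * indicator (cyl J B) s)"
proof -
  define A where "A = {x\<in>J. s x = 1}"
  have ind: "indicator (cyl J B) s = (if B = A then 1 else 0 :: real)" if "B \<in> Pow J" for B
  proof -
    have "s \<in> cyl J B \<longleftrightarrow> B = A"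
      using assms(3) that by (auto simp: cyl_def A_def conf_def space_spin split: if_splits)
    then show ?thesis by (simp add: indicator_def)
  qed
  have "(\<Sum>B\<in>Pow J. F (conf B) * indicator (cyl J B) s) = (\<Sum>B\<in>Pow J. if B = A then F (conf A) else 0)"
    by (rule sum.cong[OF refl]) (simp add: ind del: Pow_iff)
  also have "\<dots> = F (conf A)"
    using assms(2) by (subst sum.delta) (auto simp: A_def)
  also have "\<dots> = F s"
    using assms by (intro depD[OF assms(1)]) (auto simp: A_def conf_def space_spin)
  finally show ?thesis by simp
qed

lemma sets_proj: "{s \<in> \<Omega>. s x = c} \<in> sets spin_space"
proof -
  have "(\<lambda>s. s x) \<in> measurable spin_space (count_space {-1,1})"
    unfolding spin_space_def by measurable
  then have "(\<lambda>s. s x) -` ({c} \<inter> {-1,1}) \<inter> \<Omega> \<in> sets spin_space"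
    by (rule measurable_sets) auto
  moreover have "(\<lambda>s. s x) -` ({c} \<inter> {-1,1}) \<inter> \<Omega> = {s \<in> \<Omega>. s x = c}"
    by (auto simp: space_spin)
  ultimately show ?thesis by simp
qed

lemma sets_cyl: "finite J \<Longrightarrow> cyl J B \<in> sets spin_space"
proof -
  assume J: "finite J"
  have "cyl J B = (\<Inter>x\<in>J. {s \<in> \<Omega>. s x = conf B x}) \<inter> \<Omega>"
    by (auto simp: cyl_def)
  also have "\<dots> \<in> sets spin_space"
    using sets.finite_INT[OF J] sets_proj by (cases "J = {}") auto
  finally show ?thesis .
qed

lemma measurable_dep:
  fixes F :: "spins \<Rightarrow> real"
  assumes "dep J F" "finite J"
  shows "F \<in> borel_measurable spin_space"
proof -
  have "(\<lambda>s. \<Sum>B\<in>Pow J. F (conf B) * indicator (cyl J B) s) \<in> borel_measurable spin_space"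
    using sets_cyl[OF assms(2)] by (intro borel_measurable_sum borel_measurable_times) auto
  then show ?thesis
    by (rule measurable_cong[THEN iffD1, rotated]) (simp add: dep_expand[OF assms])
qed

lemma countable_vsets: "countable {J :: vertex set. finite J}"
  by (rule countable_Collect_finite)

text \<open>The hypothesis says that A is open for the product topology. Patterns on finite sets are
  given by finite sets of plus spins, so only countably many cylinders exist and A is a countable
  union of them.\<close>

lemma open_sets:
  assumes "A \<subseteq> \<Omega>" "\<And>s. s \<in> A \<Longrightarrow> \<exists>J. finite J \<and> (\<forall>t\<in>\<Omega>. (\<forall>x\<in>J. t x = s x) \<longrightarrow> t \<in> A)"
  shows "A \<in> sets spin_space"
proof -
  define C where "C = {(J, B). finite J \<and> finite B \<and> B \<subseteq> J \<and> cyl J B \<subseteq> A}"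
  have "countable C"
    by (rule countable_subset[OF _ countable_SIGMA[OF countable_vsets countable_vsets]])
       (auto simp: C_def)
  have "A = (\<Union>(J,B)\<in>C. cyl J B)"
  proof safe
    fix s assume s: "s \<in> A"
    obtain J where J: "finite J" "\<forall>t\<in>\<Omega>. (\<forall>x\<in>J. t x = s x) \<longrightarrow> t \<in> A"
      using assms(2)[OF s] by auto
    define B where "B = {x\<in>J. s x = 1}"
    have sB: "conf B x = s x" if "x \<in> J" for x
    proof -
      have "s \<in> \<Omega>" using s assms(1) by blast
      then show ?thesis using that by (auto simp: B_def conf_def space_spin)
    qed
    have "(J, B) \<in> C"
      using J sB by (auto simp: C_def cyl_def B_def)
    moreover have "s \<in> cyl J B"
      using s assms(1) sB by (auto simp: cyl_def)
    ultimately show "s \<in> (\<Union>(J,B)\<in>C. cyl J B)" by blast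
  qed (auto simp: C_def)
  also have "\<dots> \<in> sets spin_space"
    using sets_cyl by (intro sets.countable_UN'' \<open>countable C\<close>) (auto simp: C_def)
  finally show ?thesis .
qed


section \<open>The DLR equations on cylinders\<close>

definition spin_prob :: "spins measure \<Rightarrow> bool" where
  "spin_prob M \<longleftrightarrow> prob_space M \<and> sets M = sets spin_space"

lemma spin_probD:
  assumes "spin_prob M"
  shows "prob_space M" "sets M = sets spin_space" "space M = \<Omega>"
    "borel_measurable M = borel_measurable spin_space"
proof -
  show "prob_space M" and sets: "sets M = sets spin_space"
    using assms by (simp_all add: spin_prob_def)
  show "space M = \<Omega>" by (rule sets_eq_imp_space_eq[OF sets])
  show "borel_measurable M = borel_measurable spin_space" by (rule measurable_cong_sets[OF sets refl])
qed

lemma gibbs_spin_prob: "ising_gibbs \<beta> M \<Longrightarrow> spin_prob M"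
  by (simp add: ising_gibbs_def spin_prob_def)

lemma dep_bounded:
  fixes F :: "spins \<Rightarrow> real"
  assumes "dep J F" "finite J"
  obtains C where "C \<ge> 0" "\<And>s. s \<in> \<Omega> \<Longrightarrow> \<bar>F s\<bar> \<le> C"
proof
  show "0 \<le> (\<Sum>B\<in>Pow J. \<bar>F (conf B)\<bar>)" by (simp add: sum_nonneg)
  fix s assume s: "s \<in> \<Omega>"
  have "\<bar>F s\<bar> \<le> (\<Sum>B\<in>Pow J. \<bar>F (conf B) * indicator (cyl J B) s\<bar>)"
    unfolding dep_expand[OF assms s] by (rule sum_abs)
  also have "\<dots> \<le> (\<Sum>B\<in>Pow J. \<bar>F (conf B)\<bar>)"
    by (intro sum_mono) (auto simp: indicator_def)
  finally show "\<bar>F s\<bar> \<le> (\<Sum>B\<in>Pow J. \<bar>F (conf B)\<bar>)" .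
qed

lemma integrable_bounded:
  fixes F :: "spins \<Rightarrow> real"
  assumes "spin_prob M" "F \<in> borel_measurable spin_space" "\<And>s. s \<in> \<Omega> \<Longrightarrow> \<bar>F s\<bar> \<le> C"
  shows "integrable M F"
proof -
  note M = spin_probD[OF assms(1)]
  interpret prob_space M by (rule M(1))
  show ?thesis
    by (rule integrable_const_bound[where B = C]) (use assms M in auto)
qed

lemma integrable_dep:
  fixes F :: "spins \<Rightarrow> real"
  assumes "spin_prob M" "dep J F" "finite J"
  shows "integrable M F"
  using dep_bounded[OF assms(2,3)] integrable_bounded[OF assms(1) measurable_dep[OF assms(2,3)]] by metis

lemma integral_dep:
  fixes F :: "spins \<Rightarrow> real"
  assumes "spin_prob M" "dep J F" "finite J"
  shows "(\<integral>s. F s \<partial>M) = (\<Sum>B\<in>Pow J. F (conf B) * measure M (cyl J B))"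
proof -
  note M = spin_probD[OF assms(1)]
  interpret prob_space M by (rule M(1))
  have "(\<integral>s. F s \<partial>M) = (\<integral>s. (\<Sum>B\<in>Pow J. F (conf B) * indicator (cyl J B) s) \<partial>M)"
    using dep_expand[OF assms(2,3)] M(3) by (intro Bochner_Integration.integral_cong) auto
  also have "\<dots> = (\<Sum>B\<in>Pow J. (\<integral>s. F (conf B) * indicator (cyl J B) s \<partial>M))"
    using sets_cyl[OF assms(3)] M(2)
    by (intro Bochner_Integration.integral_sum integrable_mult_right integrable_real_indicator)
       (auto simp: less_top[symmetric])
  also have "\<dots> = (\<Sum>B\<in>Pow J. F (conf B) * measure M (cyl J B))"
    using sets.sets_into_space[of _ M] sets_cyl[OF assms(3)] M(2)
    by (intro sum.cong refl) (simp add: Int_absorb2)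
  finally show ?thesis .
qed

lemma dep_indicator_cyl: "dep J (indicator (cyl J B) :: spins \<Rightarrow> real)"
  unfolding dep_def by (auto simp: cyl_def indicator_def)

lemma finite_dep_gexp_support: "finite J \<Longrightarrow> finite L \<Longrightarrow> finite (J - L \<union> (bdry L - L))"
  by (simp add: finite_bdry)

lemma gexp_expand:
  assumes "dep J F" "finite J"
  shows "gexp \<beta> L \<eta> F = (\<Sum>B\<in>Pow J. F (conf B) * gexp \<beta> L \<eta> (indicator (cyl J B)))"
proof -
  have "gexp \<beta> L \<eta> F = gexp \<beta> L \<eta> (\<lambda>s. \<Sum>B\<in>Pow J. F (conf B) * indicator (cyl J B) s)"
    by (rule gexp_cong) (simp add: dep_expand[OF assms] ext_iff)
  then show ?thesis by (simp only: gexp_sum)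
qed

lemma gibbs_dlr:
  assumes M: "ising_gibbs \<beta> M" and L: "finite L" and F: "dep J F" "finite J"
  shows "(\<integral>\<eta>. gexp \<beta> L \<eta> F \<partial>M) = (\<integral>s. F s \<partial>M)"
proof -
  note sp = gibbs_spin_prob[OF M]
  note M' = spin_probD[OF sp]
  have int: "integrable M (\<lambda>\<eta>. gexp \<beta> L \<eta> (indicator (cyl J B)))" for B
    by (rule integrable_dep[OF sp dep_gexp[OF dep_indicator_cyl] finite_dep_gexp_support[OF F(2) L]])
  have "(\<integral>\<eta>. gexp \<beta> L \<eta> F \<partial>M) = (\<integral>\<eta>. (\<Sum>B\<in>Pow J. F (conf B) * gexp \<beta> L \<eta> (indicator (cyl J B))) \<partial>M)"
    by (simp only: gexp_expand[OF F])
  also have "\<dots> = (\<Sum>B\<in>Pow J. F (conf B) * (\<integral>\<eta>. gexp \<beta> L \<eta> (indicator (cyl J B)) \<partial>M))"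
    using int by (subst Bochner_Integration.integral_sum) auto
  also have "\<dots> = (\<Sum>B\<in>Pow J. F (conf B) * measure M (cyl J B))"
  proof (rule sum.cong[OF refl])
    fix B assume "B \<in> Pow J"
    have "measure M (cyl J B) = (\<integral>\<eta>. ising_kernel \<beta> L \<eta> (cyl J B) \<partial>M)"
      using M L sets_cyl[OF F(2)] unfolding ising_gibbs_def by auto
    also have "\<dots> = (\<integral>\<eta>. gexp \<beta> L \<eta> (indicator (cyl J B)) \<partial>M)"
      using kernel_eq_gexp[OF L] M'(3) by (intro Bochner_Integration.integral_cong) auto
    finally show "F (conf B) * (\<integral>\<eta>. gexp \<beta> L \<eta> (indicator (cyl J B)) \<partial>M) = F (conf B) * measure M (cyl J B)"
      by simp
  qed
  also have "\<dots> = (\<integral>s. F s \<partial>M)"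
    by (rule integral_dep[OF sp F, symmetric])
  finally show ?thesis .
qed

lemma spin_measure_eqI:
  assumes "spin_prob M" "sets N = sets spin_space"
    and eq: "\<And>J A. finite J \<Longrightarrow> A \<in> sets spin_space \<Longrightarrow> dep J (indicator A :: spins \<Rightarrow> real)
      \<Longrightarrow> emeasure M A = emeasure N A"
  shows "M = N"
proof (rule measure_eqI_PiM_infinite)
  note M = spin_probD[OF assms(1)]
  show "sets M = sets (Pi\<^sub>M UNIV (\<lambda>_. count_space {-1, 1}))" "sets N = sets (Pi\<^sub>M UNIV (\<lambda>_. count_space {-1, 1}))"
    using M assms(2) by (simp_all add: spin_space_def)
  show "finite_measure M" using M(1) by (simp add: prob_space.axioms(1))
  fix A :: "vertex \<Rightarrow> real set" and J :: "vertex set"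
  assume J: "finite J" and A: "\<And>i. i \<in> J \<Longrightarrow> A i \<in> sets (count_space {-1, 1})"
  let ?X = "prod_emb UNIV (\<lambda>_. count_space {-1, 1}) J (Pi\<^sub>E J A) :: spins set"
  have eqX: "?X = {s \<in> \<Omega>. \<forall>x\<in>J. s x \<in> A x}"
    using A by (auto simp: prod_emb_def spin_space_def space_PiM PiE_def Pi_def)
  show "emeasure M ?X = emeasure N ?X"
  proof (rule eq[OF J])
    show "?X \<in> sets spin_space"
      unfolding spin_space_def using J A by (intro sets_PiM_I) auto
    show "dep J (indicator ?X :: spins \<Rightarrow> real)"
      unfolding eqX dep_def by (auto simp: indicator_def)
  qed
qed

lemma spin_measure_eqI_cyl:
  assumes "spin_prob M" "spin_prob N"
    and "\<And>J B. finite J \<Longrightarrow> B \<subseteq> J \<Longrightarrow> measure M (cyl J B) = measure N (cyl J B)"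
  shows "M = N"
proof (rule spin_measure_eqI[OF assms(1)])
  note M = spin_probD[OF assms(1)] and N = spin_probD[OF assms(2)]
  interpret M: prob_space M by (rule M(1))
  interpret N: prob_space N by (rule N(1))
  show "sets N = sets spin_space" by (rule N(2))
  fix J A assume J: "finite J" and A: "A \<in> sets spin_space" "dep J (indicator A :: spins \<Rightarrow> real)"
  have "(\<integral>s. indicator A s \<partial>M) = (\<integral>s. (indicator A s :: real) \<partial>N)"
    unfolding integral_dep[OF assms(1) A(2) J] integral_dep[OF assms(2) A(2) J]
    using assms(3)[OF J] by (intro sum.cong) auto
  then have "measure M A = measure N A"
    using A(1) M N sets.sets_into_space[OF A(1)] by (simp add: Int_absorb2)
  then show "emeasure M A = emeasure N A"
    by (simp add: M.emeasure_eq_measure N.emeasure_eq_measure)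
qed

lemma measurable_graft:
  "(\<lambda>\<eta>. graft L (conf B) \<eta>) \<in> measurable spin_space spin_space"
proof -
  have "(\<lambda>\<eta>. \<lambda>x\<in>UNIV. if x \<in> L then conf B x else \<eta> x) \<in> measurable spin_space spin_space"
    unfolding spin_space_def
  proof (rule measurable_restrict)
    fix x
    show "(\<lambda>\<eta>. if x \<in> L then conf B x else \<eta> x) \<in> (\<Pi>\<^sub>M x\<in>UNIV. count_space {-1, 1}) \<rightarrow>\<^sub>M count_space {-1, 1}"
      by (cases "x \<in> L") (auto simp: conf_def)
  qed
  then show ?thesis by (simp add: graft_def restrict_def)
qed

lemma measurable_weight: "finite L \<Longrightarrow> (\<lambda>\<eta>. ising_weight \<beta> L \<eta>) \<in> borel_measurable spin_space"
  by (rule measurable_dep[where J = "bdry L"]) (auto simp: dep_def finite_bdry intro: weight_cong)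

text \<open>Conditional probability of the pattern B in L. The index set \<open>Pow L\<close> does
  not vary with the boundary condition, unlike \<open>extensions L \<eta>\<close>, which makes
  measurability in \<eta> visible.\<close>

definition gprob :: "real \<Rightarrow> vertex set \<Rightarrow> vertex set \<Rightarrow> spins \<Rightarrow> real" where
  "gprob \<beta> L B \<eta> = ising_weight \<beta> L (graft L (conf B) \<eta>) / (\<Sum>B\<in>Pow L. ising_weight \<beta> L (graft L (conf B) \<eta>))"

lemma gprob_nonneg: "gprob \<beta> L B \<eta> \<ge> 0"
  unfolding gprob_def using weight_pos by (intro divide_nonneg_nonneg sum_nonneg) (auto intro: less_imp_le)

lemma measurable_gprob: "finite L \<Longrightarrow> gprob \<beta> L B \<in> borel_measurable spin_space"
  unfolding gprob_def[abs_def]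
  using measurable_compose[OF measurable_graft measurable_weight] by (intro borel_measurable_divide borel_measurable_sum) auto

lemma gexp_gprob: "\<eta> \<in> \<Omega> \<Longrightarrow> gexp \<beta> L \<eta> F = (\<Sum>B\<in>Pow L. F (graft L (conf B) \<eta>) * gprob \<beta> L B \<eta>)"
  by (simp add: gexp_graft gprob_def sum_divide_distrib)

lemma measurable_gexp:
  assumes "finite L" "F \<in> borel_measurable spin_space"
  shows "(\<lambda>\<eta>. gexp \<beta> L \<eta> F) \<in> borel_measurable spin_space"
proof -
  have "(\<lambda>\<eta>. \<Sum>B\<in>Pow L. F (graft L (conf B) \<eta>) * gprob \<beta> L B \<eta>) \<in> borel_measurable spin_space"
    using measurable_gprob[OF assms(1)] measurable_compose[OF measurable_graft assms(2)]
    by (intro borel_measurable_sum borel_measurable_times) auto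
  then show ?thesis
    by (rule measurable_cong[THEN iffD1, rotated]) (simp add: gexp_gprob)
qed

text \<open>Resampling the spins in \<open>L\<close> is a measure, so that the DLR equations need to be checked on
  cylinders only.\<close>

definition resample :: "real \<Rightarrow> vertex set \<Rightarrow> spins measure \<Rightarrow> spins measure" where
  "resample \<beta> L M = distr (density (count_space (Pow L) \<Otimes>\<^sub>M M) (\<lambda>(B, \<eta>). ennreal (gprob \<beta> L B \<eta>)))
     spin_space (\<lambda>(B, \<eta>). graft L (conf B) \<eta>)"

lemma emeasure_resample:
  assumes M: "spin_prob M" and L: "finite L" and A: "A \<in> sets spin_space"
  shows "emeasure (resample \<beta> L M) A = ennreal (\<integral>\<eta>. gexp \<beta> L \<eta> (indicator A) \<partial>M)"
proof -
  note M' = spin_probD[OF M]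
  interpret prob_space M by (rule M')
  let ?C = "count_space (Pow L)" and ?g = "\<lambda>(B, \<eta>). graft L (conf B) \<eta>"
  let ?w = "\<lambda>(B, \<eta>). ennreal (gprob \<beta> L B \<eta>)"
  have cnt: "countable (Pow L)" using L by (simp add: countable_finite)
  have g: "?g \<in> measurable (?C \<Otimes>\<^sub>M M) spin_space"
    using measurable_graft measurable_cong_sets[OF M'(2) refl, of spin_space]
    by (intro measurable_pair_measure_countable1[OF cnt]) auto
  have w: "?w \<in> borel_measurable (?C \<Otimes>\<^sub>M M)"
    using measurable_gprob[OF L] M'(4)
    by (intro measurable_pair_measure_countable1[OF cnt]) auto
  have ind: "(\<lambda>x. indicator A (?g x) :: ennreal) \<in> borel_measurable (?C \<Otimes>\<^sub>M M)"
    by (rule measurable_compose[OF g]) (use A in auto)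
  have meas: "(\<lambda>\<eta>. ennreal (gprob \<beta> L B \<eta>) * indicator A (graft L (conf B) \<eta>)) \<in> borel_measurable M" for B
  proof (rule borel_measurable_times_ennreal)
    show "(\<lambda>\<eta>. ennreal (gprob \<beta> L B \<eta>)) \<in> borel_measurable M"
      unfolding measurable_cong_sets[OF M'(2) refl]
      by (rule measurable_compose[OF measurable_gprob[OF L] measurable_ennreal])
    show "(\<lambda>\<eta>. indicator A (graft L (conf B) \<eta>) :: ennreal) \<in> borel_measurable M"
      unfolding measurable_cong_sets[OF M'(2) refl]
      by (rule measurable_compose[OF measurable_graft borel_measurable_indicator[OF A]])
  qed
  have "emeasure (resample \<beta> L M) A = (\<integral>\<^sup>+x. indicator A x \<partial>resample \<beta> L M)"
    using A by (simp add: resample_def)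
  also have "\<dots> = (\<integral>\<^sup>+x. ?w x * indicator A (?g x) \<partial>(?C \<Otimes>\<^sub>M M))"
    unfolding resample_def using g w ind A
    by (subst nn_integral_distr) (auto simp: nn_integral_density)
  also have "\<dots> = (\<integral>\<^sup>+B. \<integral>\<^sup>+\<eta>. ?w (B, \<eta>) * indicator A (?g (B, \<eta>)) \<partial>M \<partial>?C)"
    using w ind by (intro nn_integral_fst[symmetric]) auto
  also have "\<dots> = (\<Sum>B\<in>Pow L. \<integral>\<^sup>+\<eta>. ennreal (gprob \<beta> L B \<eta>) * indicator A (graft L (conf B) \<eta>) \<partial>M)"
    using L by (simp add: nn_integral_count_space_finite)
  also have "\<dots> = (\<integral>\<^sup>+\<eta>. (\<Sum>B\<in>Pow L. ennreal (gprob \<beta> L B \<eta>) * indicator A (graft L (conf B) \<eta>)) \<partial>M)"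
    by (rule nn_integral_sum[symmetric]) (rule meas)
  also have "\<dots> = (\<integral>\<^sup>+\<eta>. ennreal (gexp \<beta> L \<eta> (indicator A)) \<partial>M)"
  proof (rule nn_integral_cong)
    fix \<eta> assume "\<eta> \<in> space M"
    then have "gexp \<beta> L \<eta> (indicator A) = (\<Sum>B\<in>Pow L. indicator A (graft L (conf B) \<eta>) * gprob \<beta> L B \<eta>)"
      using M' by (simp add: gexp_gprob)
    moreover have "ennreal (\<Sum>B\<in>Pow L. indicator A (graft L (conf B) \<eta>) * gprob \<beta> L B \<eta>)
        = (\<Sum>B\<in>Pow L. ennreal (gprob \<beta> L B \<eta>) * indicator A (graft L (conf B) \<eta>))"
      by (subst sum_ennreal[symmetric])
         (auto simp: gprob_nonneg ennreal_mult ennreal_indicator mult.commute)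
    ultimately show "(\<Sum>B\<in>Pow L. ennreal (gprob \<beta> L B \<eta>) * indicator A (graft L (conf B) \<eta>))
        = ennreal (gexp \<beta> L \<eta> (indicator A))" by simp
  qed
  also have "\<dots> = ennreal (\<integral>\<eta>. gexp \<beta> L \<eta> (indicator A) \<partial>M)"
  proof (rule nn_integral_eq_integral)
    have b: "0 \<le> gexp \<beta> L \<eta> (indicator A)" "gexp \<beta> L \<eta> (indicator A) \<le> 1" if "\<eta> \<in> \<Omega>" for \<eta>
      using gexp_bounds[OF L that, of 0 "indicator A" 1 \<beta>] by (auto simp: indicator_def)
    show "integrable M (\<lambda>\<eta>. gexp \<beta> L \<eta> (indicator A))"
    proof (rule integrable_bounded[OF M measurable_gexp[OF L]])
      show "indicator A \<in> borel_measurable spin_space" using A by simp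
      show "\<bar>gexp \<beta> L \<eta> (indicator A)\<bar> \<le> 1" if "\<eta> \<in> \<Omega>" for \<eta> using b[OF that] by simp
    qed
    show "AE \<eta> in M. 0 \<le> gexp \<beta> L \<eta> (indicator A)"
      using b M' by (intro AE_I2) auto
  qed
  finally show ?thesis .
qed

lemma gibbsI_cyl:
  assumes M: "spin_prob M"
    and dlr: "\<And>L J F. finite L \<Longrightarrow> finite J \<Longrightarrow> dep J F \<Longrightarrow> (\<integral>\<eta>. gexp \<beta> L \<eta> F \<partial>M) = (\<integral>s. F s \<partial>M)"
  shows "ising_gibbs \<beta> M"
proof -
  note M' = spin_probD[OF M]
  interpret prob_space M by (rule M')
  have "measure M A = (\<integral>\<eta>. ising_kernel \<beta> L \<eta> A \<partial>M)" if L: "finite L" and A: "A \<in> sets M" for L A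
  proof -
    have "M = resample \<beta> L M"
    proof (rule spin_measure_eqI[OF M])
      show "sets (resample \<beta> L M) = sets spin_space" by (simp add: resample_def)
      fix J and A :: "spins set" assume J: "finite J" and A: "A \<in> sets spin_space" "dep J (indicator A :: spins \<Rightarrow> real)"
      have "emeasure (resample \<beta> L M) A = ennreal (\<integral>s. indicator A s \<partial>M)"
        unfolding emeasure_resample[OF M L A(1)] dlr[OF L J A(2)] ..
      also have "\<dots> = emeasure M A"
        using sets.sets_into_space[OF A(1)] M' by (simp add: emeasure_eq_measure Int_absorb2)
      finally show "emeasure M A = emeasure (resample \<beta> L M) A" ..
    qed
    then have "ennreal (measure M A) = ennreal (\<integral>\<eta>. gexp \<beta> L \<eta> (indicator A) \<partial>M)"
      using emeasure_resample[OF M L, of A \<beta>] A M'(2) by (simp add: emeasure_eq_measure)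
    moreover have "0 \<le> (\<integral>\<eta>. gexp \<beta> L \<eta> (indicator A) \<partial>M)"
    proof (rule integral_nonneg_AE, rule AE_I2)
      fix \<eta> assume "\<eta> \<in> space M"
      then show "0 \<le> gexp \<beta> L \<eta> (indicator A)"
        using gexp_bounds(1)[OF L, of \<eta> 0 "indicator A" 1] M' by (auto simp: indicator_def)
    qed
    ultimately have "measure M A = (\<integral>\<eta>. gexp \<beta> L \<eta> (indicator A) \<partial>M)"
      by simp
    also have "\<dots> = (\<integral>\<eta>. ising_kernel \<beta> L \<eta> A \<partial>M)"
      using kernel_eq_gexp[OF L] M'(3) by (intro Bochner_Integration.integral_cong) auto
    finally show ?thesis .
  qed
  then show ?thesis
    unfolding ising_gibbs_def using M' by auto
qed


section \<open>Existence of Gibbs measures and uniform convergence of the kernels\<close>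

lemma compact_unit_functions: "compact {f :: 'a \<Rightarrow> real. \<forall>x. f x \<in> {0..1}}"
proof -
  have "compactin (product_topology (\<lambda>_::'a. euclidean) UNIV) (PiE UNIV (\<lambda>_. {0..1::real}))"
    by (subst compactin_PiE) auto
  moreover have "PiE UNIV (\<lambda>_. {0..1::real}) = {f :: 'a \<Rightarrow> real. \<forall>x. f x \<in> {0..1}}"
    by (auto simp: PiE_def)
  ultimately show ?thesis
    by (simp add: euclidean_product_topology)
qed

text \<open>The second assumption encodes both the linearity of \<open>l\<close> and the consistency of the marginals.\<close>

lemma spin_prob_extension:
  fixes l :: "(spins \<Rightarrow> real) \<Rightarrow> real"
  assumes nonneg: "\<And>J F. finite J \<Longrightarrow> dep J F \<Longrightarrow> (\<And>s. s \<in> \<Omega> \<Longrightarrow> F s \<ge> 0) \<Longrightarrow> l F \<ge> 0"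
    and expand: "\<And>J F. finite J \<Longrightarrow> dep J F \<Longrightarrow> l F = (\<Sum>B\<in>Pow J. F (conf B) * l (indicator (cyl J B)))"
    and one: "l (\<lambda>_. 1) = 1"
  shows "\<exists>M. spin_prob M \<and> (\<forall>J F. finite J \<longrightarrow> dep J F \<longrightarrow> (\<integral>s. F s \<partial>M) = l F)"
proof -
  let ?B = "\<lambda>J :: vertex set. \<Pi>\<^sub>M x\<in>J. (borel :: real measure)"
  define q where "q J B = l (indicator (cyl J B))" for J B
  \<comment> \<open>The law of the spins in J, placed on real-valued functions so that the
    coordinates are Polish, as the Kolmogorov extension theorem asks.\<close>
  define P where "P J = distr (point_measure (Pow J) (\<lambda>B. ennreal (q J B))) (?B J) (\<lambda>B. restrict (conf B) J)" for J
  have q0: "q J B \<ge> 0" if "finite J" for J B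
    unfolding q_def by (rule nonneg[OF that dep_indicator_cyl]) simp
  have sp: "sets (P J) = sets (?B J)" for J by (simp add: P_def)
  have meas: "(\<lambda>B. restrict (conf B) J) \<in> measurable (point_measure (Pow J) f) (?B J)" for J and f :: "vertex set \<Rightarrow> ennreal"
    by (auto simp: measurable_point_measure_eq1 space_PiM)
  have depX: "dep J (\<lambda>s. indicator X (restrict s J) :: real)" for J X
    unfolding dep_def by (metis restrict_ext)
  have lcong: "l F = l G" if "finite J" "dep J F" "\<And>s. s \<in> \<Omega> \<Longrightarrow> F s = G s" for J F G
  proof -
    have "dep J G" using that(2,3) unfolding dep_def by metis
    then show ?thesis
      unfolding expand[OF that(1,2)] expand[OF that(1) \<open>dep J G\<close>] using that(3) by simp
  qed
  have P_eq: "emeasure (P J) X = ennreal (l (\<lambda>s. indicator X (restrict s J)))"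
    if J: "finite J" and X: "X \<in> sets (?B J)" for J X
  proof -
    have "emeasure (P J) X = emeasure (point_measure (Pow J) (\<lambda>B. ennreal (q J B))) {B\<in>Pow J. restrict (conf B) J \<in> X}"
      unfolding P_def by (subst emeasure_distr[OF meas X])
        (simp add: space_point_measure, rule arg_cong[where f = "emeasure _"], auto)
    also have "\<dots> = (\<Sum>B\<in>{B\<in>Pow J. restrict (conf B) J \<in> X}. ennreal (q J B))"
      using J by (intro emeasure_point_measure_finite) auto
    also have "\<dots> = (\<Sum>B\<in>Pow J. ennreal (indicator X (restrict (conf B) J) * q J B))"
      using J by (intro sum.mono_neutral_cong_left) (auto simp: indicator_def)
    also have "\<dots> = ennreal (\<Sum>B\<in>Pow J. indicator X (restrict (conf B) J) * q J B)"
      using q0[OF J] by (intro sum_ennreal) auto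
    also have "\<dots> = ennreal (l (\<lambda>s. indicator X (restrict s J)))"
      unfolding expand[OF J depX] q_def ..
    finally show ?thesis .
  qed
  interpret K: polish_projective UNIV P
  proof (intro polish_projective.intro projective_family.intro)
    fix J H :: "vertex set" assume JH: "J \<subseteq> H" "finite H"
    then have J: "finite J" using finite_subset by auto
    show "P J = distr (P H) (?B J) (\<lambda>f. restrict f J)"
    proof (rule measure_eqI)
      show "sets (P J) = sets (distr (P H) (?B J) (\<lambda>f. restrict f J))" by (simp add: sp)
      fix X assume "X \<in> sets (P J)"
      then have X: "X \<in> sets (?B J)" by (simp add: sp)
      have r: "(\<lambda>f. restrict f J) \<in> measurable (P H) (?B J)"
        unfolding measurable_cong_sets[OF sp refl] by (rule measurable_restrict_subset[OF JH(1)])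
      let ?Y = "(\<lambda>f. restrict f J) -` X \<inter> space (P H)"
      have Y: "?Y \<in> sets (?B H)" using measurable_sets[OF r X] by (simp add: sp)
      have "emeasure (distr (P H) (?B J) (\<lambda>f. restrict f J)) X = ennreal (l (\<lambda>s. indicator ?Y (restrict s H)))"
        unfolding emeasure_distr[OF r X] by (rule P_eq[OF JH(2) Y])
      also have "l (\<lambda>s. indicator ?Y (restrict s H)) = l (\<lambda>s. indicator X (restrict s J))"
      proof (rule lcong[OF JH(2) depX])
        fix s :: spins
        have "restrict (restrict s H) J = restrict s J"
          using JH(1) by (simp add: Int_absorb1)
        moreover have "restrict s H \<in> space (P H)"
          using sets_eq_imp_space_eq[OF sp[of H]] by (simp add: space_PiM)
        ultimately show "indicator ?Y (restrict s H) = (indicator X (restrict s J) :: real)"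
          by (simp add: indicator_def)
      qed
      finally show "emeasure (P J) X = emeasure (distr (P H) (?B J) (\<lambda>f. restrict f J)) X"
        unfolding P_eq[OF J X] by (rule sym)
    qed
  next
    fix J :: "vertex set" assume J: "finite J"
    show "prob_space (P J)"
    proof (rule prob_spaceI)
      have "emeasure (P J) (space (P J)) = ennreal (l (\<lambda>s. indicator (space (P J)) (restrict s J)))"
        using J by (intro P_eq) (auto simp: sp[symmetric])
      also have "l (\<lambda>s. indicator (space (P J)) (restrict s J)) = l (\<lambda>_. 1)"
      proof (rule lcong[OF J depX])
        fix s :: spins
        have "restrict s J \<in> space (P J)"
          using sets_eq_imp_space_eq[OF sp[of J]] by (simp add: space_PiM)
        then show "indicator (space (P J)) (restrict s J) = (1 :: real)" by simp
      qed
      finally show "emeasure (P J) (space (P J)) = 1" by (simp add: one)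
    qed
  qed
  \<comment> \<open>Turns a real-valued configuration back into spins: every value other than 1
    becomes -1. The marginals \<open>P J\<close> are carried by spin patterns, which this map
    fixes.\<close>
  define r :: "spins \<Rightarrow> spins" where "r s = (\<lambda>x. if s x = 1 then 1 else -1)" for s
  have r: "r \<in> measurable K.lim spin_space"
  proof -
    have "(\<lambda>s. \<lambda>x\<in>UNIV. if s x = 1 then 1 else -1 :: real) \<in> measurable (?B UNIV) spin_space"
      unfolding spin_space_def
    proof (rule measurable_restrict)
      fix x :: vertex
      have 1: "(\<lambda>s. s x) \<in> measurable (?B UNIV) borel" by measurable
      have 2: "(\<lambda>y::real. if y = 1 then 1 else -1 :: real) \<in> measurable borel (count_space {-1,1})"
        by (rule measurable_If) auto
      show "(\<lambda>s. if s x = 1 then 1 else -1 :: real) \<in> measurable (?B UNIV) (count_space {-1, 1})"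
        using measurable_compose[OF 1 2] .
    qed
    moreover have "sets K.lim = sets (?B UNIV)" by (rule K.sets_lim)
    ultimately show ?thesis
      unfolding r_def[abs_def] by (simp add: measurable_cong_sets[OF \<open>sets K.lim = _\<close> refl] restrict_def)
  qed
  define M where "M = distr K.lim spin_space r"
  have M: "spin_prob M"
    unfolding spin_prob_def M_def using K.P.prob_space_distr[OF r] by simp
  interpret M: prob_space M using M by (simp add: spin_prob_def)
  have cyl: "measure M (cyl J B) = l (indicator (cyl J B))" if J: "finite J" for J B
  proof -
    define X where "X = {f \<in> space (?B J). \<forall>x\<in>J. (if f x = 1 then 1 else -1) = conf B x}"
    have X: "X \<in> sets (?B J)"
    proof -
      have "X = {f \<in> space (?B J). \<forall>x\<in>J. f x \<in> {y. (if y = 1 then 1 else -1) = conf B x}}"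
        by (simp add: X_def)
      moreover have "{y :: real. (if y = 1 then 1 else -1) = conf B x} \<in> sets borel" for x
      proof (cases "x \<in> B")
        case True
        then have "{y :: real. (if y = 1 then 1 else -1) = conf B x} = {1}" by (auto simp: conf_def)
        then show ?thesis by simp
      next
        case False
        then have "{y :: real. (if y = 1 then 1 else -1) = conf B x} = - {1}" by (auto simp: conf_def)
        then show ?thesis by simp
      qed
      ultimately show ?thesis
        using J by (simp add: sets.sets_Collect_finite_All measurable_sets_Collect) measurable
    qed
    have "emeasure M (cyl J B) = emeasure K.lim (r -` cyl J B \<inter> space K.lim)"
      unfolding M_def by (rule emeasure_distr[OF r sets_cyl[OF J]])
    also have "r -` cyl J B \<inter> space K.lim = prod_emb UNIV (\<lambda>_. borel) J X"
      unfolding K.space_lim by (auto simp: prod_emb_def space_PiM cyl_def X_def r_def space_spin)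
    also have "emeasure K.lim \<dots> = emeasure (P J) X"
      using J X by (intro K.emeasure_lim_emb) auto
    also have "\<dots> = ennreal (l (\<lambda>s. indicator X (restrict s J)))"
      by (rule P_eq[OF J X])
    also have "l (\<lambda>s. indicator X (restrict s J)) = l (indicator (cyl J B))"
    proof (rule lcong[OF J depX])
      fix s assume s: "s \<in> \<Omega>"
      have "(if s x = 1 then 1 else -1) = s x" for x using s by (auto simp: space_spin)
      then have "restrict s J \<in> X \<longleftrightarrow> s \<in> cyl J B"
        using s by (auto simp: X_def cyl_def space_PiM)
      then show "indicator X (restrict s J) = (indicator (cyl J B) s :: real)"
        by (simp add: indicator_def)
    qed
    finally show ?thesis
      using q0[OF J, of B] by (simp add: M.emeasure_eq_measure q_def)
  qed
  have "(\<integral>s. F s \<partial>M) = l F" if "finite J" "dep J F" for J F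
    unfolding integral_dep[OF M that(2,1)] expand[OF that] using cyl[OF that(1)] by simp
  with M show ?thesis by blast
qed

text \<open>Compactness gives convergence on all cylinders along a subsequence. The limit satisfies
  the DLR equation in D because \<open>gexp_gexp\<close> applies as soon as the volume contains D
  and because the kernel of a local function is local. Boundary conditions may vary with n;
  \<open>kernel_uniform\<close> depends on this freedom.\<close>

lemma gibbs_limit:
  assumes L: "\<And>n. finite (L n)" and \<eta>: "\<And>n. \<eta> n \<in> \<Omega>"
    and exh: "\<And>D. finite D \<Longrightarrow> \<forall>\<^sub>F n in sequentially. D \<subseteq> L n"
  shows "\<exists>r N. strict_mono r \<and> ising_gibbs \<beta> N \<and>
    (\<forall>J F. finite J \<longrightarrow> dep J F \<longrightarrow> (\<lambda>n. gexp \<beta> (L (r n)) (\<eta> (r n)) F) \<longlonglongrightarrow> (\<integral>s. F s \<partial>N))"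
proof -
  \<comment> \<open>Finite sets are listed, since lists of vertices form a countable type: the
    product space is then first countable, and compactness provides convergent subsequences.\<close>
  define f where "f n = (\<lambda>(js, bs). gexp \<beta> (L n) (\<eta> n) (indicator (cyl (set js) (set bs))))"
    for n
  have f01: "f n \<in> {f. \<forall>x. f x \<in> {0..1}}" for n
  proof -
    have "gexp \<beta> (L n) (\<eta> n) (indicator A) \<in> {0..1}" for A
      using gexp_bounds[OF L \<eta>, where a = 0 and b = 1 and F = "indicator A"]
      by (simp add: indicator_def)
    then show ?thesis by (simp add: f_def split: prod.split del: atLeastAtMost_iff)
  qed
  have "seq_compact {f :: vertex list \<times> vertex list \<Rightarrow> real. \<forall>x. f x \<in> {0..1}}"
    by (rule compact_imp_seq_compact[OF compact_unit_functions])
  then obtain \<phi> r where r: "strict_mono r" and lim: "(f \<circ> r) \<longlonglongrightarrow> \<phi>"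
    using f01 unfolding seq_compact_def by blast
  have conv_cyl: "convergent (\<lambda>n. gexp \<beta> (L (r n)) (\<eta> (r n)) (indicator (cyl J B)))"
    if J: "finite J" and B: "B \<subseteq> J" for J B
  proof -
    obtain js where js: "set js = J" using finite_list[OF J] by auto
    obtain bs where bs: "set bs = B" using finite_list finite_subset[OF B J] by auto
    have "continuous_on UNIV (\<lambda>g :: vertex list \<times> vertex list \<Rightarrow> real. g (js, bs))"
      by (rule continuous_on_product_coordinates)
    then have "isCont (\<lambda>g :: vertex list \<times> vertex list \<Rightarrow> real. g (js, bs)) \<phi>"
      unfolding continuous_on_eq_continuous_at[OF open_UNIV] by blast
    from isCont_tendsto_compose[OF this lim]
    have "(\<lambda>n. (f \<circ> r) n (js, bs)) \<longlonglongrightarrow> \<phi> (js, bs)" .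
    then show ?thesis
      unfolding convergent_def by (auto simp: f_def js bs)
  qed
  define l where "l F = lim (\<lambda>n. gexp \<beta> (L (r n)) (\<eta> (r n)) F)" for F
  have conv: "(\<lambda>n. gexp \<beta> (L (r n)) (\<eta> (r n)) F) \<longlonglongrightarrow> (\<Sum>B\<in>Pow J. F (conf B) * l (indicator (cyl J B)))"
    if J: "finite J" and F: "dep J F" for J F
    unfolding gexp_expand[OF F J]
  proof (intro tendsto_intros)
    fix B assume "B \<in> Pow J"
    then show "(\<lambda>n. gexp \<beta> (L (r n)) (\<eta> (r n)) (indicator (cyl J B))) \<longlonglongrightarrow> l (indicator (cyl J B))"
      using conv_cyl[OF J] unfolding l_def by (simp add: convergent_LIMSEQ_iff)
  qed
  have expand: "l F = (\<Sum>B\<in>Pow J. F (conf B) * l (indicator (cyl J B)))" if "finite J" "dep J F" for J F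
    unfolding l_def[of F] using conv[OF that] by (rule limI)
  have conv': "(\<lambda>n. gexp \<beta> (L (r n)) (\<eta> (r n)) F) \<longlonglongrightarrow> l F" if "finite J" "dep J F" for J F
    using conv[OF that] expand[OF that] by simp
  have "\<exists>N. spin_prob N \<and> (\<forall>J F. finite J \<longrightarrow> dep J F \<longrightarrow> (\<integral>s. F s \<partial>N) = l F)"
  proof (rule spin_prob_extension[OF _ expand])
    fix J F assume "finite J" "dep J F" "\<And>s. s \<in> \<Omega> \<Longrightarrow> F s \<ge> (0::real)"
    then show "l F \<ge> 0"
    proof (intro LIMSEQ_le_const[OF conv'], goal_cases)
      case 3
      have "0 \<le> gexp \<beta> (L (r n)) (\<eta> (r n)) F" for n
        using gexp_mono[OF L \<eta>, where F = "\<lambda>_. 0" and G = F] 3 gexp_const[OF L \<eta>, where c = 0] by (auto simp: ext_iff)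
      then show ?case by blast
    qed auto
  next
    show "l (\<lambda>_. 1) = 1"
      unfolding l_def by (simp add: gexp_const[OF L \<eta>])
  qed
  then obtain N where N: "spin_prob N" and NI: "\<And>J F. finite J \<Longrightarrow> dep J F \<Longrightarrow> (\<integral>s. F s \<partial>N) = l F"
    by blast
  have "ising_gibbs \<beta> N"
  proof (rule gibbsI_cyl[OF N])
    fix D J :: "vertex set" and F :: "spins \<Rightarrow> real"
    assume D: "finite D" and J: "finite J" and F: "dep J F"
    let ?J = "J - D \<union> (bdry D - D)"
    have J': "finite ?J" by (rule finite_dep_gexp_support[OF J D])
    have "\<forall>\<^sub>F n in sequentially. D \<subseteq> L (r n)"
      by (rule eventually_compose_filterlim[OF exh[OF D] filterlim_subseq[OF r]])
    then have "\<forall>\<^sub>F n in sequentially. gexp \<beta> (L (r n)) (\<eta> (r n)) (\<lambda>s. gexp \<beta> D s F) = gexp \<beta> (L (r n)) (\<eta> (r n)) F"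
      by eventually_elim (simp add: gexp_gexp[OF L _ \<eta>])
    then have "(\<lambda>n. gexp \<beta> (L (r n)) (\<eta> (r n)) F) \<longlonglongrightarrow> l (\<lambda>s. gexp \<beta> D s F)"
      using conv'[OF J' dep_gexp[OF F]] by (rule Lim_transform_eventually[rotated])
    then have "l (\<lambda>s. gexp \<beta> D s F) = l F"
      using conv'[OF J F] LIMSEQ_unique by blast
    then show "(\<integral>\<eta>. gexp \<beta> D \<eta> F \<partial>N) = (\<integral>s. F s \<partial>N)"
      using NI[OF J' dep_gexp[OF F]] NI[OF J F] by simp
  qed
  moreover have "(\<lambda>n. gexp \<beta> (L (r n)) (\<eta> (r n)) F) \<longlonglongrightarrow> (\<integral>s. F s \<partial>N)"
    if "finite J" "dep J F" for J F
    unfolding NI[OF that] by (rule conv'[OF that])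
  ultimately show ?thesis
    using r by blast
qed

section \<open>Exhaustion by boxes, existence, and uniformity in the boundary condition\<close>

definition vbox :: "nat \<Rightarrow> vertex set" where
  "vbox n = {- int n..int n} \<times> {- int n..int n}"

lemma finite_vbox [simp]: "finite (vbox n)"
  by (simp add: vbox_def)

lemma vbox_mono: "m \<le> n \<Longrightarrow> vbox m \<subseteq> vbox n"
  by (auto simp: vbox_def)

lemma vbox_exhausts: "finite D \<Longrightarrow> \<exists>n. D \<subseteq> vbox n"
proof (induction rule: finite_induct)
  case (insert x D)
  then obtain n where n: "D \<subseteq> vbox n" by auto
  have "x \<in> vbox (nat \<bar>fst x\<bar> + nat \<bar>snd x\<bar>)"
    by (cases x) (auto simp: vbox_def)
  then have "insert x D \<subseteq> vbox (n + (nat \<bar>fst x\<bar> + nat \<bar>snd x\<bar>))"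
    using n vbox_mono[of n "n + (nat \<bar>fst x\<bar> + nat \<bar>snd x\<bar>)"]
      vbox_mono[of "nat \<bar>fst x\<bar> + nat \<bar>snd x\<bar>" "n + (nat \<bar>fst x\<bar> + nat \<bar>snd x\<bar>)"] by auto
  then show ?case by blast
qed auto

lemma eventually_vbox: "finite D \<Longrightarrow> \<forall>\<^sub>F n in sequentially. D \<subseteq> vbox n"
  using vbox_exhausts vbox_mono unfolding eventually_sequentially by (meson subset_trans)

lemma gibbs_exists: "\<exists>M. ising_gibbs \<beta> M"
  using gibbs_limit[of vbox "\<lambda>_. conf {}" \<beta>] eventually_vbox by auto

text \<open>Otherwise every box has a boundary condition for which the kernel misses the limit by e;
  a subsequential limit of these kernels would be a Gibbs measure other than M. No rate is obtained,
  and none is used later.\<close>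

lemma kernel_uniform:
  assumes M: "ising_gibbs \<beta> M" and uniq: "\<And>N. ising_gibbs \<beta> N \<Longrightarrow> N = M"
    and F: "dep J F" "finite J" and e: "e > 0"
  shows "\<exists>L. finite L \<and> (\<forall>\<eta>\<in>\<Omega>. \<bar>gexp \<beta> L \<eta> F - (\<integral>s. F s \<partial>M)\<bar> < e)"
proof (rule ccontr)
  assume "\<not> ?thesis"
  then have "\<forall>n. \<exists>\<eta>\<in>\<Omega>. \<bar>gexp \<beta> (vbox n) \<eta> F - (\<integral>s. F s \<partial>M)\<bar> \<ge> e"
    by (meson finite_vbox linorder_not_less)
  then obtain \<eta> where \<eta>: "\<And>n. \<eta> n \<in> \<Omega>" and bad: "\<And>n. \<bar>gexp \<beta> (vbox n) (\<eta> n) F - (\<integral>s. F s \<partial>M)\<bar> \<ge> e"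
    by metis
  obtain r N where r: "strict_mono r" and N: "ising_gibbs \<beta> N"
    and lim: "(\<lambda>n. gexp \<beta> (vbox (r n)) (\<eta> (r n)) F) \<longlonglongrightarrow> (\<integral>s. F s \<partial>N)"
    using gibbs_limit[of vbox \<eta> \<beta>] \<eta> eventually_vbox F by auto
  have "(\<lambda>n. \<bar>gexp \<beta> (vbox (r n)) (\<eta> (r n)) F - (\<integral>s. F s \<partial>M)\<bar>) \<longlonglongrightarrow> 0"
    using tendsto_rabs[OF tendsto_diff[OF lim tendsto_const[of "\<integral>s. F s \<partial>M"]]] uniq[OF N] by simp
  then have "e \<le> 0"
    by (rule LIMSEQ_le_const) (use bad in auto)
  with e show False by simp
qed


section \<open>Dobrushin uniqueness at high temperature\<close>

definition osc :: "(spins \<Rightarrow> real) \<Rightarrow> (vertex \<Rightarrow> real) \<Rightarrow> bool" where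
  "osc F d \<longleftrightarrow> (\<forall>x. \<forall>s\<in>\<Omega>. \<forall>t\<in>\<Omega>. (\<forall>y. y \<noteq> x \<longrightarrow> s y = t y) \<longrightarrow> \<bar>F s - F t\<bar> \<le> d x)"

lemma oscD: "osc F d \<Longrightarrow> s \<in> \<Omega> \<Longrightarrow> t \<in> \<Omega> \<Longrightarrow> (\<And>y. y \<noteq> x \<Longrightarrow> s y = t y) \<Longrightarrow> \<bar>F s - F t\<bar> \<le> d x"
  unfolding osc_def by blast

lemma osc_telescope:
  assumes F: "osc F d" and A: "finite A" and "s \<in> \<Omega>" "t \<in> \<Omega>" "\<And>y. y \<notin> A \<Longrightarrow> s y = t y"
  shows "\<bar>F s - F t\<bar> \<le> (\<Sum>x\<in>A. d x)"
  using A assms(3-)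
proof (induction A arbitrary: s rule: finite_induct)
  case empty
  then have "s = t" by auto
  then show ?case by simp
next
  case (insert x A)
  define s' where "s' = s(x := t x)"
  have s': "s' \<in> \<Omega>" using insert.prems by (auto simp: space_spin s'_def)
  have "\<bar>F s - F s'\<bar> \<le> d x"
    by (rule oscD[OF F insert.prems(1) s']) (simp add: s'_def)
  moreover have "\<bar>F s' - F t\<bar> \<le> (\<Sum>x\<in>A. d x)"
  proof (rule insert.IH[OF s' insert.prems(2)])
    fix y assume "y \<notin> A"
    then show "s' y = t y" using insert.prems(3)[of y] by (cases "y = x") (auto simp: s'_def)
  qed
  ultimately show ?case using insert.hyps by simp
qed

lemma osc_dep_bound:
  assumes "osc F d" "dep J F" "finite J" "s \<in> \<Omega>" "t \<in> \<Omega>"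
  shows "\<bar>F s - F t\<bar> \<le> (\<Sum>x\<in>J. d x)"
proof -
  have g: "graft J t s \<in> \<Omega>" by (rule graft_in) fact+
  have "F t = F (graft J t s)"
    by (rule depD[OF assms(2,5) g]) (simp add: graft_def)
  moreover have "\<bar>F s - F (graft J t s)\<bar> \<le> (\<Sum>x\<in>J. d x)"
    by (rule osc_telescope[OF assms(1,3,4) g]) (simp add: graft_def)
  ultimately show ?thesis by simp
qed

text \<open>The difference equals a b (q - r) over (a + b) (a r + b q). Here |q - r| is at most k -
  1/k, and the denominator is at least a b / k.\<close>

lemma ratio_perturb:
  fixes a b r q k :: real
  assumes "a > 0" "b > 0" "1 / k \<le> r" "r \<le> k" "1 / k \<le> q" "q \<le> k" "k \<ge> 1"
  shows "\<bar>a / (a + b) - a * r / (a * r + b * q)\<bar> \<le> k\<^sup>2 - 1"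
proof -
  have k: "k > 0" "1 / k > 0" using assms by auto
  have rq: "r > 0" "q > 0" using assms k by linarith+
  have pos: "a + b > 0" "a * r + b * q > 0" using assms rq by (auto intro: add_pos_pos)
  have "a / (a + b) - a * r / (a * r + b * q) = a * b * (q - r) / ((a + b) * (a * r + b * q))"
    using pos by (simp add: diff_frac_eq algebra_simps)
  then have "\<bar>a / (a + b) - a * r / (a * r + b * q)\<bar> = a * b * \<bar>q - r\<bar> / ((a + b) * (a * r + b * q))"
    using assms pos by (simp add: abs_mult)
  also have "\<dots> \<le> a * b * (k - 1 / k) / (a * b * (1 / k))"
  proof (rule frac_le)
    have "\<bar>q - r\<bar> \<le> k - 1 / k" using assms by linarith
    then show "a * b * \<bar>q - r\<bar> \<le> a * b * (k - 1 / k)" using assms by (intro mult_left_mono) auto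
    have "1 / k * (a + b) \<le> a * r + b * q"
      using mult_left_mono[OF assms(3), of a] mult_left_mono[OF assms(5), of b] assms by (simp add: algebra_simps add_divide_distrib)
    then have "(a + b) * (1 / k * (a + b)) \<le> (a + b) * (a * r + b * q)"
      using pos by (intro mult_left_mono) auto
    moreover have "a * b * (1 / k) \<le> (a + b) * (1 / k * (a + b))"
    proof -
      have "a * b \<le> (a + b) * (a + b)" using assms(1,2) by (simp add: algebra_simps)
      from mult_right_mono[OF this, of "1 / k"] k show ?thesis by (simp add: algebra_simps add_divide_distrib)
    qed
    ultimately show "a * b * (1 / k) \<le> (a + b) * (a * r + b * q)" by linarith
    show "0 < a * b * (1 / k)" using assms k by simp
    show "0 \<le> a * b * (k - 1 / k)" using assms k by (intro mult_nonneg_nonneg) (auto simp: divide_le_eq intro: order_trans)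
  qed
  also have "\<dots> = k\<^sup>2 - 1"
    using assms k by (simp add: field_simps power2_eq_square)
  finally show ?thesis .
qed

lemma gexp_single:
  fixes \<beta> :: real and x :: vertex
  assumes "\<eta> \<in> \<Omega>"
  defines "a \<equiv> ising_weight \<beta> {x} (\<eta>(x := 1))" and "b \<equiv> ising_weight \<beta> {x} (\<eta>(x := -1))"
  shows "gexp \<beta> {x} \<eta> F = a / (a + b) * F (\<eta>(x := 1)) + (1 - a / (a + b)) * F (\<eta>(x := -1))"
proof -
  have g: "graft {x} (conf {x}) \<eta> = \<eta>(x := 1)" "graft {x} (conf {}) \<eta> = \<eta>(x := -1)"
    by (auto simp: graft_def conf_def fun_eq_iff)
  have P: "Pow {x} = {{}, {x}}" by auto
  have ab: "a + b > 0" using weight_pos[of \<beta>] by (simp add: a_def b_def add_pos_pos)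
  have "gexp \<beta> {x} \<eta> F = (F (\<eta>(x := 1)) * a + F (\<eta>(x := -1)) * b) / (a + b)"
    unfolding gexp_graft[OF assms(1)] P a_def b_def by (simp add: g add.commute)
  also have "\<dots> = a / (a + b) * F (\<eta>(x := 1)) + (1 - a / (a + b)) * F (\<eta>(x := -1))"
  proof -
    have "1 - a / (a + b) = b / (a + b)" using ab by (simp add: field_simps)
    then show ?thesis by (simp add: add_divide_distrib mult.commute)
  qed
  finally show ?thesis .
qed

text \<open>Among the edges at x only {x, y} can see the spin at y, and its spin product moves by at
  most 2.\<close>

lemma weight_single_perturb:
  assumes "s \<in> \<Omega>" "t \<in> \<Omega>" "\<And>z. z \<noteq> y \<Longrightarrow> s z = t z" "y \<noteq> x"
  shows "\<exists>r. ising_weight \<beta> {x} t = ising_weight \<beta> {x} s * r \<and> exp (- 2 * \<bar>\<beta>\<bar>) \<le> r \<and> r \<le> exp (2 * \<bar>\<beta>\<bar>)"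
proof -
  let ?E = "{e \<in> edges. e \<inter> {x} \<noteq> {}}"
  define D where "D = (\<Sum>e\<in>?E. \<Prod>z\<in>e. t z) - (\<Sum>e\<in>?E. \<Prod>z\<in>e. s z)"
  have fin: "finite ?E" by (rule finite_edges_touching) simp
  have abs1: "\<bar>u z\<bar> = 1" if "u \<in> \<Omega>" for u z
  proof -
    have "u z = 1 \<or> u z = -1" using that unfolding space_spin by blast
    then show ?thesis by auto
  qed
  have p1: "\<bar>\<Prod>z\<in>e. u z\<bar> = 1" if "u \<in> \<Omega>" for u e
    unfolding abs_prod using abs1[OF that] by simp
  have "D = (\<Sum>e\<in>?E. (\<Prod>z\<in>e. t z) - (\<Prod>z\<in>e. s z))"
    by (simp add: D_def sum_subtractf)
  also have "\<dots> = (\<Sum>e\<in>?E \<inter> {{x, y}}. (\<Prod>z\<in>e. t z) - (\<Prod>z\<in>e. s z))"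
  proof (rule sum.mono_neutral_right[OF fin])
    show "\<forall>e\<in>?E - ?E \<inter> {{x, y}}. (\<Prod>z\<in>e. t z) - (\<Prod>z\<in>e. s z) = 0"
    proof
      fix e assume e: "e \<in> ?E - ?E \<inter> {{x, y}}"
      then have "e \<in> edges" "x \<in> e" by auto
      then obtain w where w: "e = {x, w}" using edge_obtain by blast
      have "y \<notin> e" using e w assms(4) by auto
      have "(\<Prod>z\<in>e. t z) = (\<Prod>z\<in>e. s z)"
      proof (rule prod.cong[OF refl])
        fix z assume "z \<in> e"
        then have "z \<noteq> y" using \<open>y \<notin> e\<close> by blast
        then show "t z = s z" by (rule assms(3)[symmetric])
      qed
      then show "(\<Prod>z\<in>e. t z) - (\<Prod>z\<in>e. s z) = 0" by simp
    qed
  qed auto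
  finally have D: "D = (\<Sum>e\<in>?E \<inter> {{x, y}}. (\<Prod>z\<in>e. t z) - (\<Prod>z\<in>e. s z))" .
  have "\<bar>D\<bar> \<le> (\<Sum>e\<in>?E \<inter> {{x, y}}. 2)"
    unfolding D
  proof (rule order_trans[OF sum_abs sum_mono])
    fix e
    show "\<bar>(\<Prod>z\<in>e. t z) - (\<Prod>z\<in>e. s z)\<bar> \<le> 2"
      using p1[OF assms(1), of e] p1[OF assms(2), of e] by linarith
  qed
  also have "\<dots> \<le> (\<Sum>e\<in>{{x, y}}. 2)" by (rule sum_mono2) auto
  finally have "\<bar>D\<bar> \<le> 2" by simp
  then have "\<bar>\<beta> * D\<bar> \<le> 2 * \<bar>\<beta>\<bar>"
    using mult_left_mono[of "\<bar>D\<bar>" 2 "\<bar>\<beta>\<bar>"] by (simp add: abs_mult)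
  then have "- 2 * \<bar>\<beta>\<bar> \<le> \<beta> * D" "\<beta> * D \<le> 2 * \<bar>\<beta>\<bar>" by linarith+
  moreover have "ising_weight \<beta> {x} t = ising_weight \<beta> {x} s * exp (\<beta> * D)"
    unfolding ising_weight_def D_def by (simp add: exp_add[symmetric] algebra_simps)
  ultimately show ?thesis by (metis exp_le_cancel_iff)
qed

lemma weight_single_nonadj:
  assumes "\<And>z. z \<noteq> y \<Longrightarrow> s z = t z" "y \<noteq> x" "\<not> adj x y"
  shows "ising_weight \<beta> {x} t = ising_weight \<beta> {x} s"
proof (rule weight_cong)
  fix z assume "z \<in> bdry {x}"
  then have "z = x \<or> adj x z" unfolding bdry_def by blast
  then have "z \<noteq> y" using assms(2,3) by auto
  then show "t z = s z" using assms(1)[of z] by simp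
qed

text \<open>Resampling at x removes the dependence on the spin at x, but the law of the new spin
  depends on the neighbours of x; each neighbour thereby inherits at most the fraction c of
  \<open>d x\<close>.\<close>

lemma osc_gexp_single:
  assumes F: "osc F d" and d: "\<And>x. d x \<ge> 0" and c: "(exp (2 * \<bar>\<beta>\<bar>))\<^sup>2 - 1 \<le> c"
  shows "osc (\<lambda>\<eta>. gexp \<beta> {x} \<eta> F) (\<lambda>y. if y = x then 0 else d y + (if adj x y then c * d x else 0))"
  unfolding osc_def
proof (intro allI ballI impI)
  fix y s t assume st: "s \<in> \<Omega>" "t \<in> \<Omega>" "\<forall>z. z \<noteq> y \<longrightarrow> s z = t z"
  let ?d = "if y = x then 0 else d y + (if adj x y then c * d x else 0)"
  show "\<bar>gexp \<beta> {x} s F - gexp \<beta> {x} t F\<bar> \<le> ?d"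
  proof (cases "y = x")
    case True
    then have "t \<in> extensions {x} s" using st by (simp add: ext_iff)
    then have "gexp \<beta> {x} t F = gexp \<beta> {x} s F" unfolding gexp_def by (simp add: ext_eq)
    then show ?thesis using True by simp
  next
    case False
    let ?k = "exp (2 * \<bar>\<beta>\<bar>)"
    define a where "a = ising_weight \<beta> {x} (s(x := 1))"
    define b where "b = ising_weight \<beta> {x} (s(x := -1))"
    define a' where "a' = ising_weight \<beta> {x} (t(x := 1))"
    define b' where "b' = ising_weight \<beta> {x} (t(x := -1))"
    define p where "p = a / (a + b)"
    define p' where "p' = a' / (a' + b')"
    have pos: "a > 0" "b > 0" "a' > 0" "b' > 0"
      by (auto simp: a_def b_def a'_def b'_def weight_pos)
    have in\<Omega>: "s(x := 1) \<in> \<Omega>" "s(x := -1) \<in> \<Omega>" "t(x := 1) \<in> \<Omega>" "t(x := -1) \<in> \<Omega>"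
      using st by (auto simp: space_spin)
    have agree: "(s(x := v)) z = (t(x := v)) z" if "z \<noteq> y" for z v using st that by auto
    have p01: "0 \<le> p'" "p' \<le> 1" using pos by (auto simp: p'_def)
    have pp: "\<bar>p - p'\<bar> \<le> (if adj x y then c else 0)"
    proof (cases "adj x y")
      case True
      obtain r where r: "a' = a * r" "exp (- 2 * \<bar>\<beta>\<bar>) \<le> r" "r \<le> ?k"
        using weight_single_perturb[OF in\<Omega>(1,3) agree False, of \<beta>] unfolding a_def a'_def by blast
      obtain q where q: "b' = b * q" "exp (- 2 * \<bar>\<beta>\<bar>) \<le> q" "q \<le> ?k"
        using weight_single_perturb[OF in\<Omega>(2,4) agree False, of \<beta>] unfolding b_def b'_def by blast
      have "exp (- 2 * \<bar>\<beta>\<bar>) = 1 / ?k" by (simp add: exp_minus field_simps)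
      then have "\<bar>p - p'\<bar> \<le> ?k\<^sup>2 - 1"
        unfolding p_def p'_def r(1) q(1) using r q pos by (intro ratio_perturb) auto
      then show ?thesis using c True by simp
    next
      case nadj: False
      have "a' = a" "b' = b"
        unfolding a_def a'_def b_def b'_def by (rule weight_single_nonadj[OF agree False nadj], assumption)+
      then show ?thesis using nadj by (simp add: p_def p'_def)
    qed
    have e1: "\<bar>F (s(x := 1)) - F (t(x := 1))\<bar> \<le> d y" by (rule oscD[OF F in\<Omega>(1,3)]) (rule agree)
    have e2: "\<bar>F (s(x := -1)) - F (t(x := -1))\<bar> \<le> d y" by (rule oscD[OF F in\<Omega>(2,4)]) (rule agree)
    have e3: "\<bar>F (s(x := 1)) - F (s(x := -1))\<bar> \<le> d x" by (rule oscD[OF F in\<Omega>(1,2)]) simp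
    \<comment> \<open>The first two terms compare s and t with the same spin at x, weighted by its
      law under t; the last one pays for the change of that law.\<close>
    have "gexp \<beta> {x} s F - gexp \<beta> {x} t F
      = p' * (F (s(x := 1)) - F (t(x := 1))) + (1 - p') * (F (s(x := -1)) - F (t(x := -1)))
        + (p - p') * (F (s(x := 1)) - F (s(x := -1)))"
      unfolding gexp_single[OF st(1)] gexp_single[OF st(2)] a_def[symmetric] b_def[symmetric]
        a'_def[symmetric] b'_def[symmetric] p_def[symmetric] p'_def[symmetric]
      by (simp add: algebra_simps)
    also have "\<bar>\<dots>\<bar> \<le> p' * d y + (1 - p') * d y + (if adj x y then c else 0) * d x"
    proof -
      have "\<bar>p' * (F (s(x := 1)) - F (t(x := 1)))\<bar> \<le> p' * d y"
        using e1 p01 by (simp add: abs_mult mult_left_mono)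
      moreover have "\<bar>(1 - p') * (F (s(x := -1)) - F (t(x := -1)))\<bar> \<le> (1 - p') * d y"
        using e2 p01 by (simp add: abs_mult mult_left_mono)
      moreover have "\<bar>(p - p') * (F (s(x := 1)) - F (s(x := -1)))\<bar> \<le> (if adj x y then c else 0) * d x"
        unfolding abs_mult using pp e3 by (intro mult_mono) (auto split: if_splits)
      ultimately show ?thesis by linarith
    qed
    also have "\<dots> = ?d" using False by (simp add: algebra_simps)
    finally show ?thesis .
  qed
qed

text \<open>Resampling the spin at a further vertex \<open>x\<close> halves the weight of \<open>x\<close>.  Once this is done on the
  whole support of \<open>F\<close>, the constant \<open>\<alpha>\<close> itself is halved.\<close>

definition dobrushin_bound :: "spins measure \<Rightarrow> spins measure \<Rightarrow> real \<Rightarrow> vertex set \<Rightarrow> bool" where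
  "dobrushin_bound M N \<alpha> S \<longleftrightarrow> (\<forall>J F d. finite J \<longrightarrow> dep J F \<longrightarrow> osc F d \<longrightarrow> (\<forall>x. d x \<ge> 0) \<longrightarrow>
     (\<forall>x. x \<notin> J \<longrightarrow> d x = 0) \<longrightarrow>
     \<bar>(\<integral>s. F s \<partial>M) - (\<integral>s. F s \<partial>N)\<bar> \<le> (\<Sum>x\<in>J. (if x \<in> S then \<alpha> / 2 else \<alpha>) * d x))"

lemma dobrushin_boundD:
  assumes "dobrushin_bound M N \<alpha> S" "finite J" "dep J F" "osc F d" "\<And>x. d x \<ge> 0" "\<And>x. x \<notin> J \<Longrightarrow> d x = 0"
  shows "\<bar>(\<integral>s. F s \<partial>M) - (\<integral>s. F s \<partial>N)\<bar> \<le> (\<Sum>x\<in>J. (if x \<in> S then \<alpha> / 2 else \<alpha>) * d x)"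
  using assms unfolding dobrushin_bound_def by blast

text \<open>Replacing F by its resampled version leaves both integrals unchanged. The weight at x
  disappears and 1/12 of it moves to each of at most 6 neighbours, where it is charged at most
  \<alpha>: in total \<alpha> / 2 times \<open>d x\<close>.\<close>

lemma dobrushin_step:
  assumes M: "ising_gibbs \<beta> M" and N: "ising_gibbs \<beta> N" and \<beta>: "(exp (2 * \<bar>\<beta>\<bar>))\<^sup>2 - 1 \<le> 1 / 12"
    and \<alpha>: "\<alpha> \<ge> 0" and S: "dobrushin_bound M N \<alpha> S"
  shows "dobrushin_bound M N \<alpha> (insert x S)"
  unfolding dobrushin_bound_def
proof (intro allI impI)
  fix J and F :: "spins \<Rightarrow> real" and d :: "vertex \<Rightarrow> real"
  assume J: "finite J" and F: "dep J F" and o: "osc F d" and d: "\<forall>x. d x \<ge> 0" and d0: "\<forall>x. x \<notin> J \<longrightarrow> d x = 0"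
  let ?a = "\<lambda>S x. (if x \<in> S then \<alpha> / 2 else \<alpha>)"
  let ?A = "{y. adj x y}"
  show "\<bar>(\<integral>s. F s \<partial>M) - (\<integral>s. F s \<partial>N)\<bar> \<le> (\<Sum>z\<in>J. ?a (insert x S) z * d z)"
  proof (cases "x \<in> J")
    case False
    have "\<bar>(\<integral>s. F s \<partial>M) - (\<integral>s. F s \<partial>N)\<bar> \<le> (\<Sum>z\<in>J. ?a S z * d z)"
      using S J F o d d0 unfolding dobrushin_bound_def by blast
    also have "\<dots> = (\<Sum>z\<in>J. ?a (insert x S) z * d z)"
      using False by (intro sum.cong) auto
    finally show ?thesis .
  next
    case True
    define F' where "F' = (\<lambda>\<eta>. gexp \<beta> {x} \<eta> F)"
    define d' where "d' y = (if y = x then 0 else d y + (if adj x y then 1 / 12 * d x else 0))" for y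
    define J' where "J' = J \<union> ?A"
    have J': "finite J'" using J finite_adj by (simp add: J'_def)
    have F': "dep J' F'"
      unfolding F'_def J'_def by (rule dep_mono[OF dep_gexp[OF F]]) (auto simp: bdry_def)
    have o': "osc F' d'"
      unfolding F'_def d'_def[abs_def] using d by (intro osc_gexp_single[OF o _ \<beta>]) auto
    have "\<bar>(\<integral>s. F' s \<partial>M) - (\<integral>s. F' s \<partial>N)\<bar> \<le> (\<Sum>z\<in>J'. ?a S z * d' z)"
    proof -
      have "\<forall>y. d' y \<ge> 0" "\<forall>y. y \<notin> J' \<longrightarrow> d' y = 0"
        using d d0 by (auto simp: d'_def J'_def)
      then show ?thesis using S J' F' o' unfolding dobrushin_bound_def by blast
    qed
    also have "(\<Sum>z\<in>J'. ?a S z * d' z) \<le> (\<Sum>z\<in>J'. (if z = x then 0 else ?a S z * d z) + (if z \<in> ?A then \<alpha> / 12 * d x else 0))"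
    proof (rule sum_mono)
      fix z
      show "?a S z * d' z \<le> (if z = x then 0 else ?a S z * d z) + (if z \<in> ?A then \<alpha> / 12 * d x else 0)"
        using \<alpha> d adj_irrefl[of x] by (auto simp: d'_def algebra_simps)
    qed
    also have "\<dots> = (\<Sum>z\<in>J'. if z = x then 0 else ?a S z * d z) + (\<Sum>z\<in>J'. if z \<in> ?A then \<alpha> / 12 * d x else 0)"
      by (rule sum.distrib)
    also have "(\<Sum>z\<in>J'. if z = x then 0 else ?a S z * d z) = (\<Sum>z\<in>J. if z = x then 0 else ?a S z * d z)"
      using d0 by (intro sum.mono_neutral_right[OF J']) (auto simp: J'_def)
    also have "(\<Sum>z\<in>J'. if z \<in> ?A then \<alpha> / 12 * d x else 0) = (\<Sum>z\<in>?A. \<alpha> / 12 * d x)"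
      by (rule sum.mono_neutral_cong_right[OF J']) (auto simp: J'_def)
    also have "\<dots> \<le> 6 * (\<alpha> / 12 * d x)"
    proof -
      have "real (card ?A) \<le> 6" using card_adj[of x] by simp
      then show ?thesis unfolding sum_constant using \<alpha> d by (intro mult_right_mono) auto
    qed
    also have "(\<Sum>z\<in>J. if z = x then 0 else ?a S z * d z) + 6 * (\<alpha> / 12 * d x)
        \<le> (\<Sum>z\<in>J. ?a (insert x S) z * d z)"
    proof -
      have "(\<Sum>z\<in>J. if z = x then 0 else ?a S z * d z) = (\<Sum>z\<in>J - {x}. ?a S z * d z)"
        using True J by (subst sum.remove[of _ x]) auto
      moreover have "(\<Sum>z\<in>J. ?a (insert x S) z * d z) = \<alpha> / 2 * d x + (\<Sum>z\<in>J - {x}. ?a S z * d z)"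
        using True J by (subst sum.remove[of _ x]) auto
      ultimately show ?thesis by simp
    qed
    finally have "\<bar>(\<integral>s. F' s \<partial>M) - (\<integral>s. F' s \<partial>N)\<bar> \<le> (\<Sum>z\<in>J. ?a (insert x S) z * d z)" by simp
    then show ?thesis
      unfolding F'_def using gibbs_dlr[OF M _ F J, of "{x}"] gibbs_dlr[OF N _ F J, of "{x}"] by simp
  qed
qed

lemma dobrushin_unique:
  assumes M: "ising_gibbs \<beta> M" and N: "ising_gibbs \<beta> N" and \<beta>: "\<bar>\<beta>\<bar> \<le> 1 / 96"
  shows "M = N"
proof -
  \<comment> \<open>The square is exp (4 |\<beta>|), at most exp (1/24) under the hypothesis on
    \<beta>; a quadratic bound of the exponential then gives 1/12.\<close>
  have small: "(exp (2 * \<bar>\<beta>\<bar>))\<^sup>2 - 1 \<le> 1 / 12"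
  proof -
    have "(exp (2 * \<bar>\<beta>\<bar>))\<^sup>2 = exp (4 * \<bar>\<beta>\<bar>)"
      by (simp add: power2_eq_square exp_add[symmetric])
    also have "\<dots> \<le> exp (1 / 24)" using \<beta> by simp
    also have "\<dots> \<le> 1 + 1 / 24 + (1 / 24)\<^sup>2" by (rule exp_bound) auto
    also have "\<dots> \<le> 1 + 1 / 12" by (simp add: power2_eq_square)
    finally show ?thesis by simp
  qed
  note Msp = gibbs_spin_prob[OF M] and Nsp = gibbs_spin_prob[OF N]
  \<comment> \<open>The constant 2 arises because each of the two integrals lies within the total
    oscillation of one fixed value of F.\<close>
  have base: "dobrushin_bound M N 2 {}"
    unfolding dobrushin_bound_def
  proof (intro allI impI)
    fix J and F :: "spins \<Rightarrow> real" and d :: "vertex \<Rightarrow> real"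
    assume J: "finite J" and F: "dep J F" and o: "osc F d"
    let ?D = "\<Sum>x\<in>J. d x"
    have *: "\<bar>(\<integral>s. F s \<partial>R) - F (conf {})\<bar> \<le> ?D" if R: "spin_prob R" for R
    proof -
      note R' = spin_probD[OF R]
      interpret prob_space R by (rule R')
      have i: "integrable R F" by (rule integrable_dep[OF R F J])
      have b: "\<bar>F s - F (conf {})\<bar> \<le> ?D" if "s \<in> space R" for s
        using osc_dep_bound[OF o F J] that R' by simp
      have b1: "F s \<le> F (conf {}) + ?D" and b2: "F (conf {}) - ?D \<le> F s" if "s \<in> space R" for s
        using b[OF that] by linarith+
      have "(\<integral>s. F s \<partial>R) \<le> F (conf {}) + ?D"
        using b1 by (intro integral_le_const[OF i] AE_I2)
      moreover have "F (conf {}) - ?D \<le> (\<integral>s. F s \<partial>R)"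
        using b2 by (intro integral_ge_const[OF i] AE_I2)
      ultimately show ?thesis by linarith
    qed
    have "\<bar>(\<integral>s. F s \<partial>M) - (\<integral>s. F s \<partial>N)\<bar> \<le> 2 * ?D"
      using *[OF Msp] *[OF Nsp] by linarith
    then show "\<bar>(\<integral>s. F s \<partial>M) - (\<integral>s. F s \<partial>N)\<bar> \<le> (\<Sum>x\<in>J. (if x \<in> {} then 2 / 2 else 2) * d x)"
      by (simp add: sum_distrib_left)
  qed
  \<comment> \<open>Taking S to be the support J of the function charges every vertex \<alpha> / 2,
    which is the bound for \<alpha> / 2 with nothing resampled.\<close>
  have halve: "dobrushin_bound M N (\<alpha> / 2) {}" if \<alpha>: "\<alpha> \<ge> 0" and b: "dobrushin_bound M N \<alpha> {}" for \<alpha>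
  proof -
    have all: "dobrushin_bound M N \<alpha> S" if "finite S" for S
      using that by (induction S rule: finite_induct) (auto intro: b dobrushin_step[OF M N small \<alpha>])
    show ?thesis
      unfolding dobrushin_bound_def
    proof (intro allI impI)
      fix J and F :: "spins \<Rightarrow> real" and d :: "vertex \<Rightarrow> real"
      assume "finite J" "dep J F" "osc F d" "\<forall>x. d x \<ge> 0" "\<forall>x. x \<notin> J \<longrightarrow> d x = 0"
      then have "\<bar>(\<integral>s. F s \<partial>M) - (\<integral>s. F s \<partial>N)\<bar> \<le> (\<Sum>x\<in>J. (if x \<in> J then \<alpha> / 2 else \<alpha>) * d x)"
        using all[of J] unfolding dobrushin_bound_def by blast
      also have "\<dots> = (\<Sum>x\<in>J. (if x \<in> {} then \<alpha> / 2 / 2 else \<alpha> / 2) * d x)"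
        by (intro sum.cong) auto
      finally show "\<bar>(\<integral>s. F s \<partial>M) - (\<integral>s. F s \<partial>N)\<bar> \<le> \<dots>" .
    qed
  qed
  have pow: "dobrushin_bound M N (2 * (1 / 2) ^ n) {}" for n
  proof (induction n)
    case 0 then show ?case using base by simp
  next
    case (Suc n)
    then show ?case using halve[OF _ Suc] by simp
  qed
  show ?thesis
  proof (rule spin_measure_eqI_cyl[OF Msp Nsp])
    fix J B :: "vertex set" assume J: "finite J"
    define d :: "vertex \<Rightarrow> real" where "d x = (if x \<in> J then 1 else 0)" for x
    let ?F = "indicator (cyl J B) :: spins \<Rightarrow> real"
    have o: "osc ?F d"
      unfolding osc_def
    proof (intro allI ballI impI)
      fix x s t assume st: "s \<in> \<Omega>" "t \<in> \<Omega>" "\<forall>y. y \<noteq> x \<longrightarrow> s y = t y"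
      show "\<bar>?F s - ?F t\<bar> \<le> d x"
      proof (cases "x \<in> J")
        case False
        then have "?F s = ?F t" using st by (intro depD[OF dep_indicator_cyl, of s t J]) auto
        then show ?thesis by (simp add: d_def)
      qed (auto simp: d_def indicator_def)
    qed
    have bound: "\<bar>(\<integral>s. ?F s \<partial>M) - (\<integral>s. ?F s \<partial>N)\<bar> \<le> 2 * (1 / 2) ^ n * card J" for n
    proof -
      have "\<bar>(\<integral>s. ?F s \<partial>M) - (\<integral>s. ?F s \<partial>N)\<bar>
        \<le> (\<Sum>x\<in>J. (if x \<in> {} then 2 * (1 / 2) ^ n / 2 else 2 * (1 / 2) ^ n) * d x)"
        by (rule dobrushin_boundD[OF pow J dep_indicator_cyl o]) (auto simp: d_def)
      also have "\<dots> = (\<Sum>x\<in>J. 2 * (1 / 2) ^ n)" by (intro sum.cong) (auto simp: d_def)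
      finally show ?thesis by (simp only: sum_constant mult.commute[of "real (card J)"])
    qed
    have "(\<lambda>n. 2 * (1 / 2) ^ n * card J) \<longlonglongrightarrow> 2 * 0 * real (card J)"
      by (intro tendsto_intros LIMSEQ_power_zero) auto
    then have "\<bar>(\<integral>s. ?F s \<partial>M) - (\<integral>s. ?F s \<partial>N)\<bar> \<le> 2 * 0 * real (card J)"
      by (rule LIMSEQ_le_const) (use bound in auto)
    then have "(\<integral>s. ?F s \<partial>M) = (\<integral>s. ?F s \<partial>N)" by simp
    then show "measure M (cyl J B) = measure N (cyl J B)"
      using sets.sets_into_space[OF sets_cyl[OF J]] spin_probD(3)[OF Msp] spin_probD(3)[OF Nsp]
      by (simp add: Int_absorb2)
  qed
qed


section \<open>The pseudometric of a colouring\<close>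

abbreviation paths :: "real ^ 2 \<Rightarrow> real ^ 2 \<Rightarrow> (real \<Rightarrow> real ^ 2) set" where
  "paths x y \<equiv> {\<gamma>. piecewise_C1_path \<gamma> \<and> pathstart \<gamma> = x \<and> pathfinish \<gamma> = y}"

lemma colouring_nonneg: "0 \<le> colouring s p" and colouring_le_1: "colouring s p \<le> 1"
  by (simp_all add: colouring_def)

text \<open>A non-integrable integrand is covered as well, since its integral is 0 by
  convention.\<close>

lemma arc_length_integral_nonneg:
  assumes "\<And>p. 0 \<le> \<sigma> p"
  shows "0 \<le> arc_length_integral \<sigma> \<gamma>"
proof (cases "(\<lambda>t. \<sigma> (\<gamma> t) * norm (vector_derivative \<gamma> (at t))) integrable_on {0..1}")
  case True
  then show ?thesis unfolding arc_length_integral_def using assms by (intro integral_nonneg) auto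
qed (simp add: arc_length_integral_def not_integrable_integral)

lemma linepath_in_paths: "linepath x y \<in> paths x y"
proof -
  have "piecewise_C1_path (linepath x y)"
    unfolding piecewise_C1_path_def
    by (rule exI[where x = 1], rule exI[where x = real])
       (auto intro!: exI[where x = "\<lambda>_. y - x"] has_vector_derivative_linepath_within)
  then show ?thesis by simp
qed

lemma pseudometric_le:
  assumes "\<And>p. 0 \<le> \<sigma> p" "\<gamma> \<in> paths x y"
  shows "pseudometric \<sigma> x y \<le> arc_length_integral \<sigma> \<gamma>"
  unfolding pseudometric_def using assms arc_length_integral_nonneg
  by (intro cINF_lower bdd_belowI2[where m = 0]) auto

lemma pseudometric_nonneg:
  assumes "\<And>p. 0 \<le> \<sigma> p"
  shows "0 \<le> pseudometric \<sigma> x y"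
  unfolding pseudometric_def
proof (rule cINF_greatest)
  show "paths x y \<noteq> {}" using linepath_in_paths by blast
qed (rule arc_length_integral_nonneg[OF assms])

lemma pseudometric_less:
  assumes "\<And>p. 0 \<le> \<sigma> p" "pseudometric \<sigma> x y < a"
  shows "\<exists>\<gamma>\<in>paths x y. arc_length_integral \<sigma> \<gamma> < a"
proof (rule ccontr)
  assume "\<not> ?thesis"
  then have "a \<le> pseudometric \<sigma> x y"
    unfolding pseudometric_def
    by (intro cINF_greatest) (use linepath_in_paths in \<open>blast, auto simp: not_less\<close>)
  with assms(2) show False by simp
qed

lemma arc_length_integral_linepath:
  "arc_length_integral \<sigma> (linepath x y) = integral {0..1} (\<lambda>t. \<sigma> (linepath x y t) * norm (y - x))"
  by (simp add: arc_length_integral_def)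

lemma pseudometric_le_dist:
  assumes "\<And>p. 0 \<le> \<sigma> p" "\<And>p. \<sigma> p \<le> 1"
  shows "pseudometric \<sigma> x y \<le> norm (y - x)"
proof -
  have "arc_length_integral \<sigma> (linepath x y) \<le> norm (y - x)"
  proof (cases "(\<lambda>t. \<sigma> (linepath x y t) * norm (y - x)) integrable_on {0..1}")
    case True
    have "integral {0..1} (\<lambda>t. \<sigma> (linepath x y t) * norm (y - x)) \<le> integral {0..1} (\<lambda>t::real. norm (y - x))"
      by (rule integral_le[OF True]) (auto intro: mult_left_le_one_le assms)
    then show ?thesis by (simp add: arc_length_integral_linepath)
  next
    case False
    then show ?thesis unfolding arc_length_integral_linepath not_integrable_integral[OF False] by simp
  qed
  with pseudometric_le[OF assms(1) linepath_in_paths] show ?thesis by (rule order_trans)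
qed

lemma pseudometric_eq_0_segment:
  assumes "\<And>p. 0 \<le> \<sigma> p" "\<And>p. p \<in> closed_segment x y \<Longrightarrow> \<sigma> p = 0"
  shows "pseudometric \<sigma> x y = 0"
proof -
  have "linepath x y t \<in> closed_segment x y" if "t \<in> {0..1}" for t
    using that by (simp add: linepath_in_path)
  then have "arc_length_integral \<sigma> (linepath x y) = integral {0..1} (\<lambda>t::real. 0)"
    unfolding arc_length_integral_linepath using assms(2) by (intro integral_cong) auto
  then show ?thesis
    using pseudometric_le[of \<sigma> "linepath x y" x y, OF assms(1) linepath_in_paths] pseudometric_nonneg[of \<sigma> x y, OF assms(1)] by simp
qed

section \<open>Regularity and concatenation of piecewise smooth paths\<close>

lemma partition_mono:
  fixes p :: "nat \<Rightarrow> real"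
  assumes "\<forall>i<m. p i < p (Suc i)" "i \<le> j" "j \<le> m"
  shows "p i \<le> p j"
  using assms(2,3)
proof (induction j rule: dec_induct)
  case (step n)
  then have "p i \<le> p n" "p n < p (Suc n)" using assms(1) by auto
  then show ?case by linarith
qed simp

text \<open>The exceptional set consists of the break points, including both ends; elsewhere the
  derivative within a piece is two-sided. The ends are listed so that the remaining times lie in the
  open interval.\<close>

lemma piecewise_C1_differentiable:
  assumes "piecewise_C1_path \<gamma>"
  obtains S where "finite S" "\<And>t. t \<in> {0..1} - S \<Longrightarrow> \<gamma> differentiable (at t)" "0 \<in> S" "1 \<in> S"
proof -
  obtain m p where p: "p 0 = 0" "p (m::nat) = 1" "\<forall>i<m. p i < p (Suc i)"
    and D: "\<And>i. i < m \<Longrightarrow> \<exists>D. \<forall>t\<in>{p i..p (Suc i)}. (\<gamma> has_vector_derivative D t) (at t within {p i..p (Suc i)})"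
    using assms unfolding piecewise_C1_path_def by blast
  have "\<gamma> differentiable (at t)" if t: "t \<in> {0..1} - p ` {..m}" for t
  proof -
    define i where "i = (GREATEST i. i \<le> m \<and> p i \<le> t)"
    have i: "i \<le> m \<and> p i \<le> t"
      unfolding i_def by (rule GreatestI_nat[where k = 0 and b = m]) (use t p in auto)
    have gr: "j \<le> i" if "j \<le> m" "p j \<le> t" for j
      unfolding i_def by (rule Greatest_le_nat[where b = m]) (use that in auto)
    have "p i \<noteq> t" using i t by auto
    have "i \<noteq> m" using i t p(2) \<open>p i \<noteq> t\<close> by auto
    then have im: "i < m" using i by simp
    have "t < p (Suc i)"
    proof (rule ccontr)
      assume "\<not> t < p (Suc i)"
      then have "Suc i \<le> i" using im by (intro gr) auto
      then show False by simp
    qed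
    then have int: "t \<in> {p i<..<p (Suc i)}" using i \<open>p i \<noteq> t\<close> by auto
    obtain v where "(\<gamma> has_vector_derivative v) (at t within {p i..p (Suc i)})"
      using D[OF im] int by (meson atLeastAtMost_iff greaterThanLessThan_iff less_imp_le)
    then have "(\<gamma> has_vector_derivative v) (at t)"
      using int by (simp add: at_within_Icc_at)
    then show ?thesis using differentiableI_vector by blast
  qed
  then show thesis
    using p by (intro that[of "p ` {..m}"]) (auto intro: image_eqI[where x = 0] image_eqI[where x = m])
qed

text \<open>Needed in \<open>usc_T\<close>: a bounded path meets only finitely many
  hexagons.\<close>

lemma piecewise_C1_bounded:
  assumes "piecewise_C1_path \<gamma>"
  obtains R where "\<And>t. t \<in> {0..1} \<Longrightarrow> norm (\<gamma> t) \<le> R"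
proof -
  obtain m p where p: "p 0 = 0" "p (m::nat) = 1" "\<forall>i<m. p i < p (Suc i)"
    and D: "\<And>i. i < m \<Longrightarrow> \<exists>D. \<forall>t\<in>{p i..p (Suc i)}. (\<gamma> has_vector_derivative D t) (at t within {p i..p (Suc i)})"
    using assms unfolding piecewise_C1_path_def by blast
  have "continuous_on {p i..p (Suc i)} \<gamma>" if "i < m" for i
    using D[OF that] has_vector_derivative_continuous unfolding continuous_on_eq_continuous_within by blast
  then have "bounded (\<gamma> ` {p i..p (Suc i)})" if "i < m" for i
    using that by (intro compact_imp_bounded compact_continuous_image) auto
  then have bd: "bounded (\<Union>i<m. \<gamma> ` {p i..p (Suc i)})"
    by (intro bounded_UN) auto
  have "\<gamma> t \<in> (\<Union>i<m. \<gamma> ` {p i..p (Suc i)})" if t: "t \<in> {0..1}" for t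
  proof -
    define i where "i = (LEAST i. t \<le> p (Suc i))"
    have m: "m > 0" using p by (cases m) auto
    have ex: "t \<le> p (Suc (m - 1))" using t p m by simp
    have i: "t \<le> p (Suc i)" unfolding i_def by (rule LeastI[where P = "\<lambda>i. t \<le> p (Suc i)", OF ex])
    have "i \<le> m - 1" unfolding i_def by (rule Least_le[where P = "\<lambda>i. t \<le> p (Suc i)", OF ex])
    then have im: "i < m" using m by simp
    have "p i \<le> t"
    proof (cases i)
      case (Suc j)
      then have "\<not> t \<le> p (Suc j)" using not_less_Least[of j "\<lambda>i. t \<le> p (Suc i)"] i_def by simp
      then show ?thesis using Suc by simp
    qed (use t p in simp)
    then have "\<gamma> t \<in> \<gamma> ` {p i..p (Suc i)}" using i by (intro imageI) auto
    then show ?thesis using im by blast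
  qed
  moreover obtain R where "\<forall>x\<in>(\<Union>i<m. \<gamma> ` {p i..p (Suc i)}). norm x \<le> R"
    using bd bounded_iff by blast
  ultimately show thesis using that by blast
qed

lemma piecewise_C1_join:
  assumes "piecewise_C1_path f" "piecewise_C1_path g" "pathfinish f = pathstart g"
  shows "piecewise_C1_path (f +++ g)"
proof -
  obtain m p where p: "p 0 = 0" "p (m::nat) = 1" "\<forall>i<m. p i < p (Suc i)"
    and D: "\<And>i. i < m \<Longrightarrow> \<exists>D. continuous_on {p i..p (Suc i)} D \<and> (\<forall>t\<in>{p i..p (Suc i)}. (f has_vector_derivative D t) (at t within {p i..p (Suc i)}))"
    using assms(1) unfolding piecewise_C1_path_def by blast
  obtain n q where q: "q 0 = 0" "q (n::nat) = 1" "\<forall>i<n. q i < q (Suc i)"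
    and E: "\<And>i. i < n \<Longrightarrow> \<exists>D. continuous_on {q i..q (Suc i)} D \<and> (\<forall>t\<in>{q i..q (Suc i)}. (g has_vector_derivative D t) (at t within {q i..q (Suc i)}))"
    using assms(2) unfolding piecewise_C1_path_def by blast
  \<comment> \<open>The break points of f are squeezed into the left half and those of g into the
    right half; both descriptions give 1/2 at index m.\<close>
  define r where "r i = (if i \<le> m then p i / 2 else (1 + q (i - m)) / 2)" for i
  have r2: "r (m + i) = (1 + q i) / 2" for i
    by (cases i) (auto simp: r_def p q)
  have chain: "\<exists>D. continuous_on {(a - c) / 2..(b - c) / 2} D \<and>
      (\<forall>t\<in>{(a - c) / 2..(b - c) / 2}. (h has_vector_derivative D t) (at t within {(a - c) / 2..(b - c) / 2}))"
    if D: "continuous_on {a..b} D" "\<forall>t\<in>{a..b}. (k has_vector_derivative D t) (at t within {a..b})"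
      and hk: "\<And>t. t \<in> {(a - c) / 2..(b - c) / 2} \<Longrightarrow> h t = k (2 * t + c)"
    for a b c :: real and D and h k :: "real \<Rightarrow> real ^ 2"
  proof (intro exI conjI ballI)
    let ?I = "{(a - c) / 2..(b - c) / 2}"
    have img: "(\<lambda>t. 2 * t + c) ` ?I = {a..b}"
    proof
      show "{a..b} \<subseteq> (\<lambda>t. 2 * t + c) ` ?I"
      proof
        fix u assume "u \<in> {a..b}"
        then have "u = 2 * ((u - c) / 2) + c" "(u - c) / 2 \<in> ?I" by (auto simp: field_simps)
        then show "u \<in> (\<lambda>t. 2 * t + c) ` ?I" by blast
      qed
    qed (auto simp: field_simps)
    show "continuous_on ?I (\<lambda>t. 2 *\<^sub>R D (2 * t + c))"
      by (intro continuous_intros continuous_on_compose2[OF D(1)]) (simp only: img order_refl)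
    fix t assume t: "t \<in> ?I"
    have a: "((\<lambda>t. 2 * t + c) has_vector_derivative 2) (at t within ?I)"
      by (auto intro!: derivative_eq_intros simp: has_real_derivative_iff_has_vector_derivative[symmetric])
    have b: "(k has_vector_derivative D (2 * t + c)) (at (2 * t + c) within (\<lambda>t. 2 * t + c) ` ?I)"
      unfolding img using D(2) t by (auto simp: field_simps)
    have "(k \<circ> (\<lambda>t. 2 * t + c) has_vector_derivative 2 *\<^sub>R D (2 * t + c)) (at t within ?I)"
      by (rule vector_diff_chain_within[OF a b])
    then show "(h has_vector_derivative 2 *\<^sub>R D (2 * t + c)) (at t within ?I)"
      by (rule has_vector_derivative_transform[OF t, rotated]) (simp add: hk)
  qed
  show ?thesis
    unfolding piecewise_C1_path_def
  proof (rule exI[where x = "m + n"], rule exI[where x = r], intro conjI allI impI)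
    show "r 0 = 0" "r (m + n) = 1" using r2[of n] p q by (auto simp: r_def)
    fix i assume i: "i < m + n"
    show "r i < r (Suc i)"
    proof (cases "i < m")
      case True then show ?thesis using p by (simp add: r_def)
    next
      case False
      then have "i = m + (i - m)" "Suc i = m + Suc (i - m)" "i - m < n" using i by auto
      then show ?thesis using r2 q(3) by (metis add_less_cancel_left divide_strict_right_mono zero_less_numeral)
    qed
    show "\<exists>D. continuous_on {r i..r (Suc i)} D \<and>
      (\<forall>t\<in>{r i..r (Suc i)}. (f +++ g has_vector_derivative D t) (at t within {r i..r (Suc i)}))"
    proof (cases "i < m")
      case True
      then have "p (Suc i) \<le> 1" using partition_mono[OF p(3), of "Suc i" m] p by simp
      then have hk: "(f +++ g) t = f (2 * t + 0)" if "t \<in> {(p i - 0) / 2..(p (Suc i) - 0) / 2}" for t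
        using that by (auto simp: joinpaths_def)
      obtain D where "continuous_on {p i..p (Suc i)} D" "\<forall>t\<in>{p i..p (Suc i)}. (f has_vector_derivative D t) (at t within {p i..p (Suc i)})"
        using D[OF \<open>i < m\<close>] by blast
      from chain[OF this hk] True show ?thesis by (simp add: r_def)
    next
      case False
      define j where "j = i - m"
      have j: "i = m + j" "j < n" using False i by (auto simp: j_def)
      have "0 \<le> q j" using partition_mono[OF q(3), of 0 j] q j by simp
      then have hk: "(f +++ g) t = g (2 * t + - 1)" if "t \<in> {(q j - - 1) / 2..(q (Suc j) - - 1) / 2}" for t
        using that assms(3) by (auto simp: joinpaths_def pathfinish_def pathstart_def) (smt (verit) field_sum_of_halves)
      obtain D where "continuous_on {q j..q (Suc j)} D" "\<forall>t\<in>{q j..q (Suc j)}. (g has_vector_derivative D t) (at t within {q j..q (Suc j)})"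
        using E[OF j(2)] by blast
      from chain[OF this hk] show ?thesis
        using r2[of j] r2[of "Suc j"] by (simp only: j(1) diff_minus_eq_add add.commute[of _ 1] add_Suc_right)
    qed
  qed
qed

text \<open>An inequality is enough for the triangle inequality and avoids measurability questions.
  If the joined integrand is not integrable, the left side is 0; if it is, its restrictions to both
  halves are, and rescaling time gives equality.\<close>

lemma arc_length_integral_join:
  assumes f: "piecewise_C1_path f" and g: "piecewise_C1_path g" and \<sigma>: "\<And>p. 0 \<le> \<sigma> p"
  shows "arc_length_integral \<sigma> (f +++ g) \<le> arc_length_integral \<sigma> f + arc_length_integral \<sigma> g"
proof -
  define I where "I \<gamma> t = \<sigma> (\<gamma> t) * norm (vector_derivative \<gamma> (at t))" for \<gamma> t
  let ?h = "I (f +++ g)"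
  obtain S where S: "finite S" "\<And>t. t \<in> {0..1} - S \<Longrightarrow> f differentiable (at t)" "0 \<in> S" "1 \<in> S"
    using piecewise_C1_differentiable[OF f] by blast
  obtain S' where S': "finite S'" "\<And>t. t \<in> {0..1} - S' \<Longrightarrow> g differentiable (at t)" "0 \<in> S'" "1 \<in> S'"
    using piecewise_C1_differentiable[OF g] by blast
  have half: "I \<gamma> t = 2 * I k (2 * t + c)"
    if k: "k differentiable (at (2 * t + c))" and op: "open U" "t \<in> U" and eq: "\<And>u. u \<in> U \<Longrightarrow> \<gamma> u = k (2 * u + c)"
    for k \<gamma> :: "real \<Rightarrow> real ^ 2" and t c U
  proof -
    have a: "((\<lambda>t. 2 * t + c) has_vector_derivative 2) (at t)"
      by (auto intro!: derivative_eq_intros simp: has_real_derivative_iff_has_vector_derivative[symmetric])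
    have b: "(k has_vector_derivative vector_derivative k (at (2 * t + c))) (at (2 * t + c))"
      using k by (simp add: vector_derivative_works)
    have "(k \<circ> (\<lambda>t. 2 * t + c) has_vector_derivative 2 *\<^sub>R vector_derivative k (at (2 * t + c))) (at t)"
      by (rule vector_diff_chain_at[OF a b])
    then have "(\<gamma> has_vector_derivative 2 *\<^sub>R vector_derivative k (at (2 * t + c))) (at t)"
      by (rule has_vector_derivative_transform_within_open[OF _ op]) (simp add: eq)
    then have "vector_derivative \<gamma> (at t) = 2 *\<^sub>R vector_derivative k (at (2 * t + c))"
      by (rule vector_derivative_at)
    then show ?thesis by (simp add: I_def eq op)
  qed
  show ?thesis
  proof (cases "?h integrable_on {0..1}")
    case False
    then have "arc_length_integral \<sigma> (f +++ g) = 0"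
      by (simp add: arc_length_integral_def I_def[abs_def] not_integrable_integral)
    then show ?thesis using arc_length_integral_nonneg[of \<sigma>, OF \<sigma>] by simp
  next
    case True
    then have i1: "?h integrable_on {0..1/2}" and i2: "?h integrable_on {1/2..1}"
      by (auto elim: integrable_on_subinterval)
    have "((\<lambda>x. ?h ((1/2) *\<^sub>R x + 0)) has_integral ((1 / \<bar>1/2\<bar> ^ DIM(real)) *\<^sub>R integral {0..1/2} ?h))
      ((\<lambda>x. (1 / (1/2)) *\<^sub>R x + - ((1 / (1/2)) *\<^sub>R 0)) ` cbox 0 (1/2))"
      using i1 by (intro has_integral_affinity) (auto simp: has_integral_integral)
    then have "((\<lambda>x. ?h (x / 2)) has_integral (2 * integral {0..1/2} ?h)) {0..1}"
      by (simp add: image_mult_atLeastAtMost)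
    then have "((\<lambda>x. 2 * I f x) has_integral (2 * integral {0..1/2} ?h)) {0..1}"
    proof (rule has_integral_spike_finite[OF S(1), rotated])
      fix t assume t: "t \<in> {0..1} - S"
      then have t01: "0 < t" "t < 1" using S(3,4) by (auto simp: less_le)
      have "?h (t / 2) = 2 * I f (2 * (t / 2) + 0)"
        by (rule half[of _ _ _ "{0<..<1/2}"]) (use S(2)[OF t] t01 in \<open>auto simp: joinpaths_def\<close>)
      then show "2 * I f t = ?h (t / 2)" by simp
    qed
    from has_integral_mult_right[OF this, of "1/2"]
    have f': "(I f has_integral integral {0..1/2} ?h) {0..1}" by simp
    have "((\<lambda>x. ?h ((1/2) *\<^sub>R x + 1/2)) has_integral ((1 / \<bar>1/2\<bar> ^ DIM(real)) *\<^sub>R integral {1/2..1} ?h))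
      ((\<lambda>x. (1 / (1/2)) *\<^sub>R x + - ((1 / (1/2)) *\<^sub>R (1/2))) ` cbox (1/2) 1)"
      using i2 by (intro has_integral_affinity) (auto simp: has_integral_integral)
    moreover have "(\<lambda>x::real. 2 * x + - 1) ` {1/2..1} = {0..1}"
      by (subst image_affinity_atLeastAtMost) auto
    ultimately have "((\<lambda>x. ?h (x / 2 + 1 / 2)) has_integral (2 * integral {1/2..1} ?h)) {0..1}"
      by simp
    then have "((\<lambda>x. 2 * I g x) has_integral (2 * integral {1/2..1} ?h)) {0..1}"
    proof (rule has_integral_spike_finite[OF S'(1), rotated])
      fix t assume t: "t \<in> {0..1} - S'"
      then have t01: "0 < t" "t < 1" using S'(3,4) by (auto simp: less_le)
      have "?h (t / 2 + 1 / 2) = 2 * I g (2 * (t / 2 + 1 / 2) + - 1)"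
        by (rule half[of _ _ _ "{1/2<..<1}"]) (use S'(2)[OF t] t01 in \<open>auto simp: joinpaths_def\<close>)
      then show "2 * I g t = ?h (t / 2 + 1 / 2)" by simp
    qed
    from has_integral_mult_right[OF this, of "1/2"]
    have g': "(I g has_integral integral {1/2..1} ?h) {0..1}" by simp
    have "integral {0..1} ?h = integral {0..1/2} ?h + integral {1/2..1} ?h"
      using Henstock_Kurzweil_Integration.integral_combine[of 0 "1/2" 1 ?h] True by simp
    then show ?thesis
      using integral_unique[OF f'] integral_unique[OF g']
      by (simp add: arc_length_integral_def I_def[abs_def])
  qed
qed

lemma pseudometric_triangle:
  assumes "\<And>p. 0 \<le> \<sigma> p"
  shows "pseudometric \<sigma> x z \<le> pseudometric \<sigma> x y + pseudometric \<sigma> y z"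
proof (rule field_le_epsilon)
  fix e :: real assume e: "e > 0"
  obtain f where f: "f \<in> paths x y" "arc_length_integral \<sigma> f < pseudometric \<sigma> x y + e / 2"
    using pseudometric_less[of \<sigma> x y "pseudometric \<sigma> x y + e / 2"] assms e by auto
  obtain g where g: "g \<in> paths y z" "arc_length_integral \<sigma> g < pseudometric \<sigma> y z + e / 2"
    using pseudometric_less[of \<sigma> y z "pseudometric \<sigma> y z + e / 2"] assms e by auto
  have "f +++ g \<in> paths x z" using f g by (auto intro: piecewise_C1_join)
  then have "pseudometric \<sigma> x z \<le> arc_length_integral \<sigma> (f +++ g)"
    by (rule pseudometric_le[OF assms])
  also have "\<dots> \<le> arc_length_integral \<sigma> f + arc_length_integral \<sigma> g"
    using f g by (intro arc_length_integral_join assms) auto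
  finally show "pseudometric \<sigma> x z \<le> pseudometric \<sigma> x y + pseudometric \<sigma> y z + e"
    using f(2) g(2) by linarith
qed

section \<open>Invariance of the pseudometric under isometries\<close>

lemma pseudometric_isometry_le:
  assumes L: "bounded_linear L" and n: "\<And>v. norm (L v) = norm v" and \<sigma>: "\<And>p. 0 \<le> \<sigma> p"
  shows "pseudometric \<sigma> (L x + c) (L y + c) \<le> pseudometric (\<lambda>p. \<sigma> (L p + c)) x y"
proof -
  let ?\<Phi> = "\<lambda>p. L p + c"
  have deriv: "((\<lambda>t. ?\<Phi> (\<gamma> t)) has_vector_derivative L v) F" if "(\<gamma> has_vector_derivative v) F" for \<gamma> v F
    using bounded_linear.has_vector_derivative[OF L that] by (auto intro!: derivative_eq_intros)
  have arc: "arc_length_integral \<sigma> (\<lambda>t. ?\<Phi> (\<gamma> t)) = arc_length_integral (\<lambda>p. \<sigma> (?\<Phi> p)) \<gamma>"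
    if "piecewise_C1_path \<gamma>" for \<gamma>
  proof -
    obtain S where S: "finite S" "\<And>t. t \<in> {0..1} - S \<Longrightarrow> \<gamma> differentiable (at t)"
      using piecewise_C1_differentiable[of \<gamma>] \<open>piecewise_C1_path \<gamma>\<close> by metis
    show ?thesis
      unfolding arc_length_integral_def
    proof (rule integral_spike[OF negligible_finite[OF S(1)]])
      fix t assume t: "t \<in> {0..1} - S"
      have "((\<lambda>t. ?\<Phi> (\<gamma> t)) has_vector_derivative L (vector_derivative \<gamma> (at t))) (at t)"
        using S(2)[OF t] by (intro deriv) (simp add: vector_derivative_works)
      then have "vector_derivative (\<lambda>t. ?\<Phi> (\<gamma> t)) (at t) = L (vector_derivative \<gamma> (at t))"
        by (rule vector_derivative_at)
      then show "\<sigma> (?\<Phi> (\<gamma> t)) * norm (vector_derivative \<gamma> (at t))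
        = \<sigma> (?\<Phi> (\<gamma> t)) * norm (vector_derivative (\<lambda>t. ?\<Phi> (\<gamma> t)) (at t))"
        by (simp add: n)
    qed
  qed
  have C1: "piecewise_C1_path (\<lambda>t. ?\<Phi> (\<gamma> t))" if \<gamma>: "piecewise_C1_path \<gamma>" for \<gamma>
  proof -
    obtain m p where p: "p 0 = 0" "p (m::nat) = 1" "\<forall>i<m. p i < p (Suc i)"
      and D: "\<And>i. i < m \<Longrightarrow> \<exists>D. continuous_on {p i..p (Suc i)} D \<and> (\<forall>t\<in>{p i..p (Suc i)}. (\<gamma> has_vector_derivative D t) (at t within {p i..p (Suc i)}))"
      using \<gamma> unfolding piecewise_C1_path_def by blast
    have "\<exists>D. continuous_on {p i..p (Suc i)} D \<and> (\<forall>t\<in>{p i..p (Suc i)}. ((\<lambda>t. ?\<Phi> (\<gamma> t)) has_vector_derivative D t) (at t within {p i..p (Suc i)}))"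
      if i: "i < m" for i
    proof -
      obtain D where D: "continuous_on {p i..p (Suc i)} D" "\<forall>t\<in>{p i..p (Suc i)}. (\<gamma> has_vector_derivative D t) (at t within {p i..p (Suc i)})"
        using D[OF i] by blast
      show ?thesis
        by (rule exI[where x = "\<lambda>t. L (D t)"])
           (use D(2) in \<open>auto intro!: deriv bounded_linear.continuous_on[OF L D(1)]\<close>)
    qed
    then show ?thesis unfolding piecewise_C1_path_def using p by blast
  qed
  show ?thesis
    unfolding pseudometric_def[of "\<lambda>p. \<sigma> (?\<Phi> p)"]
  proof (rule cINF_greatest)
    show "paths x y \<noteq> {}" using linepath_in_paths by blast
    fix \<gamma> assume \<gamma>: "\<gamma> \<in> paths x y"
    then have "(\<lambda>t. ?\<Phi> (\<gamma> t)) \<in> paths (?\<Phi> x) (?\<Phi> y)"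
      using C1 by (auto simp: pathstart_def pathfinish_def)
    then have "pseudometric \<sigma> (?\<Phi> x) (?\<Phi> y) \<le> arc_length_integral \<sigma> (\<lambda>t. ?\<Phi> (\<gamma> t))"
      by (rule pseudometric_le[OF \<sigma>])
    then show "pseudometric \<sigma> (?\<Phi> x) (?\<Phi> y) \<le> arc_length_integral (\<lambda>p. \<sigma> (?\<Phi> p)) \<gamma>"
      using arc \<gamma> by simp
  qed
qed

lemma pseudometric_isometry:
  assumes L: "bounded_linear L" "\<And>v. norm (L v) = norm v" and L': "bounded_linear L'" "\<And>v. L (L' v) = v"
    and \<sigma>: "\<And>p. 0 \<le> \<sigma> p"
  shows "pseudometric (\<lambda>p. \<sigma> (L p + c)) x y = pseudometric \<sigma> (L x + c) (L y + c)"
proof (rule antisym)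
  interpret L: bounded_linear L by (rule L(1))
  interpret L': bounded_linear L' by (rule L'(1))
  have n': "norm (L' v) = norm v" for v using L(2)[of "L' v"] L'(2) by simp
  have inj: "L' (L v) = v" for v
  proof -
    have "norm (L' (L v) - v) = norm (L (L' (L v) - v))" by (simp add: L(2))
    also have "\<dots> = 0" by (simp add: L.diff L'(2))
    finally show ?thesis by simp
  qed
  have "pseudometric (\<lambda>p. \<sigma> (L p + c)) (L' (L x + c) + - L' c) (L' (L y + c) + - L' c)
      \<le> pseudometric (\<lambda>p. \<sigma> (L (L' p + - L' c) + c)) (L x + c) (L y + c)"
    by (rule pseudometric_isometry_le[OF L'(1) n' \<sigma>])
  then show "pseudometric (\<lambda>p. \<sigma> (L p + c)) x y \<le> pseudometric \<sigma> (L x + c) (L y + c)"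
    by (simp add: L'.add L.diff L'(2) inj)
  show "pseudometric \<sigma> (L x + c) (L y + c) \<le> pseudometric (\<lambda>p. \<sigma> (L p + c)) x y"
    by (rule pseudometric_isometry_le[OF L \<sigma>])
qed


section \<open>The pseudometric of the Ising colouring\<close>

abbreviation T :: "spins \<Rightarrow> real ^ 2 \<Rightarrow> real ^ 2 \<Rightarrow> real" where
  "T s \<equiv> pseudometric (colouring s)"

lemma T_nonneg: "0 \<le> T s x y"
  by (rule pseudometric_nonneg[OF colouring_nonneg])

lemma T_le: "T s x y \<le> norm (y - x)"
  by (rule pseudometric_le_dist[OF colouring_nonneg colouring_le_1])

lemma T_triangle: "T s x z \<le> T s x y + T s y z"
  by (rule pseudometric_triangle[OF colouring_nonneg])

section \<open>Sites, hexagons and edges\<close>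

lemma site_separated: "x \<noteq> y \<Longrightarrow> 1 \<le> dist (site x) (site y)"
proof -
  assume "x \<noteq> y"
  obtain a b where ab: "x - y = (a, b)" by fastforce
  with \<open>x \<noteq> y\<close> have "a \<noteq> 0 \<or> b \<noteq> 0" by (auto simp: zero_prod_def[symmetric])
  have "4 * (a * a + a * b + b * b) = (2 * a + b)\<^sup>2 + 3 * b\<^sup>2" by (simp add: power2_eq_square algebra_simps)
  moreover have "\<dots> > 0"
    using \<open>a \<noteq> 0 \<or> b \<noteq> 0\<close> by (cases "b = 0") (auto intro: add_nonneg_pos)
  ultimately have "0 < 4 * (a * a + a * b + b * b)" by (simp only:)
  then have "0 < a * a + a * b + b * b" by (rule zero_less_mult_pos) simp
  then have "1 \<le> a * a + a * b + b * b" by (simp only: int_one_le_iff_zero_less)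
  then have "1\<^sup>2 \<le> (norm (site (a, b)))\<^sup>2"
    unfolding norm_site_sq by (simp only: one_power2 of_int_1_le_iff)
  then have "1 \<le> norm (site (a, b))" by (rule power2_le_imp_le) simp
  then show ?thesis by (simp add: dist_norm site_diff[symmetric] ab)
qed

lemma exists_near_site: "\<exists>x. dist p (site x) \<le> 2"
proof -
  define b where "b = \<lfloor>p $ 2 * 2 / sqrt 3\<rfloor>"
  define a where "a = \<lfloor>p $ 1 - b / 2\<rfloor>"
  let ?q = "p - site (a, b)"
  have "0 \<le> ?q $ 1" "?q $ 1 \<le> 1"
    unfolding a_def by (simp_all, linarith+)
  then have 1: "(?q $ 1)\<^sup>2 \<le> 1" by (simp add: power_le_one)
  have "of_int b \<le> p $ 2 * 2 / sqrt 3" "p $ 2 * 2 / sqrt 3 \<le> of_int b + 1"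
    unfolding b_def by linarith+
  then have "of_int b * sqrt 3 / 2 \<le> p $ 2" "p $ 2 \<le> (of_int b + 1) * sqrt 3 / 2"
    by (simp_all add: field_simps)
  then have "0 \<le> ?q $ 2" "?q $ 2 \<le> sqrt 3 / 2"
    by (simp_all add: field_simps)
  then have "(?q $ 2)\<^sup>2 \<le> (sqrt 3 / 2)\<^sup>2" by (rule power_mono[rotated])
  then have 2: "(?q $ 2)\<^sup>2 \<le> 3 / 4" by (simp add: power_divide)
  have "norm ?q \<le> sqrt 4"
    unfolding norm_vec2 using 1 2 by (intro real_sqrt_le_mono) linarith
  then show ?thesis by (auto simp: dist_norm)
qed

lemma hexagon_near: "p \<in> hexagon x \<Longrightarrow> dist p (site x) \<le> 2"
  using exists_near_site[of p] unfolding hexagon_def by (auto intro: order_trans)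

lemma finite_sites_bounded: "finite {x. norm (site x) \<le> R}"
proof -
  define k where "k = \<lceil>2 * \<bar>R\<bar>\<rceil>"
  have "{x. norm (site x) \<le> R} \<subseteq> {-k..k} \<times> {-k..k}"
  proof
    fix x assume x: "x \<in> {x. norm (site x) \<le> R}"
    obtain a b where ab: "x = (a, b)" by fastforce
    have "(norm (site (a, b)))\<^sup>2 \<le> R\<^sup>2"
      using x ab by (intro power_mono) auto
    then have n: "real_of_int (a * a + a * b + b * b) \<le> R\<^sup>2"
      unfolding norm_site_sq .
    have "4 * (a * a + a * b + b * b) = (2 * a + b)\<^sup>2 + 3 * b\<^sup>2"
      "4 * (a * a + a * b + b * b) = (2 * b + a)\<^sup>2 + 3 * a\<^sup>2"
      by (simp_all add: power2_eq_square algebra_simps)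
    then have "b\<^sup>2 \<le> 4 * (a * a + a * b + b * b)" "a\<^sup>2 \<le> 4 * (a * a + a * b + b * b)"
      using zero_le_power2[of "2 * a + b"] zero_le_power2[of "2 * b + a"] zero_le_power2[of a] zero_le_power2[of b]
      by linarith+
    then have "real_of_int (b\<^sup>2) \<le> real_of_int (4 * (a * a + a * b + b * b))"
      "real_of_int (a\<^sup>2) \<le> real_of_int (4 * (a * a + a * b + b * b))"
      by (simp_all only: of_int_le_iff)
    then have "\<bar>real_of_int b\<bar>\<^sup>2 \<le> (2 * \<bar>R\<bar>)\<^sup>2" "\<bar>real_of_int a\<bar>\<^sup>2 \<le> (2 * \<bar>R\<bar>)\<^sup>2"
      using n by (simp_all add: power_mult_distrib)
    then have "\<bar>real_of_int b\<bar> \<le> 2 * \<bar>R\<bar>" "\<bar>real_of_int a\<bar> \<le> 2 * \<bar>R\<bar>"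
      by (auto intro: power2_le_imp_le)
    then have "\<bar>b\<bar> \<le> k" "\<bar>a\<bar> \<le> k" unfolding k_def by linarith+
    then show "x \<in> {-k..k} \<times> {-k..k}" by (auto simp: ab)
  qed
  then show ?thesis by (rule finite_subset) simp
qed

text \<open>A point of an edge of length 1 is within 1/2 of one endpoint, and distinct sites are at
  distance at least 1, so no other site is closer.\<close>

lemma segment_in_hexagons:
  assumes "adj x y" "p \<in> closed_segment (site x) (site y)"
  shows "p \<in> hexagon x \<or> p \<in> hexagon y"
proof -
  have sum: "dist (site x) p + dist p (site y) = 1"
    using assms by (simp add: between_mem_segment[symmetric] between dist_site_eq_1_iff[symmetric])
  have *: "p \<in> hexagon z" if "dist p (site z) \<le> 1 / 2" for z
    unfolding hexagon_def
  proof (intro CollectI allI)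
    fix w
    show "dist p (site z) \<le> dist p (site w)"
    proof (cases "w = z")
      case False
      then have "1 \<le> dist (site z) (site w)" by (intro site_separated) auto
      also have "\<dots> \<le> dist p (site z) + dist p (site w)" by (rule dist_triangle3)
      finally show ?thesis using that by linarith
    qed simp
  qed
  show ?thesis
    using *[of x] *[of y] sum by (simp add: dist_commute) linarith
qed

text \<open>The edge stays inside two hexagons of value 0. Where it crosses their common side the
  colour is still 0, since 0 prevails at points lying on several hexagons.\<close>

lemma T_adj_eq_0:
  assumes "adj x y" "s x = -1" "s y = -1"
  shows "T s (site x) (site y) = 0"
  by (rule pseudometric_eq_0_segment[OF colouring_nonneg])
     (use segment_in_hexagons[OF assms(1)] assms(2,3) in \<open>auto simp: colouring_def\<close>)

definition usc :: "(spins \<Rightarrow> real) \<Rightarrow> bool" where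
  "usc F \<longleftrightarrow> (\<forall>s\<in>\<Omega>. \<forall>e>0. \<exists>J. finite J \<and> (\<forall>t\<in>\<Omega>. (\<forall>x\<in>J. t x = s x) \<longrightarrow> F t < F s + e))"

text \<open>A nearly optimal path is bounded and meets finitely many hexagons. If the spins there
  are kept, it costs the same in the new configuration and remains a competitor for the
  infimum.\<close>

lemma usc_T: "usc (\<lambda>s. T s x y)"
  unfolding usc_def
proof (intro ballI allI impI)
  fix s and e :: real assume e: "e > 0"
  obtain \<gamma> where \<gamma>: "\<gamma> \<in> paths x y" "arc_length_integral (colouring s) \<gamma> < T s x y + e"
    using pseudometric_less[of "colouring s" x y "T s x y + e"] colouring_nonneg e by auto
  obtain R where R: "\<And>t. t \<in> {0..1} \<Longrightarrow> norm (\<gamma> t) \<le> R"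
    using piecewise_C1_bounded[of \<gamma>] \<gamma>(1) by auto
  let ?J = "{x. norm (site x) \<le> R + 2}"
  have "T s' x y < T s x y + e" if s': "\<forall>z\<in>?J. s' z = s z" for s'
  proof -
    have col: "colouring s' (\<gamma> t) = colouring s (\<gamma> t)" if t: "t \<in> {0..1}" for t
    proof -
      have "s' z = s z" if "\<gamma> t \<in> hexagon z" for z
      proof -
        have "norm (site z) \<le> norm (\<gamma> t) + dist (\<gamma> t) (site z)"
          using norm_triangle_sub[of "site z" "\<gamma> t"] by (simp add: dist_norm norm_minus_commute)
        then have "norm (site z) \<le> R + 2" using R[OF t] hexagon_near[OF that] by linarith
        then show ?thesis using s' by blast
      qed
      then have "(\<exists>z. \<gamma> t \<in> hexagon z \<and> s' z = -1) \<longleftrightarrow> (\<exists>z. \<gamma> t \<in> hexagon z \<and> s z = -1)"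
        by (intro iff_exI) auto
      then show ?thesis by (simp add: colouring_def)
    qed
    have "T s' x y \<le> arc_length_integral (colouring s') \<gamma>"
      by (rule pseudometric_le[OF colouring_nonneg \<gamma>(1)])
    also have "\<dots> = arc_length_integral (colouring s) \<gamma>"
      unfolding arc_length_integral_def by (intro integral_cong) (simp add: col)
    finally show ?thesis using \<gamma>(2) by linarith
  qed
  then show "\<exists>J. finite J \<and> (\<forall>t\<in>\<Omega>. (\<forall>x\<in>J. t x = s x) \<longrightarrow> T t x y < T s x y + e)"
    using finite_sites_bounded by blast
qed

lemma usc_measurable:
  assumes "usc F"
  shows "F \<in> borel_measurable spin_space"
proof (rule borel_measurableI_less)
  fix a
  show "{s \<in> \<Omega>. F s < a} \<in> sets spin_space"
  proof (rule open_sets)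
    fix s assume "s \<in> {s \<in> \<Omega>. F s < a}"
    then have s: "s \<in> \<Omega>" "a - F s > 0" by auto
    then obtain J where J: "finite J" "\<forall>t\<in>\<Omega>. (\<forall>x\<in>J. t x = s x) \<longrightarrow> F t < F s + (a - F s)"
      using assms unfolding usc_def by blast
    then show "\<exists>J. finite J \<and> (\<forall>t\<in>\<Omega>. (\<forall>x\<in>J. t x = s x) \<longrightarrow> t \<in> {s \<in> \<Omega>. F s < a})"
      by (intro exI[of _ J]) auto
  qed auto
qed

text \<open>The approximants are the suprema of F over all configurations agreeing with s on growing
  boxes. They are local, dominate F and converge to it by semicontinuity, so their means converge by
  domination.\<close>

lemma usc_cylinder_approx:
  assumes M: "spin_prob M" and F: "usc F" and F0: "\<And>s. s \<in> \<Omega> \<Longrightarrow> 0 \<le> F s" and FC: "\<And>s. s \<in> \<Omega> \<Longrightarrow> F s \<le> C" and e: "e > 0"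
  shows "\<exists>J G. finite J \<and> dep J G \<and> (\<forall>s\<in>\<Omega>. F s \<le> G s \<and> 0 \<le> G s \<and> G s \<le> C) \<and>
    (\<integral>s. G s \<partial>M) < (\<integral>s. F s \<partial>M) + e"
proof -
  note M' = spin_probD[OF M]
  define A where "A n s = {t\<in>\<Omega>. \<forall>x\<in>vbox n. t x = s x}" for n and s :: spins
  define G where "G n s = (SUP t\<in>A n s. F t)" for n s
  have bdd: "bdd_above (F ` A n s)" for n s
    using FC by (intro bdd_aboveI2[where M = C]) (auto simp: A_def)
  have self: "s \<in> A n s" if "s \<in> \<Omega>" for n and s :: spins using that by (simp add: A_def)
  have dep: "dep (vbox n) (G n)" for n
    unfolding dep_def
  proof (intro ballI impI)
    fix s t :: spins assume "\<forall>x\<in>vbox n. s x = t x"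
    then have "A n s = A n t" by (auto simp: A_def)
    then show "G n s = G n t" by (simp add: G_def)
  qed
  have le: "F s \<le> G n s" if "s \<in> \<Omega>" for n s
    unfolding G_def by (rule cSUP_upper[OF self[OF that] bdd])
  have GC: "G n s \<le> C" if "s \<in> \<Omega>" for n s
    unfolding G_def using self[OF that] FC by (intro cSUP_least) (auto simp: A_def)
  have G0: "0 \<le> G n s" if "s \<in> \<Omega>" for n s
    using le[OF that] F0[OF that] by (rule order_trans[rotated])
  have lim: "(\<lambda>n. G n s) \<longlonglongrightarrow> F s" if s: "s \<in> \<Omega>" for s
  proof (rule LIMSEQ_I)
    fix r :: real assume r: "r > 0"
    then have "r / 2 > 0" by simp
    then obtain J where J: "finite J" "\<forall>t\<in>\<Omega>. (\<forall>x\<in>J. t x = s x) \<longrightarrow> F t < F s + r / 2"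
      using F s unfolding usc_def by blast
    obtain N where N: "J \<subseteq> vbox N" using vbox_exhausts[OF J(1)] by blast
    have "norm (G n s - F s) < r" if "n \<ge> N" for n
    proof -
      have "J \<subseteq> vbox n" using N vbox_mono[OF that] by blast
      have "F t \<le> F s + r / 2" if "t \<in> A n s" for t
      proof -
        have t: "t \<in> \<Omega>" "\<forall>x\<in>vbox n. t x = s x" using that by (auto simp only: A_def mem_Collect_eq)
        then have "\<forall>x\<in>J. t x = s x" using \<open>J \<subseteq> vbox n\<close> by blast
        then show ?thesis using J(2) t(1) less_imp_le by blast
      qed
      then have "G n s \<le> F s + r / 2"
        unfolding G_def using self[OF s] by (intro cSUP_least) auto
      then show ?thesis using le[OF s, of n] r by simp
    qed
    then show "\<exists>N. \<forall>n\<ge>N. norm (G n s - F s) < r" by blast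
  qed
  interpret prob_space M by (rule M')
  have meas: "F \<in> borel_measurable M" "\<And>n. G n \<in> borel_measurable M"
    unfolding M'(4) using usc_measurable[OF F] measurable_dep[OF dep] by auto
  have "(\<lambda>n. \<integral>s. G n s \<partial>M) \<longlonglongrightarrow> (\<integral>s. F s \<partial>M)"
    by (rule integral_dominated_convergence[where w = "\<lambda>_. C"])
       (use meas lim G0 GC M'(3) in \<open>auto intro!: AE_I2\<close>)
  then have "\<forall>\<^sub>F n in sequentially. (\<integral>s. G n s \<partial>M) < (\<integral>s. F s \<partial>M) + e"
    by (rule order_tendstoD) (use e in simp)
  then obtain n where "(\<integral>s. G n s \<partial>M) < (\<integral>s. F s \<partial>M) + e"
    by (auto simp: eventually_sequentially)
  then show ?thesis
    using dep[of n] le G0 GC by (intro exI[of _ "vbox n"] exI[of _ "G n"]) auto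
qed

section \<open>Lattice symmetries of the colouring\<close>

lemma colouring_equivariant:
  assumes \<Phi>: "\<And>p q. dist (\<Phi> p) (\<Phi> q) = dist p q" and \<phi>: "\<And>x. \<Phi> (site x) = site (\<phi> x)" "surj \<phi>"
  shows "colouring (s \<circ> \<phi>) p = colouring s (\<Phi> p)"
proof -
  have all: "(\<forall>y. P y) \<longleftrightarrow> (\<forall>x. P (\<phi> x))" and ex: "(\<exists>y. P y) \<longleftrightarrow> (\<exists>x. P (\<phi> x))" for P
    using \<phi>(2) by (auto dest: surjD) (metis surjD)+
  have hex: "\<Phi> p \<in> hexagon (\<phi> x) \<longleftrightarrow> p \<in> hexagon x" for x
    unfolding hexagon_def mem_Collect_eq all[of "\<lambda>y. dist (\<Phi> p) (site (\<phi> x)) \<le> dist (\<Phi> p) (site y)"]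
    by (simp only: \<phi>(1)[symmetric] \<Phi>)
  show ?thesis
    unfolding colouring_def ex[of "\<lambda>y. \<Phi> p \<in> hexagon y \<and> s y = -1"] hex o_apply ..
qed

definition shift :: "vertex \<Rightarrow> vertex \<Rightarrow> vertex" where
  "shift t x = x + t"

text \<open>Multiplication by w = exp(i pi/3) in the basis 1, w, using w^2 = w - 1.\<close>

definition rot :: "vertex \<Rightarrow> vertex" where
  "rot x = (- snd x, fst x + snd x)"

definition rotR :: "real ^ 2 \<Rightarrow> real ^ 2" where
  "rotR v = vector [v $ 1 / 2 - sqrt 3 / 2 * v $ 2, sqrt 3 / 2 * v $ 1 + v $ 2 / 2]"

definition rotR' :: "real ^ 2 \<Rightarrow> real ^ 2" where
  "rotR' v = vector [v $ 1 / 2 + sqrt 3 / 2 * v $ 2, - sqrt 3 / 2 * v $ 1 + v $ 2 / 2]"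

lemma rotR_nth: "rotR v $ 1 = v $ 1 / 2 - sqrt 3 / 2 * v $ 2" "rotR v $ 2 = sqrt 3 / 2 * v $ 1 + v $ 2 / 2"
  and rotR'_nth: "rotR' v $ 1 = v $ 1 / 2 + sqrt 3 / 2 * v $ 2" "rotR' v $ 2 = - sqrt 3 / 2 * v $ 1 + v $ 2 / 2"
  by (simp_all add: rotR_def rotR'_def)

lemma linear_rotR: "linear rotR" and linear_rotR': "linear rotR'"
  by (intro linearI; simp add: vec_eq_iff forall_2 rotR_nth rotR'_nth field_simps)+

lemma norm_rotR: "norm (rotR v) = norm v"
proof -
  have "(x / 2 - r / 2 * y)\<^sup>2 + (r / 2 * x + y / 2)\<^sup>2 = (1 + r * r) / 4 * (x\<^sup>2 + y\<^sup>2)" for x y r :: real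
    by (simp add: power2_eq_square field_simps)
  from this[of "v $ 1" "sqrt 3" "v $ 2"] show ?thesis by (simp add: norm_vec2 rotR_nth)
qed

lemma rotR_rotR': "rotR (rotR' v) = v"
proof -
  have "(x / 2 + r / 2 * y) / 2 - r / 2 * (- r / 2 * x + y / 2) = (1 + r * r) / 4 * x"
    "r / 2 * (x / 2 + r / 2 * y) + (- r / 2 * x + y / 2) / 2 = (1 + r * r) / 4 * y" for x y r :: real
    by (simp_all add: field_simps)
  from this(1)[of "v $ 1" "sqrt 3" "v $ 2"] this(2)[of "sqrt 3" "v $ 1" "v $ 2"] show ?thesis
    by (simp add: vec_eq_iff forall_2 rotR_nth rotR'_nth)
qed

lemma rotR_site: "rotR (site x) = site (rot x)"
proof -
  have "(a + b / 2) / 2 - r / 2 * (b * r / 2) = a / 2 + (1 - r * r) / 4 * b"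
    "r / 2 * (a + b / 2) + b * r / 2 / 2 = (a + b) * r / 2" for a b r :: real
    by (simp_all add: field_simps)
  from this[of "fst x" "snd x" "sqrt 3"] show ?thesis
    by (simp add: vec_eq_iff forall_2 rotR_nth rot_def field_simps)
qed

lemma surj_rot: "surj rot" and surj_shift: "surj (shift t)"
proof -
  show "surj rot" by (rule surjI[where f = "\<lambda>x. (fst x + snd x, - fst x)"]) (simp add: rot_def)
  show "surj (shift t)" by (rule surjI[where f = "\<lambda>x. x - t"]) (simp add: shift_def)
qed

lemma T_shift: "T (s \<circ> shift t) x y = T s (x + site t) (y + site t)"
proof -
  have "colouring (s \<circ> shift t) = (\<lambda>p. colouring s (p + site t))"
    by (intro ext colouring_equivariant) (auto simp: site_add shift_def surj_shift)
  then show ?thesis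
    using pseudometric_isometry[of "\<lambda>v. v" "\<lambda>v. v" "colouring s" "site t" x y]
    by (simp add: bounded_linear_ident colouring_nonneg)
qed

lemma T_rot: "T (s \<circ> rot) x y = T s (rotR x) (rotR y)"
proof -
  have "dist (rotR p) (rotR q) = dist p q" for p q
    by (simp add: dist_norm linear_diff[OF linear_rotR, symmetric] norm_rotR)
  then have "colouring (s \<circ> rot) = (\<lambda>p. colouring s (rotR p))"
    by (intro ext colouring_equivariant) (auto simp: rotR_site surj_rot)
  then show ?thesis
    using pseudometric_isometry[of rotR rotR' "colouring s" 0 x y]
    by (simp add: linear_rotR linear_rotR' linear_conv_bounded_linear[symmetric] norm_rotR rotR_rotR' colouring_nonneg)
qed


section \<open>Symmetries and mixing of the unique Gibbs measure\<close>

text \<open>Treats lattice automorphisms (c = 1) and the global spin flip (c = -1) together.\<close>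

definition twist :: "real \<Rightarrow> (vertex \<Rightarrow> vertex) \<Rightarrow> spins \<Rightarrow> spins" where
  "twist c \<phi> s = (\<lambda>x. c * s (\<phi> x))"

locale lattice_symmetry =
  fixes c :: real and \<phi> :: "vertex \<Rightarrow> vertex"
  assumes c: "c = 1 \<or> c = -1" and bij: "bij \<phi>" and adj_\<phi>: "adj (\<phi> x) (\<phi> y) \<longleftrightarrow> adj x y"
begin

abbreviation S :: "spins \<Rightarrow> spins" where "S \<equiv> twist c \<phi>"

lemma cc: "c * c = 1"
  using c by auto

lemma S_in [simp]: "s \<in> \<Omega> \<Longrightarrow> S s \<in> \<Omega>"
  unfolding space_spin twist_def using c by auto

lemma inj_S: "inj S"
proof (rule injI)
  fix s t assume st: "S s = S t"
  show "s = t"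
  proof
    fix y
    obtain x where "y = \<phi> x" using bij by (metis bij_pointE)
    then show "s y = t y" using fun_cong[OF st, of x] c by (auto simp: twist_def)
  qed
qed

lemma surj_S: "t \<in> \<Omega> \<Longrightarrow> \<exists>s\<in>\<Omega>. S s = t"
proof
  assume t: "t \<in> \<Omega>"
  let ?s = "\<lambda>y. c * t (inv \<phi> y)"
  show "?s \<in> \<Omega>" using t c unfolding space_spin by auto
  show "S ?s = t"
    using bij cc by (simp add: twist_def bij_is_inj inv_f_f mult.assoc[symmetric])
qed

lemma ext_S: "\<eta> \<in> \<Omega> \<Longrightarrow> extensions L (S \<eta>) = S ` extensions (\<phi> ` L) \<eta>"
proof safe
  fix t assume \<eta>: "\<eta> \<in> \<Omega>" and t: "t \<in> extensions L (S \<eta>)"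
  then obtain s where s: "s \<in> \<Omega>" "S s = t" using surj_S by (auto simp: ext_iff)
  have "s y = \<eta> y" if y: "y \<notin> \<phi> ` L" for y
  proof -
    obtain x where x: "y = \<phi> x" using bij by (metis bij_pointE)
    then have "x \<notin> L" using y by blast
    then have "c * s (\<phi> x) = c * \<eta> (\<phi> x)" using t s by (auto simp: ext_iff twist_def)
    then show ?thesis using c x by auto
  qed
  then have "s \<in> extensions (\<phi> ` L) \<eta>" using s by (simp add: ext_iff)
  then show "t \<in> S ` extensions (\<phi> ` L) \<eta>" using s by blast
next
  fix s assume "s \<in> extensions (\<phi> ` L) \<eta>"
  then have s: "s \<in> \<Omega>" "\<And>y. y \<notin> \<phi> ` L \<Longrightarrow> s y = \<eta> y" by (auto simp: ext_iff)
  have "S s x = S \<eta> x" if "x \<notin> L" for x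
  proof -
    have "\<phi> x \<notin> \<phi> ` L" using that by (simp add: inj_image_mem_iff[OF bij_is_inj[OF bij]])
    then show ?thesis using s(2) by (simp add: twist_def)
  qed
  then show "S s \<in> extensions L (S \<eta>)" using S_in[OF s(1)] by (simp add: ext_iff)
qed

text \<open>The automorphism permutes the edges, and the two factors c on an edge cancel because it
  has two distinct endpoints. This is where the flip symmetry of the model without field
  enters.\<close>

lemma weight_S:
  assumes "s \<in> \<Omega>"
  shows "ising_weight \<beta> L (S s) = ising_weight \<beta> (\<phi> ` L) s"
proof -
  let ?E = "\<lambda>L. {e \<in> edges. e \<inter> L \<noteq> {}}"
  have inj: "inj \<phi>" using bij by (rule bij_is_inj)
  have b: "bij_betw ((`) \<phi>) (?E L) (?E (\<phi> ` L))"
    unfolding bij_betw_def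
  proof
    show "inj_on ((`) \<phi>) (?E L)" using inj by (simp add: inj_on_def inj_image_eq_iff)
    show "(`) \<phi> ` ?E L = ?E (\<phi> ` L)"
    proof
      show "(`) \<phi> ` ?E L \<subseteq> ?E (\<phi> ` L)"
      proof
        fix e' assume "e' \<in> (`) \<phi> ` ?E L"
        then obtain e x where e: "e' = \<phi> ` e" "e \<in> edges" "x \<in> e" "x \<in> L" by blast
        then obtain y where y: "e = {x, y}" "adj x y" using edge_obtain by blast
        then have "e' = {\<phi> x, \<phi> y}" "adj (\<phi> x) (\<phi> y)" using adj_\<phi> e by auto
        then have "e' \<in> edges" unfolding edges_eq by blast
        then show "e' \<in> ?E (\<phi> ` L)" using e by blast
      qed
      show "?E (\<phi> ` L) \<subseteq> (`) \<phi> ` ?E L"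
      proof
        fix e assume "e \<in> ?E (\<phi> ` L)"
        then obtain x where e: "e \<in> edges" "\<phi> x \<in> e" "x \<in> L" by blast
        then obtain w where w: "e = {\<phi> x, w}" "adj (\<phi> x) w" using edge_obtain by blast
        obtain y where y: "w = \<phi> y" using bij by (metis bij_pointE)
        have "adj x y" using w y adj_\<phi> by simp
        then have "{x, y} \<in> ?E L" using e unfolding edges_eq by blast
        moreover have "e = \<phi> ` {x, y}" using w y by simp
        ultimately show "e \<in> (`) \<phi> ` ?E L" by blast
      qed
    qed
  qed
  have "(\<Prod>x\<in>e. S s x) = (\<Prod>y\<in>\<phi> ` e. s y)" if e: "e \<in> ?E L" for e
  proof -
    obtain x where "x \<in> e" "e \<in> edges" using e by blast
    then obtain y where y: "e = {x, y}" "x \<noteq> y" using edge_obtain by blast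
    have "\<phi> x \<noteq> \<phi> y" using y inj by (simp add: inj_eq)
    moreover have "c * a * (c * b) = a * b" for a b
      using cc by (metis (no_types) mult.left_commute mult.assoc mult_1)
    ultimately show ?thesis using y by (simp add: twist_def)
  qed
  then have "(\<Sum>e\<in>?E L. \<Prod>x\<in>e. S s x) = (\<Sum>e\<in>?E L. \<Prod>y\<in>\<phi> ` e. s y)"
    by (rule sum.cong[OF refl])
  also have "\<dots> = (\<Sum>e\<in>?E (\<phi> ` L). \<Prod>y\<in>e. s y)"
    by (rule sum.reindex_bij_betw[OF b])
  finally show ?thesis by (simp add: ising_weight_def)
qed

lemma gexp_S:
  assumes "\<eta> \<in> \<Omega>"
  shows "gexp \<beta> L (S \<eta>) F = gexp \<beta> (\<phi> ` L) \<eta> (\<lambda>s. F (S s))"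
proof -
  have inj: "inj_on S A" for A using inj_S by (rule inj_on_subset) simp
  have w: "ising_weight \<beta> L (S s) = ising_weight \<beta> (\<phi> ` L) s" if "s \<in> extensions (\<phi> ` L) \<eta>" for s
    using that by (intro weight_S) (simp add: ext_iff)
  show ?thesis
    unfolding gexp_def ext_S[OF assms] sum.reindex[OF inj] o_def using w by simp
qed

lemma measurable_S: "S \<in> measurable spin_space spin_space"
proof -
  have "(\<lambda>s. \<lambda>x\<in>UNIV. c * s (\<phi> x)) \<in> measurable spin_space spin_space"
    unfolding spin_space_def
  proof (rule measurable_restrict)
    fix x
    have 1: "(\<lambda>s. s (\<phi> x)) \<in> (\<Pi>\<^sub>M x\<in>UNIV. count_space {-1, 1}) \<rightarrow>\<^sub>M count_space {-1, 1::real}"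
      by measurable
    have 2: "(\<lambda>y. c * y) \<in> count_space {-1, 1} \<rightarrow>\<^sub>M count_space {-1, 1::real}"
      using c by auto
    show "(\<lambda>s. c * s (\<phi> x)) \<in> (\<Pi>\<^sub>M x\<in>UNIV. count_space {-1, 1}) \<rightarrow>\<^sub>M count_space {-1, 1::real}"
      by (rule measurable_compose[OF 1 2])
  qed
  then show ?thesis by (simp add: twist_def[abs_def] restrict_def)
qed

lemma dep_S: "dep J F \<Longrightarrow> dep (\<phi> ` J) (\<lambda>s. F (S s))"
  unfolding dep_def using S_in by (auto simp: twist_def)

lemma gibbs_S:
  assumes M: "ising_gibbs \<beta> M"
  shows "ising_gibbs \<beta> (distr M spin_space S)"
proof -
  note sp = gibbs_spin_prob[OF M]
  note M' = spin_probD[OF sp]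
  interpret prob_space M by (rule M'(1))
  have meas: "S \<in> measurable M spin_space"
    unfolding measurable_cong_sets[OF M'(2) refl] by (rule measurable_S)
  show ?thesis
  proof (rule gibbsI_cyl)
    show "spin_prob (distr M spin_space S)"
      unfolding spin_prob_def using prob_space_distr[OF meas] by simp
    fix L J :: "vertex set" and F :: "spins \<Rightarrow> real"
    assume L: "finite L" and J: "finite J" and F: "dep J F"
    have "(\<integral>\<eta>. gexp \<beta> L \<eta> F \<partial>distr M spin_space S) = (\<integral>\<eta>. gexp \<beta> L (S \<eta>) F \<partial>M)"
      by (intro integral_distr meas measurable_gexp[OF L] measurable_dep[OF F J])
    also have "\<dots> = (\<integral>\<eta>. gexp \<beta> (\<phi> ` L) \<eta> (\<lambda>s. F (S s)) \<partial>M)"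
      using M'(3) by (intro Bochner_Integration.integral_cong refl gexp_S) simp
    also have "\<dots> = (\<integral>s. F (S s) \<partial>M)"
      using L J by (intro gibbs_dlr[OF M _ dep_S[OF F]]) auto
    also have "\<dots> = (\<integral>s. F s \<partial>distr M spin_space S)"
      by (intro integral_distr[symmetric] meas measurable_dep[OF F J])
    finally show "(\<integral>\<eta>. gexp \<beta> L \<eta> F \<partial>distr M spin_space S) = (\<integral>s. F s \<partial>distr M spin_space S)" .
  qed
qed

end

lemma adj_shift: "adj (shift t x) (shift t y) \<longleftrightarrow> adj x y"
  by (simp add: adj_def shift_def)

lemma adj_rot: "adj (rot x) (rot y) \<longleftrightarrow> adj x y"
proof -
  obtain u v where uv: "y - x = (u, v)" by fastforce
  have "rot y - rot x = rot (y - x)" by (simp add: rot_def prod_eq_iff)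
  then have "rot y - rot x = (- v, u + v)" by (simp add: uv rot_def)
  then have "adj (rot x) (rot y) \<longleftrightarrow> (- v) * (- v) + (- v) * (u + v) + (u + v) * (u + v) = 1"
    unfolding adj_def eisenstein_norm_eq_1_iff by (simp only:)
  also have "(- v) * (- v) + (- v) * (u + v) + (u + v) * (u + v) = u * u + u * v + v * v"
    by (simp add: algebra_simps)
  also have "u * u + u * v + v * v = 1 \<longleftrightarrow> adj x y"
    unfolding adj_def eisenstein_norm_eq_1_iff uv ..
  finally show ?thesis .
qed

lemma bij_shift: "bij (shift t)"
  by (rule bijI[OF _ surj_shift]) (simp add: inj_def shift_def)

lemma bij_rot: "bij rot"
  by (rule bijI[OF _ surj_rot]) (auto simp: inj_def rot_def prod_eq_iff)

interpretation shift: lattice_symmetry 1 "shift t" for t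
  by unfold_locales (auto simp: adj_shift bij_shift)

interpretation rot: lattice_symmetry 1 rot
  by unfold_locales (auto simp: adj_rot bij_rot)

interpretation flip: lattice_symmetry "-1" "\<lambda>x. x"
  by unfold_locales (auto simp: bij_betw_def)

lemma twist_1: "twist 1 \<phi> s = s \<circ> \<phi>"
  by (simp add: twist_def fun_eq_iff)

lemma comp_in_\<Omega> [simp]: "s \<in> \<Omega> \<Longrightarrow> s \<circ> \<phi> \<in> \<Omega>"
  unfolding space_spin by simp

definition sc :: "int \<Rightarrow> vertex \<Rightarrow> vertex" where
  "sc n z = (n * fst z, n * snd z)"

lemma sc_0 [simp]: "sc 0 z = 0" and sc_1 [simp]: "sc 1 z = z"
  by (simp_all add: sc_def zero_prod_def)

lemma norm_site_sc: "norm (site (sc n z)) = \<bar>real_of_int n\<bar> * norm (site z)"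
proof -
  have "site (sc n z) = real_of_int n *\<^sub>R site z"
    by (simp add: vec_eq_iff forall_2 sc_def field_simps)
  then show ?thesis by simp
qed

lemma exp_quadratic_bound:
  fixes u :: real assumes "0 \<le> u" "u \<le> 1" shows "exp u \<le> 1 + u + u\<^sup>2"
  using exp_bound assms by auto

text \<open>Symmetry and mixing are both derived from uniqueness, so small negative \<beta> and the
  subcritical ferromagnetic range are handled alike.\<close>

locale unique_gibbs =
  fixes \<beta> :: real and M :: "spins measure"
  assumes gibbs: "ising_gibbs \<beta> M" and uniq: "\<And>N. ising_gibbs \<beta> N \<Longrightarrow> N = M"

sublocale unique_gibbs \<subseteq> prob_space M
  using gibbs by (simp add: ising_gibbs_def)

context unique_gibbs
begin

lemma sp: "spin_prob M"
  by (rule gibbs_spin_prob[OF gibbs])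

lemmas M_simps = spin_probD(2-4)[OF sp]

lemma meas_M [intro]: "F \<in> borel_measurable spin_space \<Longrightarrow> F \<in> borel_measurable M"
  by (simp add: M_simps)

lemma meas_T [measurable]: "(\<lambda>s. T s x y) \<in> borel_measurable M"
  by (rule meas_M[OF usc_measurable[OF usc_T]])

lemma integrable_T: "integrable M (\<lambda>s. T s x y)"
  by (rule integrable_bounded[OF sp usc_measurable[OF usc_T], of _ _ "norm (y - x)"]) (simp add: T_nonneg T_le)

text \<open>The image of M under a symmetry is again a Gibbs measure, hence equal to M.\<close>

lemma integral_symmetry:
  assumes "lattice_symmetry c \<phi>" "(F :: spins \<Rightarrow> real) \<in> borel_measurable spin_space"
  shows "expectation (\<lambda>s. F (twist c \<phi> s)) = expectation F"
proof -
  interpret S: lattice_symmetry c \<phi> by fact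
  have "expectation F = integral\<^sup>L (distr M spin_space (twist c \<phi>)) F"
    using uniq[OF S.gibbs_S[OF gibbs]] by simp
  also have "\<dots> = expectation (\<lambda>s. F (twist c \<phi> s))"
    using S.measurable_S assms(2)
    by (intro integral_distr) (simp_all add: measurable_cong_sets[OF M_simps(1) refl])
  finally show ?thesis ..
qed

lemma prob_symmetry:
  assumes S: "lattice_symmetry c \<phi>" and A: "{s\<in>\<Omega>. P s} \<in> sets spin_space"
  shows "prob {s\<in>\<Omega>. P (twist c \<phi> s)} = prob {s\<in>\<Omega>. P s}"
proof -
  interpret S: lattice_symmetry c \<phi> by fact
  have "prob {s\<in>\<Omega>. P s} = measure (distr M spin_space (twist c \<phi>)) {s\<in>\<Omega>. P s}"
    using uniq[OF S.gibbs_S[OF gibbs]] by simp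
  also have "\<dots> = prob (twist c \<phi> -` {s\<in>\<Omega>. P s} \<inter> space M)"
    using S.measurable_S A by (intro measure_distr) (simp_all add: measurable_cong_sets[OF M_simps(1) refl])
  also have "twist c \<phi> -` {s\<in>\<Omega>. P s} \<inter> space M = {s\<in>\<Omega>. P (twist c \<phi> s)}"
    using S.S_in by (auto simp: M_simps)
  finally show ?thesis ..
qed

lemma integral_shift: "F \<in> borel_measurable spin_space \<Longrightarrow> expectation (\<lambda>s. F (s \<circ> shift t)) = expectation F" for F :: "spins \<Rightarrow> real"
  using integral_symmetry[OF shift.lattice_symmetry_axioms[of t], of F] by (simp add: twist_1)

lemma expectation_T_shift: "expectation (\<lambda>s. T s (x + site t) (y + site t)) = expectation (\<lambda>s. T s x y)"
  using integral_shift[OF usc_measurable[OF usc_T[of x y]], of t] by (simp add: T_shift)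

lemma expectation_T_rot: "expectation (\<lambda>s. T s (rotR x) (rotR y)) = expectation (\<lambda>s. T s x y)"
  using integral_symmetry[OF rot.lattice_symmetry_axioms usc_measurable[OF usc_T[of x y]]] by (simp add: twist_1 T_rot)

lemma sets_T: "{s\<in>\<Omega>. a \<le> T s x y} \<in> sets spin_space" "{s\<in>\<Omega>. T s x y \<le> a} \<in> sets spin_space"
  "{s\<in>\<Omega>. a < T s x y} \<in> sets spin_space"
proof -
  have [measurable]: "(\<lambda>s. T s x y) \<in> borel_measurable spin_space" by (rule usc_measurable[OF usc_T])
  show "{s\<in>\<Omega>. a \<le> T s x y} \<in> sets spin_space" "{s\<in>\<Omega>. T s x y \<le> a} \<in> sets spin_space"
    "{s\<in>\<Omega>. a < T s x y} \<in> sets spin_space" by measurable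
qed

lemma prob_T_shift_le: "prob {s\<in>\<Omega>. T s (x + site t) (y + site t) \<le> a} = prob {s\<in>\<Omega>. T s x y \<le> a}"
  using prob_symmetry[OF shift.lattice_symmetry_axioms[of t] sets_T(2)[of x y a]] by (simp add: twist_1 T_shift)

lemma prob_T_shift_gt: "prob {s\<in>\<Omega>. a < T s (x + site t) (y + site t)} = prob {s\<in>\<Omega>. a < T s x y}"
  using prob_symmetry[OF shift.lattice_symmetry_axioms[of t] sets_T(3)[of a x y]] by (simp add: twist_1 T_shift)

lemma prob_T_rot_gt: "prob {s\<in>\<Omega>. a < T s (rotR x) (rotR y)} = prob {s\<in>\<Omega>. a < T s x y}"
  using prob_symmetry[OF rot.lattice_symmetry_axioms sets_T(3)[of a x y]] by (simp add: twist_1 T_rot)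

section \<open>Expected cost between lattice points\<close>

definition g :: "vertex \<Rightarrow> real" where
  "g z = expectation (\<lambda>s. T s 0 (site z))"

lemma g_nonneg: "0 \<le> g z"
  unfolding g_def by (rule integral_nonneg_AE) (simp add: T_nonneg)

lemma g_add: "g (x + y) \<le> g x + g y"
proof -
  have "g (x + y) \<le> expectation (\<lambda>s. T s 0 (site x) + T s (site x) (site (x + y)))"
    unfolding g_def by (intro integral_mono Bochner_Integration.integrable_add integrable_T T_triangle)
  also have "\<dots> = g x + expectation (\<lambda>s. T s (0 + site x) (site y + site x))"
    by (simp add: g_def integrable_T site_add add.commute)
  finally show ?thesis unfolding expectation_T_shift by (simp add: g_def)
qed

lemma g_rot: "g (rot z) = g z"
  using expectation_T_rot[of 0 "site z"] by (simp add: g_def rotR_site linear_0[OF linear_rotR])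

lemma g_0: "g 0 = 0"
proof -
  have "T s 0 0 = 0" for s using T_le[of s 0 0] T_nonneg[of s 0 0] by simp
  then show ?thesis by (simp add: g_def)
qed

lemma g_uminus: "g (- z) = g z"
proof -
  have "- z = rot (rot (rot z))" by (simp add: rot_def prod_eq_iff)
  then show ?thesis by (simp add: g_rot)
qed

lemma g_sc: "g (sc n z) \<le> \<bar>real_of_int n\<bar> * g z"
proof -
  have nat: "g (sc (int k) z) \<le> k * g z" for k
  proof (induction k)
    case (Suc k)
    have "sc (int (Suc k)) z = sc (int k) z + z" by (simp add: sc_def prod_eq_iff algebra_simps)
    then show ?case using Suc g_add[of "sc (int k) z" z] by (simp add: algebra_simps)
  qed (simp add: g_0)
  show ?thesis
  proof (cases "n \<ge> 0")
    case True
    then show ?thesis using nat[of "nat n"] by simp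
  next
    case False
    have "sc n z = - sc (int (nat (- n))) z" using False by (simp add: sc_def prod_eq_iff)
    then show ?thesis using nat[of "nat (- n)"] False by (simp add: g_uminus)
  qed
qed

text \<open>By uniqueness the conditional law of a local function given the
  spins far away is uniformly close to its law, so well separated translates behave like independent
  copies.\<close>

lemma separated_translates:
  fixes f :: "spins \<Rightarrow> real"
  assumes f: "dep J f" "finite J" and f0: "\<And>s. s \<in> \<Omega> \<Longrightarrow> 0 \<le> f s" and fC: "\<And>s. s \<in> \<Omega> \<Longrightarrow> f s \<le> C"
    and m: "expectation f < m"
  shows "\<exists>(q::nat) \<rho>. 0 < \<rho> \<and> \<rho> < 1 \<and> (\<forall>t::nat \<Rightarrow> vertex. (\<forall>i j. i < j \<longrightarrow> t j - t i \<notin> vbox q) \<longrightarrow>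
    (\<forall>n. prob {s\<in>\<Omega>. m * n \<le> (\<Sum>i<n. f (s \<circ> shift (t i)))} \<le> \<rho> ^ n))"
proof -
  define C' where "C' = max C 1"
  have C': "C' \<ge> 1" "\<And>s. s \<in> \<Omega> \<Longrightarrow> f s \<le> C'" using fC by (auto simp: C'_def max.coboundedI1)
  define \<delta> where "\<delta> = m - expectation f"
  have \<delta>: "\<delta> > 0" using m by (simp add: \<delta>_def)
  \<comment> \<open>Small enough that the quadratic bound of exp applies to \<kappa> f, and that its
    second-order term uses only half of the gap \<delta>.\<close>
  define \<kappa> where "\<kappa> = min (1 / C') (\<delta> / (2 * C'\<^sup>2))"
  have \<kappa>: "\<kappa> > 0" "\<kappa> * C' \<le> 1" "\<kappa> * C'\<^sup>2 \<le> \<delta> / 2"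
  proof -
    show "\<kappa> > 0" using C' \<delta> by (simp add: \<kappa>_def)
    have "\<kappa> \<le> 1 / C'" by (simp add: \<kappa>_def)
    then show "\<kappa> * C' \<le> 1" using C' by (simp add: field_simps)
    have "\<kappa> \<le> \<delta> / (2 * C'\<^sup>2)" by (simp add: \<kappa>_def)
    then show "\<kappa> * C'\<^sup>2 \<le> \<delta> / 2" using C' by (simp add: field_simps)
  qed
  define h where "h s = exp (\<kappa> * f s)" for s
  have h: "dep J h" using f(1) unfolding dep_def h_def by metis
  have ih: "integrable M h" and if': "integrable M f" by (rule integrable_dep[OF sp _ f(2)], fact)+
  have "expectation h \<le> expectation (\<lambda>s. 1 + \<kappa> * f s + \<kappa> * (\<kappa> * C'\<^sup>2))"
  proof (rule integral_mono[OF ih])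
    show "integrable M (\<lambda>s. 1 + \<kappa> * f s + \<kappa> * (\<kappa> * C'\<^sup>2))" using if' by simp
    fix s assume "s \<in> space M"
    then have s: "0 \<le> f s" "f s \<le> C'" using f0 C' M_simps by auto
    have "\<kappa> * f s \<le> \<kappa> * C'" using s \<kappa> by (intro mult_left_mono) auto
    also have "\<dots> \<le> 1" by (rule \<kappa>(2))
    finally have "\<kappa> * f s \<le> 1" .
    moreover have "0 \<le> \<kappa> * f s" using s \<kappa>(1) by simp
    ultimately have "h s \<le> 1 + \<kappa> * f s + (\<kappa> * f s)\<^sup>2" unfolding h_def by (intro exp_quadratic_bound)
    also have "(\<kappa> * f s)\<^sup>2 \<le> (\<kappa> * C')\<^sup>2" using s \<kappa> by (intro power_mono mult_left_mono) auto
    also have "(\<kappa> * C')\<^sup>2 = \<kappa> * (\<kappa> * C'\<^sup>2)" by (simp add: power2_eq_square)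
    finally show "h s \<le> 1 + \<kappa> * f s + \<kappa> * (\<kappa> * C'\<^sup>2)" by simp
  qed
  also have "\<dots> = 1 + \<kappa> * (expectation f + \<kappa> * C'\<^sup>2)"
    using if' by (simp add: prob_space algebra_simps)
  also have "\<dots> \<le> 1 + \<kappa> * (expectation f + \<delta> / 2)" using \<kappa> by (intro add_left_mono mult_left_mono) auto
  also have "\<dots> < 1 + \<kappa> * m"
  proof -
    have "expectation f + \<delta> / 2 < m" using \<delta> \<delta>_def by linarith
    then show ?thesis using \<kappa>(1) by simp
  qed
  also have "\<dots> \<le> exp (\<kappa> * m)" by (rule exp_ge_add_one_self)
  finally have Eh: "expectation h < exp (\<kappa> * m)" .
  \<comment> \<open>The midpoint leaves room on both sides: above the mean for the uniform error of
    the kernel, and below exp (\<kappa> m) for the exponential rate.\<close>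
  define K where "K = (expectation h + exp (\<kappa> * m)) / 2"
  have K: "expectation h < K" "K < exp (\<kappa> * m)" using Eh by (auto simp: K_def)
  have Kpos: "K > 0"
  proof -
    have "0 \<le> expectation h" by (rule integral_nonneg_AE) (simp add: h_def)
    then show ?thesis using K by simp
  qed
  obtain L where L: "finite L" and uni: "\<And>\<eta>. \<eta> \<in> \<Omega> \<Longrightarrow> \<bar>gexp \<beta> L \<eta> h - expectation h\<bar> < K - expectation h"
    using kernel_uniform[OF gibbs uniq h f(2), of "K - expectation h"] K by auto
  then have gK: "gexp \<beta> L \<eta> h \<le> K" if "\<eta> \<in> \<Omega>" for \<eta> using uni[OF that] by linarith
  \<comment> \<open>If a translation difference avoids this box, the supports of the earlier factors
    do not meet the volume resampled for the last factor.\<close>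
  obtain q where q: "(\<lambda>(x, y). x - y) ` (J \<times> L) \<subseteq> vbox q"
    using vbox_exhausts[of "(\<lambda>(x, y). x - y) ` (J \<times> L)"] f(2) L by auto
  define \<rho> where "\<rho> = K * exp (- \<kappa> * m)"
  have \<rho>: "0 < \<rho>" "\<rho> < 1"
  proof -
    show "0 < \<rho>" using Kpos by (simp add: \<rho>_def)
    have "\<rho> < exp (\<kappa> * m) * exp (- \<kappa> * m)" unfolding \<rho>_def using K by (intro mult_strict_right_mono) auto
    then show "\<rho> < 1" by (simp add: exp_minus)
  qed
  have "prob {s\<in>\<Omega>. m * n \<le> (\<Sum>i<n. f (s \<circ> shift (t i)))} \<le> \<rho> ^ n"
    if t: "\<forall>i j. i < j \<longrightarrow> t j - t i \<notin> vbox q" for t :: "nat \<Rightarrow> vertex" and n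
  proof -
    define P where "P n s = (\<Prod>i<n. h (s \<circ> shift (t i)))" for n s
    have depi: "dep (shift (t i) ` J) (\<lambda>s. h (s \<circ> shift (t i)))" for i
      using shift.dep_S[OF h, of "t i"] by (simp add: twist_1)
    have depP: "dep (\<Union>i<n. shift (t i) ` J) (P n)" for n
      unfolding dep_def
    proof (intro ballI impI)
      fix s u assume su: "s \<in> \<Omega>" "u \<in> \<Omega>" "\<forall>x\<in>(\<Union>i<n. shift (t i) ` J). s x = u x"
      show "P n s = P n u"
        unfolding P_def using su by (intro prod.cong refl depD[OF depi]) auto
    qed
    have finP: "finite (\<Union>i<n. shift (t i) ` J)" for n using f(2) by auto
    have P0: "0 < P n s" for n s unfolding P_def by (intro prod_pos) (simp add: h_def)
    have iP: "integrable M (P n)" for n by (rule integrable_dep[OF sp depP finP])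
    have EP: "expectation (P n) \<le> K ^ n" for n
    proof (induction n)
      case 0 then show ?case by (simp add: P_def prob_space)
    next
      case (Suc n)
      let ?L = "shift (t n) ` L"
      have finL: "finite ?L" using L by simp
      \<comment> \<open>Given the spins outside the translated volume, the first n factors are
        constant, and the last one has conditional mean at most K whatever these spins are.\<close>
      have ker: "gexp \<beta> ?L \<eta> (P (Suc n)) \<le> K * P n \<eta>" if \<eta>: "\<eta> \<in> \<Omega>" for \<eta>
      proof -
        have "gexp \<beta> ?L \<eta> (P (Suc n)) = gexp \<beta> ?L \<eta> (\<lambda>s. P n s * h (s \<circ> shift (t n)))"
          by (intro gexp_cong) (simp add: P_def mult.commute)
        also have "\<dots> = P n \<eta> * gexp \<beta> ?L \<eta> (\<lambda>s. h (s \<circ> shift (t n)))"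
        proof (rule gexp_mult_const)
          fix s assume s: "s \<in> extensions ?L \<eta>"
          show "P n s = P n \<eta>"
          proof (rule depD[OF depP])
            show "s \<in> \<Omega>" "\<eta> \<in> \<Omega>" using s \<eta> by (auto simp: ext_iff)
            fix x assume "x \<in> (\<Union>i<n. shift (t i) ` J)"
            then obtain i j where i: "i < n" "j \<in> J" "x = j + t i" by (auto simp: shift_def)
            have "x \<notin> ?L"
            proof
              assume "x \<in> ?L"
              then obtain l where l: "l \<in> L" "x = l + t n" by (auto simp: shift_def)
              then have "t n - t i = j - l" using i by (simp add: algebra_simps)
              then have "t n - t i \<in> vbox q" using q i l by force
              then show False using t i by blast
            qed
            then show "s x = \<eta> x" using s by (simp add: ext_iff)
          qed
        qed
        also have "gexp \<beta> ?L \<eta> (\<lambda>s. h (s \<circ> shift (t n))) = gexp \<beta> L (\<eta> \<circ> shift (t n)) h"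
          using shift.gexp_S[OF \<eta>, of \<beta> L "t n" h] by (simp add: twist_1)
        also have "\<dots> \<le> K" by (rule gK) (simp add: \<eta>)
        finally show ?thesis using P0[of n \<eta>] by (simp add: mult.commute)
      qed
      have "expectation (P (Suc n)) = expectation (\<lambda>\<eta>. gexp \<beta> ?L \<eta> (P (Suc n)))"
        by (rule gibbs_dlr[OF gibbs finL depP finP, symmetric])
      also have "\<dots> \<le> expectation (\<lambda>\<eta>. K * P n \<eta>)"
        using iP by (intro integral_mono integrable_dep[OF sp dep_gexp[OF depP]] finite_dep_gexp_support finP finL ker)
          (auto simp: M_simps)
      also have "\<dots> = K * expectation (P n)" by simp
      also have "\<dots> \<le> K * K ^ n" using Suc Kpos by (intro mult_left_mono) auto
      finally show ?case by simp
    qed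
    have eqset: "{s\<in>\<Omega>. m * n \<le> (\<Sum>i<n. f (s \<circ> shift (t i)))} = {s\<in>space M. exp (\<kappa> * m * n) \<le> P n s}"
    proof -
      have "P n s = exp (\<kappa> * (\<Sum>i<n. f (s \<circ> shift (t i))))" for s
        by (simp add: P_def h_def exp_sum sum_distrib_left)
      then show ?thesis using \<kappa>(1) by (auto simp: M_simps mult.assoc)
    qed
    have "prob {s\<in>space M. exp (\<kappa> * m * n) \<le> P n s} \<le> expectation (P n) / exp (\<kappa> * m * n)"
      using integral_Markov_inequality_measure[of M "P n" "space M" "exp (\<kappa> * m * n)"] iP[of n] P0
      by (simp add: less_imp_le)
    also have "\<dots> \<le> K ^ n / exp (\<kappa> * m * n)" using EP by (intro divide_right_mono) auto
    also have "\<dots> = \<rho> ^ n"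
      by (simp add: \<rho>_def power_mult_distrib exp_of_nat_mult[symmetric] exp_minus field_simps)
    finally show ?thesis unfolding eqset .
  qed
  with \<rho> show ?thesis by blast
qed

end


section \<open>Tail bounds for the pseudometric\<close>

text \<open>Consecutive blocks of a line overlap in influence; within one residue class modulo Q
  they are far enough apart for \<open>separated_translates\<close>.\<close>

lemma sum_residue_classes:
  fixes W :: "nat \<Rightarrow> real"
  shows "(\<Sum>u<k * Q. W u) = (\<Sum>r<Q. \<Sum>j<k. W (j * Q + r))"
proof -
  have "(\<Sum>u<k * Q. W u) = (\<Sum>j<k. \<Sum>u\<in>{j * Q..<j * Q + Q}. W u)"
    by (rule sum.nat_group[symmetric])
  also have "\<dots> = (\<Sum>j<k. \<Sum>r<Q. W (j * Q + r))"
  proof (rule sum.cong[OF refl])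
    fix j
    show "(\<Sum>u\<in>{j * Q..<j * Q + Q}. W u) = (\<Sum>r<Q. W (j * Q + r))"
      using sum.shift_bounds_nat_ivl[of W 0 "j * Q" Q] by (simp add: add.commute atLeast0LessThan)
  qed
  also have "\<dots> = (\<Sum>r<Q. \<Sum>j<k. W (j * Q + r))" by (rule sum.swap)
  finally show ?thesis .
qed

lemma T_chain:
  "T s 0 (site (sc (int (i * N)) z)) \<le> (\<Sum>u<i. T (s \<circ> shift (sc (int (u * N)) z)) 0 (site (sc (int N) z)))"
proof (induction i)
  case 0
  have "T s 0 0 \<le> 0" using T_le[of s 0 0] by simp
  then show ?case by simp
next
  case (Suc i)
  let ?x = "site (sc (int (i * N)) z)"
  have "sc (int (Suc i * N)) z = sc (int N) z + sc (int (i * N)) z"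
    by (simp add: sc_def algebra_simps)
  then have e: "site (sc (int (Suc i * N)) z) = site (sc (int N) z) + ?x" by (simp add: site_add)
  have "T s 0 (site (sc (int (Suc i * N)) z)) \<le> T s 0 ?x + T s ?x (site (sc (int (Suc i * N)) z))"
    by (rule T_triangle)
  also have "T s ?x (site (sc (int (Suc i * N)) z)) = T (s \<circ> shift (sc (int (i * N)) z)) 0 (site (sc (int N) z))"
    unfolding T_shift e by simp
  finally show ?case unfolding sum.lessThan_Suc using Suc by linarith
qed

lemma sc_notin_vbox:
  assumes "z \<noteq> 0" "int q < \<bar>n\<bar>"
  shows "sc n z \<notin> vbox q"
proof
  assume "sc n z \<in> vbox q"
  then have b: "\<bar>n * fst z\<bar> \<le> int q" "\<bar>n * snd z\<bar> \<le> int q"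
    unfolding vbox_def sc_def by auto
  have "\<bar>n\<bar> * 1 \<le> \<bar>n\<bar> * \<bar>c\<bar>" if "c \<noteq> 0" for c :: int using that by (intro mult_left_mono) auto
  then have "\<bar>n\<bar> \<le> \<bar>n * c\<bar>" if "c \<noteq> 0" for c using that by (simp add: abs_mult)
  moreover have "fst z \<noteq> 0 \<or> snd z \<noteq> 0" using assms(1) by (auto simp: prod_eq_iff)
  ultimately show False using b assms(2) by force
qed

context unique_gibbs
begin

text \<open>The segment is cut into blocks of N steps, each bounded by a translate of one local
  function with mean below a N. An excessive total forces an excessive sum in one of the Q residue
  classes, and each class obeys the Chernoff bound. Lengths m \<le> n are allowed because rounded
  multiples of a vector are only known to have at most a given length.\<close>

lemma upper_tail:
  assumes z: "z \<noteq> 0" and N: "N \<ge> 1" "g (sc (int N) z) < a * real N"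
  shows "\<exists>Q \<rho> C. 0 < \<rho> \<and> \<rho> < 1 \<and> 0 \<le> Q \<and> 0 \<le> C \<and>
    (\<forall>n m. m \<le> n \<longrightarrow> prob {s\<in>\<Omega>. a * real n + C < T s 0 (site (sc (int m) z))} \<le> Q * \<rho> ^ n)"
proof -
  let ?w = "site (sc (int N) z)"
  have "0 < a * real N" using g_nonneg N(2) by (rule order.strict_trans1)
  then have a: "a > 0" using N(1) by (simp add: zero_less_mult_iff)
  obtain J f where J: "finite J" and f: "dep J f" and fF: "\<And>s. s \<in> \<Omega> \<Longrightarrow> T s 0 ?w \<le> f s"
    and f0: "\<And>s. s \<in> \<Omega> \<Longrightarrow> 0 \<le> f s" and fC: "\<And>s. s \<in> \<Omega> \<Longrightarrow> f s \<le> norm ?w" and Ef: "expectation f < a * real N"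
    using usc_cylinder_approx[OF sp usc_T[of 0 ?w], of "norm ?w" "a * real N - g (sc (int N) z)"] N(2) T_nonneg T_le[of _ 0 ?w]
    unfolding g_def by (auto simp: diff_0_right)
  obtain q \<rho> where \<rho>: "0 < \<rho>" "\<rho> < 1" and tail: "\<And>t n. \<forall>i j. i < j \<longrightarrow> t j - t i \<notin> vbox q \<Longrightarrow>
      prob {s\<in>\<Omega>. a * real N * real n \<le> (\<Sum>i<n. f (s \<circ> shift (t i)))} \<le> \<rho> ^ n"
    using separated_translates[OF f J f0 fC Ef] by blast
  define Q where "Q = q + 1"
  define W where "W s u = f (s \<circ> shift (sc (int (u * N)) z))" for s u
  \<comment> \<open>Number of blocks per class, rounded up so that the N Q k steps in total cover
    n.\<close>
  define k where "k n = n div (N * Q) + 1" for n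
  define bad where "bad n = (\<Union>r<Q. {s\<in>\<Omega>. a * real N * real (k n) \<le> (\<Sum>j<k n. W s (j * Q + r))})" for n
  \<comment> \<open>Pays for the overshoot of at most N Q steps and for the m mod N steps beyond the
    last whole block.\<close>
  define C where "C = a * real (N * Q) + real N * norm (site z)"
  have NQ: "N * Q > 0" using N(1) by (simp add: Q_def)
  have kn: "n \<le> N * Q * k n" "N * Q * k n \<le> n + N * Q" for n
    using mult_div_mod_eq[of "N * Q" n] mod_less_divisor[OF NQ, of n] unfolding k_def by (simp_all add: algebra_simps)
  have Wmeas: "(\<lambda>s. W s u) \<in> borel_measurable spin_space" for u
    unfolding W_def using measurable_compose[OF shift.measurable_S measurable_dep[OF f J]] by (simp add: twist_1)
  have sets_bad: "{s\<in>\<Omega>. a * real N * real (k n) \<le> (\<Sum>j<k n. W s (j * Q + r))} \<in> sets M" for n r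
  proof -
    note Wmeas[measurable]
    show ?thesis unfolding M_simps by measurable
  qed
  have prob_bad: "prob (bad n) \<le> real Q * \<rho> ^ k n" for n
  proof -
    have "prob (bad n) \<le> (\<Sum>r<Q. prob {s\<in>\<Omega>. a * real N * real (k n) \<le> (\<Sum>j<k n. W s (j * Q + r))})"
      unfolding bad_def by (intro finite_measure_subadditive_finite) (use sets_bad in auto)
    also have "\<dots> \<le> (\<Sum>r<Q. \<rho> ^ k n)"
    proof (rule sum_mono)
      fix r
      have "sc (int ((j * Q + r) * N)) z - sc (int ((i * Q + r) * N)) z \<notin> vbox q" if "i < j" for i j
      proof -
        have "sc (int ((j * Q + r) * N)) z - sc (int ((i * Q + r) * N)) z = sc (int ((j - i) * Q * N)) z"
          using that by (simp add: sc_def of_nat_diff algebra_simps)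
        moreover
        have "q < (j - i) * Q * N"
        proof -
          have "q < Q" by (simp add: Q_def)
          also have "Q \<le> (j - i) * Q * N" using that N(1) by (simp add: Suc_leI)
          finally show ?thesis .
        qed
        then have "sc (int ((j - i) * Q * N)) z \<notin> vbox q"
          by (intro sc_notin_vbox[OF z]) (simp only: abs_of_nat of_nat_less_iff)
        ultimately show ?thesis by (simp only: not_False_eq_True)
      qed
      then show "prob {s\<in>\<Omega>. a * real N * real (k n) \<le> (\<Sum>j<k n. W s (j * Q + r))} \<le> \<rho> ^ k n"
        unfolding W_def by (intro tail) blast
    qed
    finally show ?thesis by simp
  qed
  have incl: "{s\<in>\<Omega>. a * real n + C < T s 0 (site (sc (int m) z))} \<subseteq> bad n" if m: "m \<le> n" for n m
  proof (rule ccontr)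
    assume "\<not> ?thesis"
    then obtain s where s: "s \<in> \<Omega>" "a * real n + C < T s 0 (site (sc (int m) z))" "s \<notin> bad n" by blast
    define i where "i = m div N"
    have W0: "0 \<le> W s u" for u unfolding W_def by (rule f0) (simp add: s)
    have mi: "m = i * N + m mod N" by (simp add: i_def)
    have iQk: "i \<le> k n * Q"
    proof -
      have "i * N \<le> m" by (simp add: i_def)
      also have "m \<le> N * Q * k n" using m kn(1)[of n] by (rule order_trans)
      also have "\<dots> = k n * Q * N" by simp
      finally show ?thesis using N(1) by (simp only: mult_le_cancel2)
    qed
    have "sc (int m) z = sc (int (m mod N)) z + sc (int (i * N)) z"
      by (subst mi) (simp add: sc_def algebra_simps)
    then have "norm (site (sc (int m) z) - site (sc (int (i * N)) z)) = real (m mod N) * norm (site z)"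
      by (simp add: site_add norm_site_sc)
    also have "\<dots> \<le> real N * norm (site z)"
      using N(1) by (intro mult_right_mono) (auto intro: less_imp_le)
    finally have "T s (site (sc (int (i * N)) z)) (site (sc (int m) z)) \<le> real N * norm (site z)"
      using T_le[of s "site (sc (int (i * N)) z)" "site (sc (int m) z)"] by linarith
    moreover have "T s 0 (site (sc (int (i * N)) z)) \<le> a * real n + a * real (N * Q)"
    proof -
      have "T s 0 (site (sc (int (i * N)) z)) \<le> (\<Sum>u<i. W s u)"
        unfolding W_def by (rule order_trans[OF T_chain sum_mono]) (simp add: fF s)
      also have "\<dots> \<le> (\<Sum>u<k n * Q. W s u)"
        using iQk W0 by (intro sum_mono2) auto
      also have "\<dots> = (\<Sum>r<Q. \<Sum>j<k n. W s (j * Q + r))" by (rule sum_residue_classes)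
      also have "\<dots> \<le> (\<Sum>r<Q. a * real N * real (k n))"
        using s(1,3) unfolding bad_def by (intro sum_mono) (auto simp: not_le intro: less_imp_le)
      also have "\<dots> = a * real (N * Q * k n)" by (simp add: algebra_simps)
      also have "\<dots> \<le> a * real (n + N * Q)" using a kn(2)[of n] by (intro mult_left_mono of_nat_mono) auto
      finally show ?thesis by (simp add: algebra_simps)
    qed
    ultimately have "T s 0 (site (sc (int m) z)) \<le> a * real n + C"
      using T_triangle[of s 0 "site (sc (int m) z)" "site (sc (int (i * N)) z)"] by (simp add: C_def)
    with s(2) show False by simp
  qed
  \<comment> \<open>Converts decay per block of a class into decay per step.\<close>
  define \<rho>' where "\<rho>' = root (N * Q) \<rho>"
  have \<rho>': "0 < \<rho>'" "\<rho>' < 1" "\<rho>' ^ (N * Q) = \<rho>"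
    unfolding \<rho>'_def using \<rho> NQ by (auto simp: real_root_pow_pos2)
  have "prob {s\<in>\<Omega>. a * real n + C < T s 0 (site (sc (int m) z))} \<le> real Q * \<rho>' ^ n" if "m \<le> n" for n m
  proof -
    have "bad n \<in> sets M" unfolding bad_def using sets_bad by (intro sets.finite_UN) auto
    then have "prob {s\<in>\<Omega>. a * real n + C < T s 0 (site (sc (int m) z))} \<le> prob (bad n)"
      by (intro finite_measure_mono incl that)
    also have "\<dots> \<le> real Q * \<rho> ^ k n" by (rule prob_bad)
    also have "\<rho> ^ k n = \<rho>' ^ (N * Q * k n)" unfolding power_mult[of _ "N * Q"] \<rho>'(3) ..
    also have "\<dots> \<le> \<rho>' ^ n" using kn(1)[of n] \<rho>' by (intro power_decreasing) auto
    finally show ?thesis by (simp add: mult_left_mono)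
  qed
  moreover have "0 \<le> C" using a by (simp add: C_def)
  ultimately show ?thesis using \<rho>' by (intro exI[of _ "real Q"] exI[of _ \<rho>'] exI[of _ C]) auto
qed

text \<open>The mean is at least \<mu>' n, while values above nearly (\<mu>' + \<epsilon>) n are
  exponentially rare. Frequent values below \<mu>' n / 2 would therefore pull the mean down too
  far.\<close>

lemma lower_tail:
  assumes z: "z \<noteq> 0" and \<mu>: "\<mu> > 0" "\<And>n. n \<ge> 1 \<Longrightarrow> \<mu> * real n \<le> g (sc (int n) z)" and \<kappa>: "\<kappa> > 0"
  shows "\<forall>\<^sub>F n in sequentially. prob {s\<in>\<Omega>. T s 0 (site (sc (int n) z)) \<le> \<mu> * real n / 2} \<le> \<kappa>"
proof -
  define R where "R = (\<lambda>n. g (sc (int n) z) / real n) ` {1..}"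
  \<comment> \<open>The infimum rather than \<mu>: it bounds every normalised mean from below and is
    nearly attained at some N, which \<open>upper_tail\<close> takes as block length.\<close>
  define \<mu>' where "\<mu>' = Inf R"
  have R: "R \<noteq> {}" "\<And>r. r \<in> R \<Longrightarrow> \<mu> \<le> r"
    unfolding R_def using \<mu>(2) by (auto simp: field_simps)
  then have bdd: "bdd_below R" by (meson bdd_belowI)
  have \<mu>': "\<mu> \<le> \<mu>'" unfolding \<mu>'_def using R by (intro cInf_greatest) auto
  have \<mu>'g: "\<mu>' * real n \<le> g (sc (int n) z)" if "n \<ge> 1" for n
  proof -
    have "\<mu>' \<le> g (sc (int n) z) / real n" unfolding \<mu>'_def using that by (intro cInf_lower bdd) (auto simp: R_def)
    then show ?thesis using that by (simp add: field_simps)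
  qed
  \<comment> \<open>The estimate bounds probability times \<mu>' / 2 by \<epsilon> plus vanishing
    terms; this \<epsilon> is half of \<kappa> \<mu>' / 2.\<close>
  define \<epsilon> where "\<epsilon> = \<kappa> * \<mu>' / 4"
  have \<epsilon>: "\<epsilon> > 0" using \<kappa> \<mu>(1) \<mu>' by (simp add: \<epsilon>_def)
  define a where "a = \<mu>' + \<epsilon>"
  have "Inf R < a" using \<epsilon> by (simp add: a_def \<mu>'_def)
  then obtain N where N: "N \<ge> 1" "g (sc (int N) z) / real N < a"
    using cInf_lessD[OF R(1)] unfolding R_def by auto
  then have "g (sc (int N) z) < a * real N" by (simp add: field_simps)
  then obtain Q \<rho> C where Q: "0 < \<rho>" "\<rho> < 1" "0 \<le> Q" "0 \<le> C"
    and tail: "\<And>n m. m \<le> n \<Longrightarrow> prob {s\<in>\<Omega>. a * real n + C < T s 0 (site (sc (int m) z))} \<le> Q * \<rho> ^ n"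
    using upper_tail[OF z N(1)] by blast
  define D where "D = norm (site z)"
  have main: "prob {s\<in>\<Omega>. T s 0 (site (sc (int n) z)) \<le> \<mu>' * real n / 2} * (\<mu>' / 2) \<le> \<epsilon> + C / real n + D * (Q * \<rho> ^ n)"
    if n: "n \<ge> 1" for n
  proof -
    define X where "X s = T s 0 (site (sc (int n) z))" for s
    define A where "A = {s\<in>\<Omega>. X s \<le> \<mu>' * real n / 2}"
    define B where "B = {s\<in>\<Omega>. a * real n + C < X s}"
    define b where "b = a * real n + C"
    have sA: "A \<in> sets M" and sB: "B \<in> sets M"
      unfolding A_def B_def X_def M_simps by (rule sets_T)+
    have b: "\<mu>' * real n \<le> b" using \<epsilon> Q(4) by (simp add: b_def a_def algebra_simps)
    have \<mu>n: "0 < \<mu>' * real n" using \<mu>(1) \<mu>' n by simp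
    \<comment> \<open>On B only the deterministic bound n D is available; off B the value is at most
      b, and on A it is at most \<mu>' n / 2.\<close>
    have pt: "X s \<le> b - indicator A s * (b - \<mu>' * real n / 2) + real n * D * indicator B s" if s: "s \<in> \<Omega>" for s
    proof (cases "s \<in> B")
      case True
      have "X s \<le> real n * D" unfolding X_def D_def using T_le[of s 0 "site (sc (int n) z)"] by (simp add: norm_site_sc)
      moreover have "0 \<le> b - indicator A s * (b - \<mu>' * real n / 2)"
        using b \<mu>n by (auto simp: indicator_def)
      ultimately show ?thesis using True by simp
    next
      case False
      then have "X s \<le> b" using s by (simp add: B_def b_def)
      then show ?thesis using False s by (auto simp: indicator_def A_def)
    qed
    have iA: "integrable M (indicator A :: spins \<Rightarrow> real)" and iB: "integrable M (indicator B :: spins \<Rightarrow> real)"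
      using sA sB by (auto intro!: integrable_real_indicator simp: less_top[symmetric])
    have EA: "expectation (indicator A) = prob A" "expectation (indicator B) = prob B"
      using sA sB sets.sets_into_space by (simp_all add: Int_absorb2)
    have "\<mu>' * real n \<le> expectation X" using \<mu>'g[OF n] unfolding g_def X_def[abs_def] .
    also have "\<dots> \<le> expectation (\<lambda>s. b - indicator A s * (b - \<mu>' * real n / 2) + real n * D * indicator B s)"
      using iA iB pt unfolding X_def
      by (intro integral_mono integrable_T Bochner_Integration.integrable_add Bochner_Integration.integrable_diff
          integrable_mult_left integrable_mult_right integrable_const) (auto simp: M_simps)
    also have "\<dots> = b - prob A * (b - \<mu>' * real n / 2) + real n * D * prob B"
      using iA iB EA by (simp add: prob_space)
    also have "\<dots> \<le> b - prob A * (\<mu>' * real n / 2) + real n * D * (Q * \<rho> ^ n)"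
    proof -
      have "prob B \<le> Q * \<rho> ^ n" unfolding B_def X_def by (rule tail) simp
      then have "real n * D * prob B \<le> real n * D * (Q * \<rho> ^ n)" by (intro mult_left_mono) (auto simp: D_def)
      moreover have "prob A * (\<mu>' * real n / 2) \<le> prob A * (b - \<mu>' * real n / 2)" using b by (intro mult_left_mono) auto
      ultimately show ?thesis by linarith
    qed
    finally have "prob A * (\<mu>' * real n / 2) \<le> \<epsilon> * real n + C + real n * D * (Q * \<rho> ^ n)"
      by (simp add: b_def a_def algebra_simps)
    then have "(prob A * (\<mu>' / 2)) * real n \<le> (\<epsilon> + C / real n + D * (Q * \<rho> ^ n)) * real n"
      using n by (simp add: algebra_simps)
    then show ?thesis using n unfolding A_def X_def by (simp add: mult_le_cancel_right)
  qed
  have "(\<lambda>n. \<epsilon> + C / real n + D * (Q * \<rho> ^ n)) \<longlonglongrightarrow> \<epsilon> + 0 + D * (Q * 0)"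
    using Q by (intro tendsto_intros lim_const_over_n LIMSEQ_power_zero) auto
  moreover have "\<epsilon> + 0 + D * (Q * 0) < \<kappa> * (\<mu>' / 2)" using \<epsilon> by (simp add: \<epsilon>_def)
  ultimately have "\<forall>\<^sub>F n in sequentially. \<epsilon> + C / real n + D * (Q * \<rho> ^ n) < \<kappa> * (\<mu>' / 2)"
    by (rule order_tendstoD)
  then show ?thesis
    using eventually_ge_at_top[of 1]
  proof eventually_elim
    case (elim n)
    have "prob {s\<in>\<Omega>. T s 0 (site (sc (int n) z)) \<le> \<mu> * real n / 2} \<le> prob {s\<in>\<Omega>. T s 0 (site (sc (int n) z)) \<le> \<mu>' * real n / 2}"
    proof (rule finite_measure_mono)
      have "\<mu> * real n / 2 \<le> \<mu>' * real n / 2" using \<mu>' by (simp add: mult_right_mono)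
      then show "{s\<in>\<Omega>. T s 0 (site (sc (int n) z)) \<le> \<mu> * real n / 2} \<subseteq> {s\<in>\<Omega>. T s 0 (site (sc (int n) z)) \<le> \<mu>' * real n / 2}" by auto
      show "{s\<in>\<Omega>. T s 0 (site (sc (int n) z)) \<le> \<mu>' * real n / 2} \<in> sets M" unfolding M_simps by (rule sets_T)
    qed
    also have "\<dots> \<le> \<kappa>"
    proof -
      have "prob {s\<in>\<Omega>. T s 0 (site (sc (int n) z)) \<le> \<mu>' * real n / 2} * (\<mu>' / 2) < \<kappa> * (\<mu>' / 2)"
        using main[OF elim(2)] elim(1) by linarith
      then show ?thesis using \<mu>(1) \<mu>' by (simp add: mult_less_cancel_right)
    qed
    finally show ?case .
  qed
qed

text \<open>Multiplying the Eisenstein integer (a, b) by its conjugate (a + b, -b) gives its norm, a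
  point of the first axis. So that point is an integer combination of (a, b) and its rotation, and
  linear growth along the axis forces linear growth along (a, b).\<close>

lemma g_direction_bound:
  assumes "\<And>n. n \<ge> 1 \<Longrightarrow> \<epsilon> * real n \<le> g (sc (int n) (1, 0))" and S: "a * a + a * b + b * b > 0" and n: "n \<ge> 1"
  shows "\<epsilon> * real n * real_of_int (a * a + a * b + b * b) \<le> real_of_int (\<bar>a + b\<bar> + \<bar>b\<bar>) * g (sc (int n) (a, b))"
proof -
  let ?S = "a * a + a * b + b * b" and ?w = "sc (int n) (a, b)"
  have "\<epsilon> * real (n * nat ?S) \<le> g (sc (int (n * nat ?S)) (1, 0))"
    by (rule assms(1)) (use S n in \<open>simp add: Suc_leI\<close>)
  moreover have "real (n * nat ?S) = real n * real_of_int ?S" using S by (simp add: of_nat_nat)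
  moreover have "sc (int (n * nat ?S)) (1, 0) = sc (a + b) ?w + sc (- b) (rot ?w)"
    using S by (simp add: sc_def rot_def algebra_simps)
  ultimately have "\<epsilon> * (real n * real_of_int ?S) \<le> g (sc (a + b) ?w + sc (- b) (rot ?w))" by (simp only:)
  also have "\<dots> \<le> g (sc (a + b) ?w) + g (sc (- b) (rot ?w))" by (rule g_add)
  also have "\<dots> \<le> \<bar>real_of_int (a + b)\<bar> * g ?w + \<bar>real_of_int (- b)\<bar> * g (rot ?w)"
    by (intro add_mono g_sc)
  also have "\<dots> = real_of_int (\<bar>a + b\<bar> + \<bar>b\<bar>) * g ?w" by (simp add: g_rot algebra_simps)
  finally show ?thesis by (simp add: mult.assoc)
qed

end


section \<open>The hex lemma\<close>

text \<open>Membership of x is required separately, since the empty path would otherwise start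
  outside A.\<close>

definition linked :: "vertex set \<Rightarrow> vertex \<Rightarrow> vertex \<Rightarrow> bool" where
  "linked A x y \<longleftrightarrow> x \<in> A \<and> (\<lambda>u v. adj u v \<and> u \<in> A \<and> v \<in> A)\<^sup>*\<^sup>* x y"

lemma linked_refl: "x \<in> A \<Longrightarrow> linked A x x"
  by (simp add: linked_def)

lemma linked_in: "linked A x y \<Longrightarrow> y \<in> A"
  unfolding linked_def by (auto elim: rtranclp.cases)

lemma linked_step: "linked A x y \<Longrightarrow> adj y z \<Longrightarrow> z \<in> A \<Longrightarrow> linked A x z"
  using linked_in[of A x y] unfolding linked_def by (auto intro: rtranclp.rtrancl_into_rtrancl)

text \<open>The second coordinate is reversed so that the diagonal (1, 1) of Kuhn's triangulation
  becomes (1, -1), which is a lattice edge, as (1, 1) is not.\<close>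

definition board_vertex :: "(nat \<Rightarrow> nat) \<Rightarrow> vertex" where
  "board_vertex x = (int (x 0), - int (x 1))"

lemma board_adj:
  assumes "a \<le> b" "\<And>j. b j \<le> Suc (a j)" "(a 0, a 1) \<noteq> (b 0, b (1::nat))"
  shows "adj (board_vertex a) (board_vertex b)"
proof -
  have "b j = a j \<or> b j = Suc (a j)" for j
    using assms(1) assms(2)[of j] unfolding le_fun_def by (metis le_SucE le_antisym)
  note this[of 0] this[of 1]
  moreover have "board_vertex b - board_vertex a = (int (b 0) - int (a 0), int (a 1) - int (b 1))"
    by (simp add: board_vertex_def)
  moreover have "b 0 \<noteq> a 0 \<or> b 1 \<noteq> a 1" using assms(3) by auto
  ultimately show ?thesis unfolding adj_def by (elim disjE) simp_all
qed

text \<open>Gale's labelling: label 0 on vertices of \<open>A\<close> that are not linked to the left side, label 1 on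
  vertices outside \<open>A\<close> that are not linked to the bottom side, label 2 on the others.  Without a
  crossing, no triangle carries all three labels, contradicting Sperner's lemma in the form of
  \<open>kuhn_combinatorial\<close>.  The board is enlarged by a row and a column to meet its boundary
  condition.\<close>

theorem hex_crossing:
  "(\<exists>j j'. j \<le> p \<and> j' \<le> p \<and> linked A (0, - int j) (int p, - int j')) \<or>
   (\<exists>i i'. i \<le> p \<and> i' \<le> p \<and> linked (- A) (int i, 0) (int i', - int p))"
proof (rule ccontr)
  assume "\<not> ?thesis"
  then have noL: "\<And>j j'. j \<le> p \<Longrightarrow> j' \<le> p \<Longrightarrow> \<not> linked A (0, - int j) (int p, - int j')"
    and noB: "\<And>i i'. i \<le> p \<Longrightarrow> i' \<le> p \<Longrightarrow> \<not> linked (- A) (int i, 0) (int i', - int p)"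
    by blast+
  define Lft where "Lft = {v. \<exists>j\<le>p. linked A (0, - int j) v}"
  define Bot where "Bot = {v. \<exists>i\<le>p. linked (- A) (int i, 0) v}"
  \<comment> \<open>\<open>reduced 2\<close> returns the first k with \<open>lab x k\<close>
    nonzero, or 2 if there is none. The first two cases fill the added column and row with the
    values that the boundary condition prescribes.\<close>
  define lab :: "(nat \<Rightarrow> nat) \<Rightarrow> nat \<Rightarrow> nat" where "lab x k =
    (let v = board_vertex x in
     if x 0 = Suc p then (if k = 0 \<or> x 1 = Suc p then 1 else 0)
     else if x 1 = Suc p then (if k = 0 then 0 else 1)
     else if v \<in> A then (if k = 0 \<and> v \<notin> Lft then 1 else 0)
     else (if k = 1 \<and> v \<notin> Bot then 1 else 0))" for x k
  let ?r = "reduced 2 \<circ> lab"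
  have "odd (card {s. ksimplex (Suc p) 2 s \<and> ?r ` s = {..2}})"
  proof (rule kuhn_combinatorial)
    show "\<forall>x j. (\<forall>j. x j \<le> Suc p) \<and> j < 2 \<and> x j = 0 \<longrightarrow> lab x j = 0"
    proof (intro allI impI, elim conjE)
      fix x :: "nat \<Rightarrow> nat" and j :: nat assume x: "\<forall>j. x j \<le> Suc p" "j < 2" "x j = 0"
      have x01: "x 0 \<le> Suc p" "x 1 \<le> Suc p" using x by auto
      consider "j = 0" | "j = 1" using x(2) by linarith
      then show "lab x j = 0"
      proof cases
        case 1
        have "board_vertex x \<in> Lft" if "board_vertex x \<in> A" "x 1 \<noteq> Suc p"
        proof -
          have "x 1 \<le> p" using that(2) x01 by simp
          moreover have "board_vertex x = (0, - int (x 1))" using x 1 by (simp add: board_vertex_def)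
          ultimately show ?thesis using linked_refl[OF that(1)] unfolding Lft_def by auto
        qed
        then show ?thesis using 1 x by (auto simp: lab_def Let_def)
      next
        case 2
        have "board_vertex x \<in> Bot" if "board_vertex x \<notin> A" "x 0 \<noteq> Suc p"
        proof -
          have "x 0 \<le> p" using that(2) x01 by simp
          moreover have "board_vertex x = (int (x 0), 0)" using x 2 by (simp add: board_vertex_def)
          moreover have "linked (- A) (board_vertex x) (board_vertex x)" using that(1) by (intro linked_refl) simp
          ultimately show ?thesis unfolding Bot_def by auto
        qed
        then show ?thesis using 2 x by (auto simp: lab_def Let_def)
      qed
    qed
    show "\<forall>x j. (\<forall>j. x j \<le> Suc p) \<and> j < 2 \<and> x j = Suc p \<longrightarrow> lab x j = 1"
    proof (intro allI impI, elim conjE)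
      fix x :: "nat \<Rightarrow> nat" and j :: nat assume x: "j < 2" "x j = Suc p"
      consider "j = 0" | "j = 1" using x(1) by linarith
      then show "lab x j = 1" using x(2) by cases (auto simp: lab_def Let_def)
    qed
  qed simp
  then have "{s. ksimplex (Suc p) 2 s \<and> ?r ` s = {..2}} \<noteq> {}"
    by (rule odd_card_imp_not_empty)
  then obtain s b u where "kuhn_simplex (Suc p) 2 b u s" and rl: "?r ` s = {..2}"
    by (auto elim: ksimplex.cases)
  interpret kuhn_simplex "Suc p" 2 b u s by fact
  have r0: "lab x 0 \<noteq> 0" if "?r x = 0" for x
    using that reduced_labelling(3)[of 2 "lab x"] by simp
  have r1: "lab x 0 = 0 \<and> lab x 1 \<noteq> 0" if "?r x = 1" for x
    using that reduced_labelling[of 2 "lab x"] by simp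
  have r2: "lab x 0 = 0 \<and> lab x 1 = 0" if "?r x = 2" for x
    using that reduced_labelling(2)[of 2 "lab x"] by simp
  obtain x where x: "x \<in> s" "lab x 0 \<noteq> 0"
    using rl r0 by (metis atMost_iff imageE zero_le)
  obtain y where y: "y \<in> s" "lab y 0 = 0" "lab y 1 \<noteq> 0"
    using rl r1 by (metis atMost_iff imageE one_le_numeral)
  obtain z where z: "z \<in> s" "lab z 0 = 0" "lab z 1 = 0"
    using rl r2 by (metis atMost_iff imageE order_refl)
  have near: "a j \<le> Suc (c j)" if "a \<in> s" "c \<in> s" for a c j
    using base_le[OF that(2), of j] le_Suc_base[OF that(1), of j] by linarith
  have adj: "adj (board_vertex z) (board_vertex a)" if "a \<in> s" "(a 0, a 1) \<noteq> (z 0, z 1)" for a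
  proof -
    have "a \<in> enum ` {..2}" "z \<in> enum ` {..2}" using that(1) z(1) s_eq by simp_all
    then obtain i j where "a = enum i" "i \<le> 2" "z = enum j" "j \<le> 2" by blast
    then have "a \<le> z \<or> z \<le> a" using enum_mono[of i j] enum_mono[of j i] by auto
    then show ?thesis
    proof
      assume "a \<le> z"
      from board_adj[OF this near[OF z(1) that(1)] that(2)] show ?thesis by (rule adj_sym)
    next
      assume "z \<le> a"
      from board_adj[OF this near[OF that(1) z(1)] that(2)[symmetric]] show ?thesis .
    qed
  qed
  have bnd: "a 0 \<le> Suc p" "a 1 \<le> Suc p" if "a \<in> s" for a
    using s_space that by (auto simp: Pi_iff)
  \<comment> \<open>The label 2 does not occur on the added row and column, so z lies on the
    original board.\<close>
  have zP: "z 0 \<le> p" "z 1 \<le> p"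
    using z bnd[OF z(1)] by (auto simp: lab_def Let_def le_Suc_eq split: if_splits)
  have ne: "(a 0, a 1) \<noteq> (z 0, z 1)" if "lab a 0 \<noteq> lab z 0 \<or> lab a 1 \<noteq> lab z 1" for a
  proof
    assume "(a 0, a 1) = (z 0, z 1)"
    then have eq: "a 0 = z 0" "a 1 = z 1" by simp_all
    have "lab a k = lab z k" for k unfolding lab_def board_vertex_def eq ..
    with that show False by simp
  qed
  have zx: "adj (board_vertex z) (board_vertex x)" using adj[OF x(1) ne] x z by simp
  have zy: "adj (board_vertex z) (board_vertex y)" using adj[OF y(1) ne] y z by simp
  show False
  proof (cases "board_vertex z \<in> A")
    case True
    then have zL: "board_vertex z \<in> Lft" using z(2) zP by (auto simp: lab_def Let_def split: if_splits)
    \<comment> \<open>A linked vertex in the last original column would complete a crossing. Hence x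
      is not in the added column, and its label 0 says that it is in A but unlinked, although it is
      adjacent to the linked z.\<close>
    have "z 0 \<noteq> p" using zL noL zP(2) unfolding Lft_def board_vertex_def by blast
    then have "x 0 \<noteq> Suc p" using near[OF x(1) z(1), of 0] zP by auto
    then have "board_vertex x \<in> A" "board_vertex x \<notin> Lft"
      using x(2) by (auto simp: lab_def Let_def split: if_splits)
    then show False using zL zx linked_step unfolding Lft_def by blast
  next
    case False
    then have zB: "board_vertex z \<in> Bot" using z(3) zP by (auto simp: lab_def Let_def split: if_splits)
    have "z 1 \<noteq> p" using zB noB zP(1) unfolding Bot_def board_vertex_def by blast
    then have "y 1 \<noteq> Suc p" using near[OF y(1) z(1), of 1] zP by auto
    then have "board_vertex y \<notin> A" "board_vertex y \<notin> Bot"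
      using y(2,3) by (auto simp: lab_def Let_def split: if_splits)
    then show False using zB zy linked_step[of "- A"] unfolding Bot_def by blast
  qed
qed


section \<open>Vanishing of the time constant\<close>

lemma norm_site_axis:
  "norm (site (a, 0)) = \<bar>real_of_int a\<bar>" "norm (site (0, b)) = \<bar>real_of_int b\<bar>"
proof -
  have "norm (site (a, 0)) = sqrt ((norm (site (a, 0)))\<^sup>2)" "norm (site (0, b)) = sqrt ((norm (site (0, b)))\<^sup>2)"
    by simp_all
  then show "norm (site (a, 0)) = \<bar>real_of_int a\<bar>" "norm (site (0, b)) = \<bar>real_of_int b\<bar>"
    unfolding norm_site_sq by (simp_all add: real_sqrt_mult)
qed

lemma tendsto_0_if_small:
  fixes f :: "nat \<Rightarrow> real"
  assumes "\<And>e. e > 0 \<Longrightarrow> \<forall>\<^sub>F n in sequentially. \<bar>f n\<bar> < e"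
  shows "f \<longlonglongrightarrow> 0"
  using assms by (intro tendstoI) simp

lemma linked_T_eq_0:
  assumes "linked {x. s x = -1} x y"
  shows "T s (site x) (site y) = 0"
proof -
  let ?A = "{x. s x = -1}"
  have "(\<lambda>u v. adj u v \<and> u \<in> ?A \<and> v \<in> ?A)\<^sup>*\<^sup>* x y" using assms by (simp add: linked_def)
  then show ?thesis
  proof (induction rule: rtranclp_induct)
    case base
    show ?case using T_le[of s "site x" "site x"] T_nonneg[of s "site x" "site x"] by simp
  next
    case (step y z)
    then have "T s (site y) (site z) = 0" by (intro T_adj_eq_0) auto
    then show ?case
      using step.IH T_triangle[of s "site x" "site z" "site y"] T_nonneg[of s "site x" "site z"] by simp
  qed
qed

text \<open>The complement of the minus spins is the set of minus spins of the flipped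
  configuration, so either alternative of the hex lemma is a crossing at zero cost.\<close>

lemma hex_crossing_T:
  assumes "s \<in> \<Omega>"
  shows "(\<exists>j\<le>p. \<exists>j'\<le>p. T s (site (0, - int j)) (site (int p, - int j')) = 0) \<or>
    (\<exists>i\<le>p. \<exists>i'\<le>p. T (twist (-1) (\<lambda>x. x) s) (site (int i, 0)) (site (int i', - int p)) = 0)"
proof -
  have "- {x. s x = -1} = {x. twist (-1) (\<lambda>x. x) s x = -1}"
    using assms unfolding space_spin twist_def by auto
  from hex_crossing[of p "{x. s x = -1}", unfolded this] show ?thesis
    using linked_T_eq_0[of s] linked_T_eq_0[of "twist (-1) (\<lambda>x. x) s"] by blast
qed

context unique_gibbs
begin

text \<open>The rhombus has side K m, where K is fixed before the scale m, so that the union bound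
  runs over (K + 1)^2 pairs of marks at every scale.\<close>

lemma expected_cost_sublinear:
  assumes "\<epsilon> > 0"
  shows "\<exists>N\<ge>1. g (sc (int N) (1, 0)) < \<epsilon> * real N"
proof (rule ccontr)
  assume "\<not> ?thesis"
  then have low: "\<epsilon> * real n \<le> g (sc (int n) (1, 0))" if "n \<ge> 1" for n
    using that by (meson not_le)
  \<comment> \<open>With \<epsilon> K \<ge> 16 the mean cost between marks on opposite sides is at
    least 4 m, twice the cost 2 m of rounding both ends of a crossing.\<close>
  define K where "K = nat \<lceil>16 / \<epsilon>\<rceil> + 1"
  have K: "K \<ge> 1" "\<epsilon> * real K \<ge> 16"
  proof -
    have "16 / \<epsilon> \<le> real K" unfolding K_def by linarith
    then show "\<epsilon> * real K \<ge> 16" using assms by (simp add: field_simps)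
  qed (simp add: K_def)
  \<comment> \<open>Makes the (K + 1)^2 pairs contribute 1/4 altogether.\<close>
  define \<kappa> where "\<kappa> = 1 / (4 * (real K + 1)\<^sup>2)"
  have \<kappa>: "\<kappa> > 0" by (simp add: \<kappa>_def)
  \<comment> \<open>Opposite sides stay apart: by completing the square, the norm of (K, -d) is at
    least three quarters of K^2 for every offset d.\<close>
  have quad: "3 * (int K * int K) \<le> 4 * (int K * int K + int K * (- d) + d * d)" for d :: int
  proof -
    have "4 * (int K * int K + int K * (- d) + d * d) - 3 * (int K * int K) = (int K - 2 * d)\<^sup>2"
      by (simp add: power2_eq_square algebra_simps)
    then show ?thesis using zero_le_power2[of "int K - 2 * d"] by linarith
  qed
  \<comment> \<open>A norm of at least 3 K^2 / 4 and coefficients summing to at most 3 K give a mean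
    cost of at least \<epsilon> K n / 4, by \<open>g_direction_bound\<close>.\<close>
  have bound: "4 * real n \<le> g (sc (int n) (a, b))"
    if n: "n \<ge> 1" and ab: "3 * (int K * int K) \<le> 4 * (a * a + a * b + b * b)" "\<bar>a + b\<bar> + \<bar>b\<bar> \<le> 3 * int K" for a b n
  proof -
    let ?S = "a * a + a * b + b * b" and ?G = "g (sc (int n) (a, b))"
    have "0 < int K * int K" using K(1) by simp
    then have "0 < 3 * (int K * int K)" by simp
    then have "0 < 4 * ?S" using ab(1) by (rule order.strict_trans2)
    then have "0 < ?S" by (rule zero_less_mult_pos) simp
    then have "\<epsilon> * real n * real_of_int ?S \<le> real_of_int (\<bar>a + b\<bar> + \<bar>b\<bar>) * ?G"
      by (intro g_direction_bound low n)
    also have "\<dots> \<le> real_of_int (3 * int K) * ?G"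
      using ab(2) g_nonneg by (intro mult_right_mono) (simp_all only: of_int_le_iff)
    finally have 1: "\<epsilon> * real n * real_of_int ?S \<le> 3 * real K * ?G" by simp
    have "real_of_int (3 * (int K * int K)) \<le> real_of_int (4 * ?S)"
      using ab(1) by (simp only: of_int_le_iff)
    then have "3 * (real K * real K) \<le> 4 * real_of_int ?S" by simp
    then have "\<epsilon> * real n * (3 * (real K * real K)) \<le> \<epsilon> * real n * (4 * real_of_int ?S)"
      using assms by (intro mult_left_mono) auto
    also have "\<dots> = 4 * (\<epsilon> * real n * real_of_int ?S)" by (rule mult.left_commute)
    also have "\<dots> \<le> 4 * (3 * real K * ?G)" using 1 by (rule mult_left_mono) simp
    finally have "(3 * real K) * (\<epsilon> * real K * real n) \<le> (3 * real K) * (4 * ?G)"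
      by (simp add: algebra_simps)
    then have "\<epsilon> * real K * real n \<le> 4 * ?G" using K(1) by (subst (asm) mult_le_cancel_left_pos) auto
    moreover have "16 * real n \<le> \<epsilon> * real K * real n" using K(2) by (intro mult_right_mono) auto
    ultimately show ?thesis by linarith
  qed
  have nonzero: "(a, b) \<noteq> (0 :: vertex)" if "3 * (int K * int K) \<le> 4 * (a * a + a * b + b * b)" for a b :: int
  proof
    assume "(a, b) = (0 :: vertex)"
    then have "a = 0" "b = 0" by (simp_all add: zero_prod_def)
    then have "int K * int K \<le> 0" using that by simp
    then show False using K(1) by (simp add: mult_le_0_iff)
  qed
  \<comment> \<open>\<open>lower_tail\<close> with rate 4, half of which is the threshold 2.\<close>
  have ev: "\<forall>\<^sub>F n in sequentially. prob {s\<in>\<Omega>. T s 0 (site (sc (int n) (a, b))) \<le> 2 * real n} \<le> \<kappa>"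
    if "3 * (int K * int K) \<le> 4 * (a * a + a * b + b * b)" "\<bar>a + b\<bar> + \<bar>b\<bar> \<le> 3 * int K" for a b
    using lower_tail[OF nonzero[OF that(1)], of 4 \<kappa>] bound that \<kappa> by simp
  have "\<forall>\<^sub>F m in sequentially. \<forall>i\<in>{..K}. \<forall>j\<in>{..K}.
    prob {s\<in>\<Omega>. T s 0 (site (sc (int m) (int K, - (int j - int i)))) \<le> 2 * real m} \<le> \<kappa> \<and>
    prob {s\<in>\<Omega>. T s 0 (site (sc (int m) (int j - int i, - int K))) \<le> 2 * real m} \<le> \<kappa>"
  proof (intro eventually_ball_finite ballI eventually_conj ev)
    fix i j assume ij: "i \<in> {..K}" "j \<in> {..K}"
    show "3 * (int K * int K) \<le> 4 * (int K * int K + int K * - (int j - int i) + - (int j - int i) * - (int j - int i))"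
      using quad[of "int j - int i"] by (simp only: minus_mult_minus)
    show "\<bar>int K + - (int j - int i)\<bar> + \<bar>- (int j - int i)\<bar> \<le> 3 * int K" using ij by auto
    show "3 * (int K * int K) \<le> 4 * ((int j - int i) * (int j - int i) + (int j - int i) * - int K + - int K * - int K)"
      using quad[of "int j - int i"] by (simp add: algebra_simps)
    show "\<bar>int j - int i + - int K\<bar> + \<bar>- int K\<bar> \<le> 3 * int K" using ij by auto
  qed auto
  then obtain m where m: "m \<ge> 1" and pr: "\<And>i j. i \<le> K \<Longrightarrow> j \<le> K \<Longrightarrow>
      prob {s\<in>\<Omega>. T s 0 (site (sc (int m) (int K, - (int j - int i)))) \<le> 2 * real m} \<le> \<kappa> \<and>
      prob {s\<in>\<Omega>. T s 0 (site (sc (int m) (int j - int i, - int K))) \<le> 2 * real m} \<le> \<kappa>"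
    using eventually_happens[OF eventually_conj[OF _ eventually_ge_at_top[of 1]]] by (smt (verit) atMost_iff sequentially_bot)
  define p where "p = K * m"
  define LR where "LR s \<longleftrightarrow> (\<exists>j\<le>p. \<exists>j'\<le>p. T s (site (0, - int j)) (site (int p, - int j')) = 0)" for s
  define TB where "TB s \<longleftrightarrow> (\<exists>i\<le>p. \<exists>i'\<le>p. T s (site (int i, 0)) (site (int i', - int p)) = 0)" for s
  \<comment> \<open>Covers both pairs of sides: x and y parametrise opposite sides by arc length,
    and \<open>j div m * m\<close> is the mark preceding j.\<close>
  have unlikely: "prob {s\<in>\<Omega>. \<exists>j\<le>p. \<exists>j'\<le>p. T s (site (x j)) (site (y j')) = 0} \<le> 1 / 4"
    if lx: "\<And>i j. norm (site (x i) - site (x j)) = \<bar>real i - real j\<bar>"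
      and ly: "\<And>i j. norm (site (y i) - site (y j)) = \<bar>real i - real j\<bar>"
      and pxy: "\<And>i j. i \<le> K \<Longrightarrow> j \<le> K \<Longrightarrow> prob {s\<in>\<Omega>. T s 0 (site (y (j * m) - x (i * m))) \<le> 2 * real m} \<le> \<kappa>"
    for x y :: "nat \<Rightarrow> vertex"
  proof -
    let ?B = "\<lambda>(i, j). {s\<in>\<Omega>. T s (site (x (i * m))) (site (y (j * m))) \<le> 2 * real m}"
    have sB: "?B ij \<in> sets M" for ij
      unfolding M_simps by (cases ij) (simp add: sets_T)
    have near: "\<bar>real j - real (j div m * m)\<bar> \<le> real m" for j
    proof -
      have "j = j div m * m + j mod m" by simp
      then have "real j = real (j div m * m) + real (j mod m)" by (metis of_nat_add)
      moreover have "j mod m < m" using m by simp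
      ultimately show ?thesis by simp
    qed
    have "{s\<in>\<Omega>. \<exists>j\<le>p. \<exists>j'\<le>p. T s (site (x j)) (site (y j')) = 0} \<subseteq> (\<Union>ij\<in>{..K} \<times> {..K}. ?B ij)"
    proof
      fix s assume "s \<in> {s\<in>\<Omega>. \<exists>j\<le>p. \<exists>j'\<le>p. T s (site (x j)) (site (y j')) = 0}"
      then obtain j j' where s: "s \<in> \<Omega>" "j \<le> p" "j' \<le> p" "T s (site (x j)) (site (y j')) = 0" by blast
      let ?i = "j div m" and ?i' = "j' div m"
      have K': "?i \<le> K" "?i' \<le> K"
        using div_le_mono[OF s(2), of m] div_le_mono[OF s(3), of m] m by (simp_all add: p_def)
      have "T s (site (x (?i * m))) (site (y (?i' * m)))
        \<le> T s (site (x (?i * m))) (site (x j)) + (T s (site (x j)) (site (y j')) + T s (site (y j')) (site (y (?i' * m))))"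
        using T_triangle[of s "site (x (?i * m))" "site (y (?i' * m))" "site (x j)"]
          T_triangle[of s "site (x j)" "site (y (?i' * m))" "site (y j')"] by linarith
      also have "\<dots> \<le> real m + (0 + real m)"
      proof (intro add_mono)
        show "T s (site (x (?i * m))) (site (x j)) \<le> real m"
          using T_le[of s "site (x (?i * m))" "site (x j)"] near[of j] by (simp add: lx)
        show "T s (site (y j')) (site (y (?i' * m))) \<le> real m"
          using T_le[of s "site (y j')" "site (y (?i' * m))"] near[of j'] by (simp add: ly abs_minus_commute)
      qed (simp add: s)
      finally have "s \<in> ?B (?i, ?i')" using s(1) by simp
      then show "s \<in> (\<Union>ij\<in>{..K} \<times> {..K}. ?B ij)" using K' by blast
    qed
    then have "prob {s\<in>\<Omega>. \<exists>j\<le>p. \<exists>j'\<le>p. T s (site (x j)) (site (y j')) = 0} \<le> prob (\<Union>ij\<in>{..K} \<times> {..K}. ?B ij)"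
      using sB by (intro finite_measure_mono sets.finite_UN) auto
    also have "\<dots> \<le> (\<Sum>ij\<in>{..K} \<times> {..K}. prob (?B ij))"
      using sB by (intro finite_measure_subadditive_finite) auto
    also have "\<dots> \<le> (\<Sum>ij\<in>{..K} \<times> {..K}. \<kappa>)"
    proof (rule sum_mono)
      fix ij assume "ij \<in> {..K} \<times> {..K}"
      then obtain i j where ij: "ij = (i, j)" "i \<le> K" "j \<le> K" by auto
      have "prob (?B (i, j)) = prob {s\<in>\<Omega>. T s (0 + site (x (i * m))) (site (y (j * m) - x (i * m)) + site (x (i * m))) \<le> 2 * real m}"
        by (simp add: site_diff)
      also have "\<dots> = prob {s\<in>\<Omega>. T s 0 (site (y (j * m) - x (i * m))) \<le> 2 * real m}"
        by (rule prob_T_shift_le)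
      finally show "prob (?B ij) \<le> \<kappa>" using pxy ij by simp
    qed
    also have "\<dots> = (real K + 1)\<^sup>2 * \<kappa>" by (simp add: power2_eq_square algebra_simps)
    also have "\<dots> = 1 / 4" by (simp add: \<kappa>_def)
    finally show ?thesis .
  qed
  have "prob {s\<in>\<Omega>. LR s} \<le> 1 / 4"
    unfolding LR_def
  proof (rule unlikely)
    show "norm (site (0, - int i) - site (0, - int j)) = \<bar>real i - real j\<bar>" for i j
      by (simp add: site_diff[symmetric]) (simp add: norm_site_axis)
    show "norm (site (int p, - int i) - site (int p, - int j)) = \<bar>real i - real j\<bar>" for i j
      by (simp add: site_diff[symmetric]) (simp add: norm_site_axis)
    fix i j assume "i \<le> K" "j \<le> K"
    moreover have "(int p, - int (j * m)) - (0, - int (i * m)) = sc (int m) (int K, - (int j - int i))"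
      by (simp add: p_def sc_def algebra_simps)
    ultimately show "prob {s\<in>\<Omega>. T s 0 (site ((int p, - int (j * m)) - (0, - int (i * m)))) \<le> 2 * real m} \<le> \<kappa>"
      using pr by (simp only:)
  qed
  moreover have "prob {s\<in>\<Omega>. TB s} \<le> 1 / 4"
    unfolding TB_def
  proof (rule unlikely)
    show "norm (site (int i, 0) - site (int j, 0)) = \<bar>real i - real j\<bar>" for i j
      by (simp add: site_diff[symmetric]) (simp add: norm_site_axis)
    show "norm (site (int i, - int p) - site (int j, - int p)) = \<bar>real i - real j\<bar>" for i j
      by (simp add: site_diff[symmetric]) (simp add: norm_site_axis)
    fix i j assume "i \<le> K" "j \<le> K"
    moreover have "(int (j * m), - int p) - (int (i * m), 0) = sc (int m) (int j - int i, - int K)"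
      by (simp add: p_def sc_def algebra_simps)
    ultimately show "prob {s\<in>\<Omega>. T s 0 (site ((int (j * m), - int p) - (int (i * m), 0))) \<le> 2 * real m} \<le> \<kappa>"
      using pr by (simp only:)
  qed
  moreover have "1 \<le> prob {s\<in>\<Omega>. LR s} + prob {s\<in>\<Omega>. TB s}"
  proof -
    have T0: "{s\<in>\<Omega>. T s a b = 0} \<in> sets spin_space" for a b
    proof -
      have [measurable]: "(\<lambda>s. T s a b) \<in> borel_measurable spin_space" by (rule usc_measurable[OF usc_T])
      show ?thesis by measurable
    qed
    have bex: "{s\<in>\<Omega>. \<exists>j\<le>p. \<exists>j'\<le>p. T s (x j) (y j') = 0} \<in> sets spin_space" for x y :: "nat \<Rightarrow> real ^ 2"
    proof -
      have "{s\<in>\<Omega>. \<exists>j\<le>p. \<exists>j'\<le>p. T s (x j) (y j') = 0} = (\<Union>j\<in>{..p}. \<Union>j'\<in>{..p}. {s\<in>\<Omega>. T s (x j) (y j') = 0})"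
        by auto
      also have "\<dots> \<in> sets spin_space" by (intro sets.finite_UN T0) auto
      finally show ?thesis .
    qed
    have sLR: "{s\<in>\<Omega>. LR s} \<in> sets spin_space" and sTB: "{s\<in>\<Omega>. TB s} \<in> sets spin_space"
      unfolding LR_def TB_def by (rule bex)+
    let ?f = "twist (-1) (\<lambda>x. x)"
    have "?f -` {s\<in>\<Omega>. TB s} \<inter> \<Omega> \<in> sets spin_space"
      by (rule measurable_sets[OF flip.measurable_S sTB])
    moreover have "?f -` {s\<in>\<Omega>. TB s} \<inter> \<Omega> = {s\<in>\<Omega>. TB (?f s)}" using flip.S_in by auto
    ultimately have sTB': "{s\<in>\<Omega>. TB (?f s)} \<in> sets spin_space" by simp
    have "\<Omega> = {s\<in>\<Omega>. LR s} \<union> {s\<in>\<Omega>. TB (?f s)}"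
      using hex_crossing_T[of _ p] unfolding LR_def TB_def by blast
    then have "1 = prob ({s\<in>\<Omega>. LR s} \<union> {s\<in>\<Omega>. TB (?f s)})" using prob_space M_simps by simp
    also have "\<dots> \<le> prob {s\<in>\<Omega>. LR s} + prob {s\<in>\<Omega>. TB (?f s)}"
      using sLR sTB' by (intro measure_Un_le) (simp_all add: M_simps)
    also have "prob {s\<in>\<Omega>. TB (?f s)} = prob {s\<in>\<Omega>. TB s}"
      by (rule prob_symmetry[OF flip.lattice_symmetry_axioms sTB])
    finally show ?thesis .
  qed
  ultimately show False by linarith
qed

lemma prob_T_axis:
  assumes "z \<in> {(1, 0), (0, 1), (-1, 0), (0, -1)}"
  shows "prob {s\<in>\<Omega>. c < T s 0 (site (sc n z))} = prob {s\<in>\<Omega>. c < T s 0 (site (sc n (1, 0)))}"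
proof -
  have rot: "prob {s\<in>\<Omega>. c < T s 0 (site (rot w))} = prob {s\<in>\<Omega>. c < T s 0 (site w)}" for w
    using prob_T_rot_gt[of c 0 "site w"] by (simp add: rotR_site linear_0[OF linear_rotR])
  have "sc n (0, 1) = rot (sc n (1, 0))" "sc n (-1, 0) = rot (rot (sc n (0, 1)))" "sc n (0, -1) = rot (sc n (-1, 0))"
    by (simp_all add: sc_def rot_def)
  then show ?thesis using assms rot by (elim insertE) simp_all
qed

lemma prob_T_axis_points:
  "\<exists>z\<in>{(1, 0), (0, 1), (-1, 0), (0, -1)}. (a, 0) = sc (int (nat \<bar>a\<bar>)) z"
  "\<exists>z\<in>{(1, 0), (0, 1), (-1, 0), (0, -1)}. (0, b) = sc (int (nat \<bar>b\<bar>)) z"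
  by (auto simp: sc_def)

text \<open>The point n v is within 2 of a lattice point reached by two axis-parallel legs. By
  rotation and translation invariance each leg has the law of a segment of the first axis, whose
  tail is summable.\<close>

lemma T_sublinear_bound:
  fixes v :: "real ^ 2"
  assumes "\<epsilon> > 0"
  shows "AE s in M. \<forall>\<^sub>F n in sequentially. T s 0 (real n *\<^sub>R v) \<le> \<epsilon> * real n"
proof -
  \<comment> \<open>Coordinates of v in the basis 1, exp(i pi/3).\<close>
  define \<beta>' where "\<beta>' = v $ 2 * 2 / sqrt 3"
  define \<alpha> where "\<alpha> = v $ 1 - \<beta>' / 2"
  \<comment> \<open>Bounds both coordinates with a margin of 1 for the floor, so each leg has at
    most D n steps.\<close>
  define D where "D = nat \<lceil>\<bar>\<alpha>\<bar> + \<bar>\<beta>'\<bar>\<rceil> + 1"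
  have D: "D \<ge> 1" "\<bar>\<alpha>\<bar> + 1 \<le> real D" "\<bar>\<beta>'\<bar> + 1 \<le> real D"
    unfolding D_def by linarith+
  define a where "a n = \<lfloor>real n * \<alpha>\<rfloor>" for n
  define b where "b n = \<lfloor>real n * \<beta>'\<rfloor>" for n
  have ab: "nat \<bar>a n\<bar> \<le> D * n" "nat \<bar>b n\<bar> \<le> D * n" if "n \<ge> 1" for n
  proof -
    have fl: "nat \<bar>\<lfloor>real n * t\<rfloor>\<bar> \<le> D * n" if t: "\<bar>t\<bar> + 1 \<le> real D" for t
    proof -
      have "\<bar>real n * t\<bar> + 1 \<le> real n * \<bar>t\<bar> + real n" using \<open>n \<ge> 1\<close> by (simp add: abs_mult)
      also have "\<dots> = real n * (\<bar>t\<bar> + 1)" by (simp add: algebra_simps)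
      also have "\<dots> \<le> real n * real D" using t by (intro mult_left_mono) auto
      finally have "\<bar>real n * t\<bar> + 1 \<le> real (D * n)" by (simp add: mult.commute)
      then have "real_of_int \<bar>\<lfloor>real n * t\<rfloor>\<bar> \<le> real (D * n)" by linarith
      then show ?thesis by linarith
    qed
    show "nat \<bar>a n\<bar> \<le> D * n" "nat \<bar>b n\<bar> \<le> D * n" unfolding a_def b_def using fl D by auto
  qed
  have near: "norm (real n *\<^sub>R v - site (a n, b n)) \<le> 2" for n
  proof -
    let ?x = "frac (real n * \<alpha>)" and ?y = "frac (real n * \<beta>')"
    have v: "v $ 1 = \<alpha> + \<beta>' / 2" "v $ 2 = \<beta>' * sqrt 3 / 2" by (simp_all add: \<alpha>_def \<beta>'_def)
    have xy: "0 \<le> ?x" "?x \<le> 1" "0 \<le> ?y" "?y \<le> 1" by (simp_all add: frac_lt_1 less_imp_le)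
    have "real n *\<^sub>R v - site (a n, b n) = ?x *\<^sub>R site (1, 0) + ?y *\<^sub>R site (0, 1)"
      by (simp add: vec_eq_iff forall_2 v a_def b_def frac_def algebra_simps)
    also have "norm \<dots> \<le> ?x * norm (site (1, 0)) + ?y * norm (site (0, 1))"
      using norm_triangle_ineq[of "?x *\<^sub>R site (1, 0)" "?y *\<^sub>R site (0, 1)"] xy by simp
    also have "\<dots> = ?x + ?y" by (simp add: norm_site_axis)
    finally show ?thesis using xy by linarith
  qed
  \<comment> \<open>The two legs cost 2 \<epsilon> n / 3 up to constants; the last third absorbs the
    constants for large n.\<close>
  define \<delta> where "\<delta> = \<epsilon> / (3 * real D)"
  have \<delta>: "\<delta> > 0" using assms D by (simp add: \<delta>_def)
  obtain N where N: "N \<ge> 1" "g (sc (int N) (1, 0)) < \<delta> * real N"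
    using expected_cost_sublinear[OF \<delta>] by blast
  have "(1, 0) \<noteq> (0 :: vertex)" by (simp add: zero_prod_def)
  then obtain Q \<rho> C where Q: "0 < \<rho>" "\<rho> < 1" "0 \<le> Q" "0 \<le> C"
    and tail: "\<And>n m. m \<le> n \<Longrightarrow> prob {s\<in>\<Omega>. \<delta> * real n + C < T s 0 (site (sc (int m) (1, 0)))} \<le> Q * \<rho> ^ n"
    using upper_tail[OF _ N] by blast
  define A where "A n = {s\<in>\<Omega>. \<delta> * real (D * n) + C < T s 0 (site (a n, 0))}" for n
  define B where "B n = {s\<in>\<Omega>. \<delta> * real (D * n) + C < T s (site (a n, 0)) (site (a n, b n))}" for n
  have sA: "A n \<in> sets M" and sB: "B n \<in> sets M" for n
    unfolding A_def B_def M_simps by (rule sets_T)+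
  have axis: "prob {s\<in>\<Omega>. \<delta> * real (D * n) + C < T s 0 (site w)} \<le> Q * \<rho> ^ n"
    if "\<exists>z\<in>{(1, 0), (0, 1), (-1, 0), (0, -1)}. w = sc (int m) z" "m \<le> D * n" for w m n
  proof -
    have "prob {s\<in>\<Omega>. \<delta> * real (D * n) + C < T s 0 (site w)} = prob {s\<in>\<Omega>. \<delta> * real (D * n) + C < T s 0 (site (sc (int m) (1, 0)))}"
      using that(1) prob_T_axis by blast
    also have "\<dots> \<le> Q * \<rho> ^ (D * n)" by (rule tail) (rule that)
    also have "\<dots> \<le> Q * \<rho> ^ n" using Q D(1) by (intro mult_left_mono power_decreasing) auto
    finally show ?thesis .
  qed
  have pA: "prob (A n) \<le> Q * \<rho> ^ n" if "n \<ge> 1" for n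
    unfolding A_def by (rule axis[OF prob_T_axis_points(1) ab(1)[OF that]])
  have pB: "prob (B n) \<le> Q * \<rho> ^ n" if "n \<ge> 1" for n
  proof -
    have "(a n, b n) = (0, b n) + (a n, 0)" by simp
    then have "B n = {s\<in>\<Omega>. \<delta> * real (D * n) + C < T s (0 + site (a n, 0)) (site (0, b n) + site (a n, 0))}"
      unfolding B_def by (simp only: site_add add_0)
    then have "prob (B n) = prob {s\<in>\<Omega>. \<delta> * real (D * n) + C < T s 0 (site (0, b n))}"
      by (simp only: prob_T_shift_gt)
    then show ?thesis using axis[OF prob_T_axis_points(2) ab(2)[OF that]] by simp
  qed
  have geo: "summable (\<lambda>n. 2 * (Q * \<rho> ^ n))"
    using Q by (intro summable_mult summable_geometric) auto
  have "summable (\<lambda>n. prob (A n \<union> B n))"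
  proof (rule summable_comparison_test'[OF geo, where N = 1])
    fix n :: nat assume n: "n \<ge> 1"
    have "prob (A n \<union> B n) \<le> prob (A n) + prob (B n)" by (rule measure_Un_le[OF sA sB])
    then show "norm (prob (A n \<union> B n)) \<le> 2 * (Q * \<rho> ^ n)" using pA[OF n] pB[OF n] by simp
  qed
  then have "AE s in M. \<forall>\<^sub>F n in sequentially. s \<in> space M - (A n \<union> B n)"
    using sA sB by (intro borel_cantelli_AE1) (auto simp: less_top[symmetric])
  then show ?thesis
  proof eventually_elim
    case (elim s)
    have "filterlim (\<lambda>n::nat. (\<epsilon> / 3) * real n) at_top sequentially"
      using assms by (intro filterlim_tendsto_pos_mult_at_top[OF tendsto_const] filterlim_real_sequentially) auto
    then have "\<forall>\<^sub>F n in sequentially. 2 * C + 2 \<le> \<epsilon> / 3 * real n"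
      unfolding filterlim_at_top by blast
    then show ?case using elim
    proof eventually_elim
      case (elim n)
      then have s: "s \<in> \<Omega>" "T s 0 (site (a n, 0)) \<le> \<delta> * real (D * n) + C"
        "T s (site (a n, 0)) (site (a n, b n)) \<le> \<delta> * real (D * n) + C"
        by (auto simp: A_def B_def M_simps not_less)
      have "T s (site (a n, b n)) (real n *\<^sub>R v) \<le> 2"
        using T_le[of s "site (a n, b n)" "real n *\<^sub>R v"] near[of n] by linarith
      then have "T s 0 (real n *\<^sub>R v) \<le> 2 * (\<delta> * real (D * n)) + (2 * C + 2)"
        using s T_triangle[of s 0 "real n *\<^sub>R v" "site (a n, b n)"] T_triangle[of s 0 "site (a n, b n)" "site (a n, 0)"]
        by linarith
      also have "\<delta> * real (D * n) = \<epsilon> / 3 * real n" using D(1) by (simp add: \<delta>_def)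
      finally show ?case using elim(1) by linarith
    qed
  qed
qed

theorem time_constant_zero: "has_time_constant M colouring (\<lambda>v. 0)"
  unfolding has_time_constant_def
proof (intro allI conjI)
  fix v :: "real ^ 2"
  have "AE s in M. \<forall>k::nat. \<forall>\<^sub>F n in sequentially. T s 0 (real n *\<^sub>R v) \<le> 1 / real (Suc k) * real n"
    unfolding AE_all_countable by (intro allI T_sublinear_bound) simp
  then show AE: "AE s in M. (\<lambda>n. T s 0 (real n *\<^sub>R v) / real n) \<longlonglongrightarrow> 0"
  proof eventually_elim
    case (elim s)
    show ?case
    proof (rule tendsto_0_if_small)
      fix e :: real assume e: "e > 0"
      obtain k where k: "1 / real (Suc k) < e" using nat_approx_posE[OF e] by blast
      have "\<forall>\<^sub>F n in sequentially. T s 0 (real n *\<^sub>R v) \<le> 1 / real (Suc k) * real n" using elim by blast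
      then show "\<forall>\<^sub>F n in sequentially. \<bar>T s 0 (real n *\<^sub>R v) / real n\<bar> < e"
        using eventually_gt_at_top[of 0]
      proof eventually_elim
        case (elim n)
        then have "T s 0 (real n *\<^sub>R v) / real n \<le> 1 / real (Suc k)" by (simp add: field_simps)
        then show ?case using k T_nonneg[of s 0 "real n *\<^sub>R v"] by simp
      qed
    qed
  qed
  show "integrable M (\<lambda>s. T s 0 (real n *\<^sub>R v))" for n by (rule integrable_T)
  have "(\<lambda>n. \<integral>s. \<bar>T s 0 (real n *\<^sub>R v) / real n - 0\<bar> \<partial>M) \<longlonglongrightarrow> (\<integral>s. 0 \<partial>M)"
  proof (rule integral_dominated_convergence[where w = "\<lambda>_. norm v"])
    show "(\<lambda>s. \<bar>T s 0 (real n *\<^sub>R v) / real n - 0\<bar>) \<in> borel_measurable M" for n by measurable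
    show "AE s in M. (\<lambda>n. \<bar>T s 0 (real n *\<^sub>R v) / real n - 0\<bar>) \<longlonglongrightarrow> 0"
      using AE
    proof eventually_elim
      case (elim s)
      from tendsto_rabs_zero[OF elim] show ?case by simp
    qed
    show "AE s in M. norm \<bar>T s 0 (real n *\<^sub>R v) / real n - 0\<bar> \<le> norm v" for n
    proof (rule AE_I2)
      fix s
      have "T s 0 (real n *\<^sub>R v) \<le> real n * norm v" using T_le[of s 0 "real n *\<^sub>R v"] by simp
      \<comment> \<open>For n = 0 the quotient is 0, division by zero being 0.\<close>
      then have "T s 0 (real n *\<^sub>R v) / real n \<le> norm v"
        by (cases "n = 0") (simp_all add: field_simps)
      then show "norm \<bar>T s 0 (real n *\<^sub>R v) / real n - 0\<bar> \<le> norm v"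
        using T_nonneg[of s 0 "real n *\<^sub>R v"] by simp
    qed
  qed auto
  then show "(\<lambda>n. \<integral>s. \<bar>T s 0 (real n *\<^sub>R v) / real n - 0\<bar> \<partial>M) \<longlonglongrightarrow> 0" by simp
qed

end

theorem corollary3p22:
  "\<exists>\<beta>\<^sub>0<0. \<forall>\<beta>::real. \<beta>\<^sub>0 < \<beta> \<and> \<beta> < ising_beta_c \<longrightarrow>
     (\<exists>!M. ising_gibbs \<beta> M) \<and>
     (\<forall>M. ising_gibbs \<beta> M \<longrightarrow> has_time_constant M colouring (\<lambda>v. 0))"
\<comment> \<open>The value -1/96 is the range in which \<open>dobrushin_unique\<close>
  applies.\<close>
proof (intro exI[of _ "- 1 / 96"] conjI allI impI)
  show "- 1 / 96 < (0::real)" by simp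
  fix \<beta> :: real assume \<beta>: "- 1 / 96 < \<beta> \<and> \<beta> < ising_beta_c"
  have uniq: "M = N" if "ising_gibbs \<beta> M" "ising_gibbs \<beta> N" for M N
  proof (cases "\<beta> < 0")
    case True
    then show ?thesis using dobrushin_unique[OF that] \<beta> by simp
  next
    case False
    show ?thesis
    proof (rule ccontr)
      assume "M \<noteq> N"
      \<comment> \<open>Two distinct Gibbs measures at \<beta> \<ge> 0 put \<beta> into the set
        whose infimum is \<open>ising_beta_c\<close>; the set is bounded below by 0.\<close>
      then have "ising_beta_c \<le> \<beta>"
        unfolding ising_beta_c_def using that False
        by (intro cInf_lower bdd_belowI[where m = 0]) auto
      with \<beta> show False by simp
    qed
  qed
  then show "\<exists>!M. ising_gibbs \<beta> M" using gibbs_exists[of \<beta>] by blast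
  fix M assume M: "ising_gibbs \<beta> M"
  interpret unique_gibbs \<beta> M by unfold_locales (auto intro: M uniq)
  show "has_time_constant M colouring (\<lambda>v. 0)" by (rule time_constant_zero)
qed

end
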